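(* Let $r\in[1,2)$, $\alpha>0$, and let $\pi^X\propto\exp(-f)$ be a probability distribution on $\mathbb{R}^d$ satisfying the Latała–Oleszkiewicz inequality of order $r$ and constant $\alpha$ ($(r,\alpha)$-LOI). For any $\eta>0$, $q\ge2$, any initial distribution $\rho_0^X$ and any integer $k\ge0$, the law $\rho_k^X$ of the $k$-th iterate of the proximal sampler with target $\pi^X$ and step size $\eta$ satisfies $$R_{q,\pi^X}(\rho_k^X)\le\begin{cases}\Bigl(R_{q,\pi^X}(\rho_0^X)^{2/r-1}-\dfrac{(2/r-1)\,k\log(1+\alpha\eta)}{68q}\Bigr)^{r/(2-r)}, & \text{if } k\le c_0,\\[2mm] \dfrac{1}{(1+\alpha\eta)^{(k-\lceil c_0\rceil)/(68q)}}, & \text{if } k\ge\lceil c_0\rceil,\end{cases}$$ where $$c_0:=\frac{68q}{(2/r-1)\log(1+\alpha\eta)}\,\bigl(R_{q,\pi^X}(\rho_0^X)^{2/r-1}-1\bigr).$$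
   Context: Probability measures are identified with their Lebesgue densities when these exist. The target $\pi^X\propto \exp(-f)$, $f:\mathbb{R}^d\to\mathbb{R}$, is assumed to have finite second moment. Proximal sampler with step size $\eta>0$: define the joint probability density on $\mathbb{R}^d\times\mathbb{R}^d$ by $\pi(x,y)\propto \exp(-f(x)-\frac{1}{2\eta}\|x-y\|^2)$. Its conditionals are $\pi^{Y\mid X}(\cdot\mid x)=\mathcal N(x,\eta I)$ and $\pi^{X\mid Y}(x\mid y)\propto_x \exp(-f(x)-\frac1{2\eta}\|x-y\|^2)$, and its $X$-marginal is $\pi^X$. Starting from $x_0\sim\rho_0^X$, for $k=0,1,2,\dots$: draw $y_k\mid x_k\sim\pi^{Y\mid X}(\cdot\mid x_k)$, then draw $x_{k+1}\mid y_k\sim \pi^{X\mid Y}(\cdot\mid y_k)$ (exactly). $\rho_k^X$ denotes the law of $x_k$. Rényi divergence of order $q>1$: $R_{q,\pi}(\rho)=\frac1{q-1}\log\int\frac{\rho^q}{\pi^{q-1}}$ for $\rho\ll\pi$ (and $+\infty$ if $\rho\not\ll\pi$). Latała–Oleszkiewicz inequality: $\pi$ satisfies $(r,\alpha)$-LOI, with $r\in[1,2]$ and $\alpha>0$, if for any smooth bounded $\psi:\mathbb{R}^d\to\mathbb{R}_+$, $$\sup_{p\in(1,2)}\frac{\mathbb{E}_\pi[\psi^2]-\mathbb{E}_\pi[\psi^p]^{2/p}}{(2-p)^{2(1-1/r)}}\le\frac1\alpha\,\mathbb{E}_\pi[\|\nabla\psi\|^2].$$ *)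

theory Defs
  imports "HOL-Probability.Probability"
begin

(* The probability measure with Lebesgue density proportional to exp (- V).
   It is meaningful when exp (- V) is Lebesgue integrable. *)
definition gibbs :: "('a::euclidean_space \<Rightarrow> real) \<Rightarrow> 'a measure" where
  "gibbs V = density lborel (\<lambda>x. ennreal (exp (- V x) / (\<integral>z. exp (- V z) \<partial>lborel)))"

(* The normal distribution with mean x and covariance \<eta> I; normal_density takes the
   standard deviation as its second argument. *)
definition isotropic_gaussian :: "real \<Rightarrow> 'a::euclidean_space \<Rightarrow> 'a measure" where
  "isotropic_gaussian \<eta> x =
     density lborel (\<lambda>y. ennreal (\<Prod>b\<in>Basis. normal_density (x \<bullet> b) (sqrt \<eta>) (y \<bullet> b)))"

(* The two conditionals of the joint density proportional to
   exp (- f x - (norm (x - y))^2 / (2 * \<eta>)). *)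
definition prox_forward :: "real \<Rightarrow> 'a::euclidean_space \<Rightarrow> 'a measure" where
  "prox_forward \<eta> x = isotropic_gaussian \<eta> x"

definition prox_backward :: "('a::euclidean_space \<Rightarrow> real) \<Rightarrow> real \<Rightarrow> 'a \<Rightarrow> 'a measure" where
  "prox_backward f \<eta> y = gibbs (\<lambda>x. f x + (norm (x - y))\<^sup>2 / (2 * \<eta>))"

primrec prox_law ::
  "('a::euclidean_space \<Rightarrow> real) \<Rightarrow> real \<Rightarrow> 'a measure \<Rightarrow> nat \<Rightarrow> 'a measure" where
  "prox_law f \<eta> \<rho>0 0 = \<rho>0"
| "prox_law f \<eta> \<rho>0 (Suc k) =
     (prox_law f \<eta> \<rho>0 k \<bind> prox_forward \<eta>) \<bind> prox_backward f \<eta>"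

definition lebesgue_density :: "'a::euclidean_space measure \<Rightarrow> 'a \<Rightarrow> real" where
  "lebesgue_density \<mu> x = enn2real (RN_deriv lborel \<mu> x)"

(* For \<pi> with a Lebesgue density: absolute continuity of \<rho> with respect to \<pi> then also
   provides a Lebesgue density of \<rho>, vanishing almost everywhere where that of \<pi> does, so
   that the convention x / 0 = 0 is harmless. The integral may be infinite. *)
definition renyi_integral :: "real \<Rightarrow> 'a::euclidean_space measure \<Rightarrow> 'a measure \<Rightarrow> ennreal" where
  "renyi_integral q \<pi> \<rho> =
     (\<integral>\<^sup>+x. ennreal (lebesgue_density \<rho> x powr q / lebesgue_density \<pi> x powr (q - 1)) \<partial>lborel)"

definition renyi :: "real \<Rightarrow> 'a::euclidean_space measure \<Rightarrow> 'a measure \<Rightarrow> ereal" where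
  "renyi q \<pi> \<rho> =
     (if absolutely_continuous \<pi> \<rho> \<and> renyi_integral q \<pi> \<rho> < \<infinity>
      then ereal (1 / (q - 1) * ln (enn2real (renyi_integral q \<pi> \<rho>)))
      else \<infinity>)"

(* Powers of extended nonnegative numbers with a positive exponent. *)
definition epowr :: "ereal \<Rightarrow> real \<Rightarrow> ereal" where
  "epowr x a = (if x = \<infinity> then \<infinity> else ereal (real_of_ereal x powr a))"

primrec C_k :: "nat \<Rightarrow> ('a::euclidean_space \<Rightarrow> real) \<Rightarrow> bool" where
  "C_k 0 g \<longleftrightarrow> continuous_on UNIV g"
| "C_k (Suc n) g \<longleftrightarrow>
     (\<forall>x. g differentiable (at x)) \<and> (\<forall>v. C_k n (\<lambda>x. frechet_derivative g (at x) v))"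

definition smooth :: "('a::euclidean_space \<Rightarrow> real) \<Rightarrow> bool" where
  "smooth g \<longleftrightarrow> (\<forall>n. C_k n g)"

definition gradient :: "('a::euclidean_space \<Rightarrow> real) \<Rightarrow> 'a \<Rightarrow> 'a" where
  "gradient g x = (\<Sum>b\<in>Basis. frechet_derivative g (at x) b *\<^sub>R b)"

(* The right-hand side is infinite when the gradient of \<psi> is not square integrable. *)
definition latala_oleszkiewicz :: "'a::euclidean_space measure \<Rightarrow> real \<Rightarrow> real \<Rightarrow> bool" where
  "latala_oleszkiewicz \<pi> r \<alpha> \<longleftrightarrow>
     (\<forall>\<psi>. smooth \<psi> \<and> bounded (range \<psi>) \<and> (\<forall>x. 0 \<le> \<psi> x) \<longrightarrow>
        (SUP p\<in>{1<..<2::real}.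
           ereal (((\<integral>x. (\<psi> x)\<^sup>2 \<partial>\<pi>) - (\<integral>x. \<psi> x powr p \<partial>\<pi>) powr (2 / p))
                  / (2 - p) powr (2 * (1 - 1 / r))))
        \<le> ereal (1 / \<alpha>) * enn2ereal (\<integral>\<^sup>+x. ennreal ((norm (gradient \<psi> x))\<^sup>2) \<partial>\<pi>))"

end

theory Submission
  imports Defs
begin

text \<open>
  An iteration of the sampler acts on densities relative to the target $\pi$. If the current law
  is $h\pi$, the law after the forward step has density $g(y) = E[h(X) \mid Y = y]$ relative to the
  smoothed target, and the law after the backward step has density $Pg$ relative to $\pi$, where
  $Pv(x)$ is the mean of $v$ under the normal law $N(x, \eta I)$. By Jensen's inequality the forward
  step does not increase $\int h^q$, so the theorem is about the gap between
  $G = \int P(g^q)\,d\pi$ and $F = \int (Pg)^q\,d\pi$. This gap is bounded directly, for the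
  whole step at once, without differentiating along the heat flow.

  For $\kappa > 1$ and $v \ge 0$, writing $w = Pv$, the Gaussian Jensen gap is controlled from
  below by the gradient (\<open>gauss_avg_powr_gradient\<close>):
  \[ P(v^\kappa) \ge w^\kappa \exp(\tfrac12 (\kappa-1)\eta |\nabla\log w|^2). \]
  For $2 \le \kappa \le q$ take $v = g^{q/\kappa}$ and $\psi = w^{\kappa/2}$. Then
  $A = \int \psi^2 d\pi$ lies between $F$ and $G$, and the convexity of the exponential gives
  $A \log(G/A) \ge 2(\kappa-1)\eta\kappa^{-2} \int |\nabla\psi|^2 d\pi$. The functional inequality for
  $\psi$ with exponent $p = 2 - t$ bounds $\int|\nabla\psi|^2$ from below by
  $A - (\int \psi^p)^{2/p}$, and Hoelder interpolation bounds the subtracted term by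
  $A \exp(-\frac{t}{2-t}(R - D/(\kappa-1)))$ with $R = \log G/(q-1)$ and $D = \log(G/A)$.
  The outcome (\<open>dissipation_bounded\<close>, \<open>dissipation\<close>) is an implicit inequality for $D$,
  for all $t \in (0,1)$ and $\kappa \in [2,q]$; it is monotone in $D$, so $A$ may be
  replaced by $F$.

  The rest is calculus. Choosing $t$ inversely proportional to the maximum of 1 and the
  divergence turns the inequality into a form of the implicit Euler step for
  $\dot R = -\mathrm{const}\cdot R^{2-2/r}$ when $R \ge 1$ and $\dot R = -\mathrm{const}\cdot R$ when $R \le 1$. The function \<open>decay_clock\<close> straightens
  this equation, and \<open>decay_clock_step\<close> shows that it drops by at least
  $\log(1+\alpha\eta)/(68q)$ per iteration. The parameter $\kappa$ matters here: a given $\kappa$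
  cannot show a drop of the divergence beyond the fraction $(\kappa-1)/(q-1)$, so $\kappa = 2$
  serves only while $\log(1+\alpha\eta)$ is bounded, and larger step sizes call for larger
  $\kappa$. The price, a factor $\kappa^{-2}$ in the rate, is then compensated by the size of
  $\alpha\eta$.
\<close>

section \<open>Gaussian kernels and exponential tilting\<close>

definition gauss_const :: "'a::euclidean_space itself \<Rightarrow> real \<Rightarrow> real" where
  "gauss_const _ \<eta> = (1 / sqrt (2 * pi * \<eta>)) ^ DIM('a)"

definition gauss_kernel :: "real \<Rightarrow> 'a::euclidean_space \<Rightarrow> 'a \<Rightarrow> real" where
  "gauss_kernel \<eta> x y = gauss_const TYPE('a) \<eta> * exp (- (norm (y - x))\<^sup>2 / (2 * \<eta>))"

lemma gauss_const_pos: "\<eta> > 0 \<Longrightarrow> gauss_const TYPE('a::euclidean_space) \<eta> > 0"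
  by (simp add: gauss_const_def)

lemma gauss_kernel_pos: "\<eta> > 0 \<Longrightarrow> gauss_kernel \<eta> x y > 0"
  by (simp add: gauss_kernel_def gauss_const_pos)

lemma gauss_kernel_measurable [measurable]:
  assumes [measurable]: "f \<in> borel_measurable M" "g \<in> borel_measurable M"
  shows "(\<lambda>z. gauss_kernel \<eta> (f z) (g z :: 'a::euclidean_space)) \<in> borel_measurable M"
  unfolding gauss_kernel_def by measurable

lemma prod_normal_density_eq_gauss_kernel:
  fixes x y :: "'a::euclidean_space"
  assumes "\<eta> > 0"
  shows "(\<Prod>b\<in>Basis. normal_density (x \<bullet> b) (sqrt \<eta>) (y \<bullet> b)) = gauss_kernel \<eta> x y"
proof -
  have sq: "(norm (y - x))\<^sup>2 = (\<Sum>b\<in>Basis. (y \<bullet> b - x \<bullet> b)\<^sup>2)"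
    by (subst power2_norm_eq_inner, subst euclidean_inner) (simp add: power2_eq_square inner_diff_left)
  have "(\<Prod>b\<in>Basis. normal_density (x \<bullet> b) (sqrt \<eta>) (y \<bullet> b))
      = (\<Prod>b\<in>(Basis::'a set). (1 / sqrt (2 * pi * \<eta>)) * exp (- (y \<bullet> b - x \<bullet> b)\<^sup>2 / (2 * \<eta>)))"
    using assms by (simp add: normal_density_def)
  also have "\<dots> = gauss_const TYPE('a) \<eta> * exp (\<Sum>b\<in>(Basis::'a set). - (y \<bullet> b - x \<bullet> b)\<^sup>2 / (2 * \<eta>))"
    unfolding prod.distrib gauss_const_def by (simp add: exp_sum)
  also have "(\<Sum>b\<in>(Basis::'a set). - (y \<bullet> b - x \<bullet> b)\<^sup>2 / (2 * \<eta>)) = - (norm (y - x))\<^sup>2 / (2 * \<eta>)"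
    unfolding sq by (simp add: sum_negf sum_divide_distrib[symmetric])
  finally show ?thesis by (simp add: gauss_kernel_def)
qed

lemma isotropic_gaussian_eq:
  "\<eta> > 0 \<Longrightarrow> isotropic_gaussian \<eta> x = density lborel (\<lambda>y. ennreal (gauss_kernel \<eta> x y))"
  unfolding isotropic_gaussian_def by (simp add: prod_normal_density_eq_gauss_kernel)

lemma nn_integral_gauss_kernel:
  fixes x :: "'a::euclidean_space"
  assumes "\<eta> > 0"
  shows "(\<integral>\<^sup>+y. ennreal (gauss_kernel \<eta> x y) \<partial>lborel) = 1"
proof -
  have "(\<integral>\<^sup>+y. ennreal (gauss_kernel \<eta> x y) \<partial>lborel)
      = (\<integral>\<^sup>+y. (\<Prod>b\<in>Basis. ennreal (normal_density (x \<bullet> b) (sqrt \<eta>) (y \<bullet> b))) \<partial>lborel)"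
    by (simp add: prod_ennreal flip: prod_normal_density_eq_gauss_kernel[OF assms])
  also have "\<dots> = (\<Prod>b\<in>(Basis::'a set). \<integral>\<^sup>+u. ennreal (normal_density (x \<bullet> b) (sqrt \<eta>) u) \<partial>lborel)"
    by (intro nn_integral_lborel_prod) auto
  also have "\<dots> = 1"
  proof (intro prod.neutral ballI)
    fix b :: 'a
    have "emeasure (density lborel (normal_density (x \<bullet> b) (sqrt \<eta>))) UNIV = 1"
      using prob_space.emeasure_space_1[OF prob_space_normal_density[of "sqrt \<eta>" "x \<bullet> b"]] assms by simp
    then show "(\<integral>\<^sup>+u. ennreal (normal_density (x \<bullet> b) (sqrt \<eta>) u) \<partial>lborel) = 1"
      by (simp add: emeasure_density)
  qed
  finally show ?thesis .
qed

lemma integrable_gauss_kernel: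
  "\<eta> > 0 \<Longrightarrow> integrable lborel (gauss_kernel \<eta> (x::'a::euclidean_space))"
  by (rule integrableI_nonneg) (auto simp: nn_integral_gauss_kernel less_imp_le[OF gauss_kernel_pos])

lemma prob_space_isotropic_gaussian:
  "\<eta> > 0 \<Longrightarrow> prob_space (isotropic_gaussian \<eta> (x::'a::euclidean_space))"
  by (rule prob_spaceI)
     (simp add: isotropic_gaussian_eq emeasure_density nn_integral_gauss_kernel)

lemma sets_isotropic_gaussian [simp, measurable_cong]:
  "sets (isotropic_gaussian \<eta> x) = sets borel"
  by (simp add: isotropic_gaussian_def)

lemma space_isotropic_gaussian [simp]: "space (isotropic_gaussian \<eta> x) = UNIV"
  by (simp add: isotropic_gaussian_def)

lemma integral_isotropic_gaussian:
  fixes v :: "'a::euclidean_space \<Rightarrow> real"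
  assumes "\<eta> > 0" and [measurable]: "v \<in> borel_measurable borel"
  shows "(\<integral>y. v y \<partial>isotropic_gaussian \<eta> x) = (\<integral>y. gauss_kernel \<eta> x y * v y \<partial>lborel)"
  unfolding isotropic_gaussian_eq[OF assms(1)]
  by (subst integral_density) (auto simp: less_imp_le[OF gauss_kernel_pos] assms)

lemma integrable_isotropic_gaussian_iff:
  fixes v :: "'a::euclidean_space \<Rightarrow> real"
  assumes "\<eta> > 0" and [measurable]: "v \<in> borel_measurable borel"
  shows "integrable (isotropic_gaussian \<eta> x) v \<longleftrightarrow> integrable lborel (\<lambda>y. gauss_kernel \<eta> x y * v y)"
  unfolding isotropic_gaussian_eq[OF assms(1)]
  by (subst integrable_density) (auto simp: less_imp_le[OF gauss_kernel_pos] assms)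

text \<open>
  Completing the square: an exponential tilt of a Gaussian is a multiple of a shifted
  Gaussian. This yields the moment generating function below.
\<close>

lemma gauss_kernel_tilt:
  fixes x y l :: "'a::euclidean_space"
  assumes "\<eta> > 0"
  shows "gauss_kernel \<eta> x y * exp (l \<bullet> (y - x))
       = exp (\<eta> * (norm l)\<^sup>2 / 2) * gauss_kernel \<eta> (x + \<eta> *\<^sub>R l) y"
proof -
  have n: "(norm (y - (x + \<eta> *\<^sub>R l)))\<^sup>2 = (norm (y - x))\<^sup>2 - 2 * \<eta> * (l \<bullet> (y - x)) + \<eta>\<^sup>2 * (norm l)\<^sup>2"
    unfolding power2_norm_eq_inner
    by (simp add: inner_diff_left inner_diff_right inner_add_left inner_add_right
        inner_commute power2_eq_square algebra_simps)
  have "exp (- (norm (y - x))\<^sup>2 / (2 * \<eta>)) * exp (l \<bullet> (y - x))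
      = exp (\<eta> * (norm l)\<^sup>2 / 2) * exp (- (norm (y - (x + \<eta> *\<^sub>R l)))\<^sup>2 / (2 * \<eta>))"
    unfolding n exp_add[symmetric] using assms
    by (intro arg_cong[of _ _ exp]) (simp add: field_simps power2_eq_square)
  then show ?thesis unfolding gauss_kernel_def by (simp add: mult.assoc mult.left_commute)
qed

lemma gauss_mgf:
  fixes x l :: "'a::euclidean_space"
  assumes "\<eta> > 0"
  shows "integrable (isotropic_gaussian \<eta> x) (\<lambda>y. exp (l \<bullet> (y - x)))"
    and "(\<integral>y. exp (l \<bullet> (y - x)) \<partial>isotropic_gaussian \<eta> x) = exp (\<eta> * (norm l)\<^sup>2 / 2)"
proof -
  have one: "(\<integral>y. gauss_kernel \<eta> z y \<partial>lborel) = 1" for z :: 'a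
    by (subst integral_eq_nn_integral)
       (auto simp: nn_integral_gauss_kernel assms less_imp_le[OF gauss_kernel_pos])
  show "integrable (isotropic_gaussian \<eta> x) (\<lambda>y. exp (l \<bullet> (y - x)))"
    by (subst integrable_isotropic_gaussian_iff[OF assms])
       (simp_all add: gauss_kernel_tilt[OF assms] integrable_gauss_kernel[OF assms])
  show "(\<integral>y. exp (l \<bullet> (y - x)) \<partial>isotropic_gaussian \<eta> x) = exp (\<eta> * (norm l)\<^sup>2 / 2)"
    by (subst integral_isotropic_gaussian[OF assms]) (simp_all add: gauss_kernel_tilt[OF assms] one)
qed

section \<open>Smoothness of Laplace transforms and of positive powers\<close>

text \<open>
  The conditions for \<open>C_k\<close> can be checked with any family of derivatives, which
  avoids computing \<open>frechet_derivative\<close>.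
\<close>

lemma C_k_SucI:
  assumes "\<And>x. (g has_derivative g' x) (at x)" and "\<And>v. C_k n (\<lambda>x. g' x v)"
  shows "C_k (Suc n) g"
proof -
  have "frechet_derivative g (at x) = g' x" for x
    using frechet_derivative_at[OF assms(1)] by simp
  then show ?thesis using assms by (auto simp: differentiable_def)
qed

lemma C_k_Suc_has_derivative:
  "C_k (Suc n) g \<Longrightarrow> (g has_derivative frechet_derivative g (at x)) (at x)"
  by (simp add: frechet_derivative_works)

lemma C_k_Suc_imp: "C_k (Suc n) g \<Longrightarrow> C_k n g"
proof (induction n arbitrary: g)
  case 0
  then show ?case
    by (auto intro!: continuous_at_imp_continuous_on differentiable_imp_continuous_within)
next
  case (Suc n)
  then show ?case by (metis C_k.simps(2))
qed

lemma C_k_const: "C_k n (\<lambda>x. c)"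
proof (induction n arbitrary: c)
  case (Suc n)
  show ?case by (rule C_k_SucI[where g' = "\<lambda>x v. 0"]) (auto intro: Suc)
qed simp

lemma C_k_inner: "C_k n (\<lambda>x. x \<bullet> b)"
proof (cases n)
  case (Suc m)
  show ?thesis unfolding Suc
    by (rule C_k_SucI[where g' = "\<lambda>x v. v \<bullet> b"]) (auto intro!: C_k_const derivative_eq_intros)
qed (auto intro!: continuous_intros)

lemma C_k_add: "C_k n g \<Longrightarrow> C_k n h \<Longrightarrow> C_k n (\<lambda>x. g x + h x)"
proof (induction n arbitrary: g h)
  case (Suc n)
  show ?case
    by (rule C_k_SucI[OF has_derivative_add[OF Suc.prems[THEN C_k_Suc_has_derivative]]])
       (use Suc in auto)
qed (auto intro: continuous_on_add)

lemma C_k_mult: "C_k n g \<Longrightarrow> C_k n h \<Longrightarrow> C_k n (\<lambda>x. g x * h x)"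
proof (induction n arbitrary: g h)
  case (Suc n)
  show ?case
    by (rule C_k_SucI[OF has_derivative_mult[OF Suc.prems[THEN C_k_Suc_has_derivative]]])
       (use Suc.prems in \<open>auto intro!: C_k_add Suc.IH C_k_Suc_imp[OF Suc.prems(1)] C_k_Suc_imp[OF Suc.prems(2)]\<close>)
qed (auto intro: continuous_on_mult)

lemma C_k_exp_neg_norm_sq: "C_k n (\<lambda>x::'a::euclidean_space. exp (- c * (norm x)\<^sup>2))"
proof (induction n)
  case (Suc n)
  show ?case
  proof (rule C_k_SucI[where g' = "\<lambda>x v. (- 2 * c) * ((x \<bullet> v) * exp (- c * (norm x)\<^sup>2))"])
    show "((\<lambda>x. exp (- c * (norm x)\<^sup>2)) has_derivative
            (\<lambda>v. (- 2 * c) * ((x \<bullet> v) * exp (- c * (norm x)\<^sup>2)))) (at x)" for x :: 'a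
      unfolding power2_norm_eq_inner
      by (auto intro!: derivative_eq_intros simp: inner_commute algebra_simps fun_eq_iff)
    show "C_k n (\<lambda>x. (- 2 * c) * ((x \<bullet> v) * exp (- c * (norm x)\<^sup>2)))" for v :: 'a
      by (intro C_k_mult C_k_const C_k_inner Suc)
  qed
qed (auto intro!: continuous_intros)

lemma has_derivative_powr_const:
  fixes g :: "'a::real_normed_vector \<Rightarrow> real"
  assumes "(g has_derivative g') (at x)" "g x > 0"
  shows "((\<lambda>x. g x powr c) has_derivative (\<lambda>v. c * (g x powr (c - 1) * g' v))) (at x)"
  using has_derivative_powr[OF assms(1) has_derivative_const assms(2), of c]
  by (simp add: powr_diff mult_ac abs_of_pos[OF assms(2)])

lemma C_k_powr: "C_k n g \<Longrightarrow> (\<And>x. g x > 0) \<Longrightarrow> C_k n (\<lambda>x. g x powr c)"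
proof (induction n arbitrary: c)
  case 0
  then show ?case by (auto intro!: continuous_intros simp: less_imp_neq[symmetric])
next
  case (Suc n)
  show ?case
    by (rule C_k_SucI[OF has_derivative_powr_const[OF C_k_Suc_has_derivative[OF Suc.prems(1)] Suc.prems(2)]])
       (use Suc.prems in \<open>auto intro!: C_k_mult C_k_const Suc.IH[OF C_k_Suc_imp[OF Suc.prems(1)]]\<close>)
qed

text \<open>
  Used to differentiate under an integral sign: a bound on the integrand that is quadratic in
  the increment can be integrated.
\<close>

lemma has_derivative_quadratic_remainder:
  fixes f :: "'a::real_normed_vector \<Rightarrow> real"
  assumes "bounded_linear D"
    and bd: "\<And>h. norm h \<le> 1 \<Longrightarrow> \<bar>f (x + h) - f x - D h\<bar> \<le> C * (norm h)\<^sup>2"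
  shows "(f has_derivative D) (at x)"
  unfolding has_derivative_at
proof (intro conjI assms(1))
  have "((\<lambda>h::'a. \<bar>C\<bar> * norm h) \<longlongrightarrow> \<bar>C\<bar> * norm (0::'a)) (at 0)"
    by (intro tendsto_intros)
  then have lim: "((\<lambda>h::'a. \<bar>C\<bar> * norm h) \<longlongrightarrow> 0) (at 0)" by simp
  show "((\<lambda>h. norm (f (x + h) - f x - D h) / norm h) \<longlongrightarrow> 0) (at 0)"
  proof (rule Lim_null_comparison[OF _ lim])
    have "\<forall>\<^sub>F h::'a in at 0. norm h < 1"
      unfolding eventually_at by (rule exI[of _ 1]) (simp add: dist_norm)
    then show "\<forall>\<^sub>F h in at 0. norm (norm (f (x + h) - f x - D h) / norm h) \<le> \<bar>C\<bar> * norm h"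
    proof eventually_elim
      case (elim h)
      have "\<bar>f (x + h) - f x - D h\<bar> \<le> \<bar>C\<bar> * (norm h)\<^sup>2"
        using bd[of h] elim by (smt (verit) mult_right_mono zero_le_power2)
      then show ?case by (cases "h = 0") (auto simp: divide_le_eq power2_eq_square mult.assoc)
    qed
  qed
qed

text \<open>
  A class of functions that is closed under multiplication by linear functionals, so that
  their Laplace transforms can be differentiated any number of times.
\<close>

definition exp_integrable :: "('a::euclidean_space \<Rightarrow> real) \<Rightarrow> bool" where
  "exp_integrable u \<longleftrightarrow> u \<in> borel_measurable borel \<and>
     (\<forall>c. integrable lborel (\<lambda>y. exp (c * norm y) * \<bar>u y\<bar>))"

definition laplace :: "real \<Rightarrow> ('a::euclidean_space \<Rightarrow> real) \<Rightarrow> 'a \<Rightarrow> real" where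
  "laplace c u x = (\<integral>y. exp (c * (x \<bullet> y)) * u y \<partial>lborel)"

lemma exp_integrable_inner_mult:
  fixes u :: "'a::euclidean_space \<Rightarrow> real"
  assumes "exp_integrable u"
  shows "exp_integrable (\<lambda>y. c * ((v \<bullet> y) * u y))"
proof -
  have [measurable]: "u \<in> borel_measurable borel" using assms by (simp add: exp_integrable_def)
  have "integrable lborel (\<lambda>y. exp (d * norm y) * \<bar>c * ((v \<bullet> y) * u y)\<bar>)" for d
  proof (rule Bochner_Integration.integrable_bound)
    show "integrable lborel (\<lambda>y. \<bar>c\<bar> * norm v * (exp ((d + 1) * norm y) * \<bar>u y\<bar>))"
      using assms by (simp add: exp_integrable_def)
    have "norm (exp (d * norm y) * \<bar>c * ((v \<bullet> y) * u y)\<bar>)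
         \<le> norm (\<bar>c\<bar> * norm v * (exp ((d + 1) * norm y) * \<bar>u y\<bar>))" for y
    proof -
      have "\<bar>v \<bullet> y\<bar> \<le> norm v * norm y" by (rule Cauchy_Schwarz_ineq2)
      also have "norm y \<le> exp (norm y)" by (metis exp_ge_add_one_self add.commute le_add_same_cancel1 order_trans zero_le_one)
      finally have "\<bar>v \<bullet> y\<bar> \<le> norm v * exp (norm y)" by (simp add: mult_left_mono)
      then have "exp (d * norm y) * \<bar>c\<bar> * \<bar>u y\<bar> * \<bar>v \<bullet> y\<bar> \<le> exp (d * norm y) * \<bar>c\<bar> * \<bar>u y\<bar> * (norm v * exp (norm y))"
        by (intro mult_left_mono) auto
      then show ?thesis by (simp add: abs_mult exp_add ring_distribs mult_ac)
    qed
    then show "AE y in lborel. norm (exp (d * norm y) * \<bar>c * ((v \<bullet> y) * u y)\<bar>)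
         \<le> norm (\<bar>c\<bar> * norm v * (exp ((d + 1) * norm y) * \<bar>u y\<bar>))" by simp
  qed simp
  then show ?thesis by (simp add: exp_integrable_def)
qed

lemma integrable_laplace:
  fixes u :: "'a::euclidean_space \<Rightarrow> real"
  assumes "exp_integrable u"
  shows "integrable lborel (\<lambda>y. exp (c * (x \<bullet> y)) * u y)"
proof -
  have [measurable]: "u \<in> borel_measurable borel" using assms by (simp add: exp_integrable_def)
  show ?thesis
  proof (rule Bochner_Integration.integrable_bound)
    show "integrable lborel (\<lambda>y. exp ((\<bar>c\<bar> * norm x) * norm y) * \<bar>u y\<bar>)"
      using assms by (simp add: exp_integrable_def)
    have "c * (x \<bullet> y) \<le> \<bar>c\<bar> * norm x * norm y" for y
    proof -
      have "c * (x \<bullet> y) \<le> \<bar>c\<bar> * \<bar>x \<bullet> y\<bar>" by (metis abs_ge_self abs_mult)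
      also have "\<dots> \<le> \<bar>c\<bar> * (norm x * norm y)" by (intro mult_left_mono Cauchy_Schwarz_ineq2) auto
      finally show ?thesis by (simp add: mult.assoc)
    qed
    then show "AE y in lborel. norm (exp (c * (x \<bullet> y)) * u y) \<le> norm (exp ((\<bar>c\<bar> * norm x) * norm y) * \<bar>u y\<bar>)"
      by (auto simp: abs_mult intro!: mult_right_mono)
  qed simp
qed

lemma exp_remainder: "\<bar>exp z - 1 - z\<bar> \<le> z\<^sup>2 * exp \<bar>z\<bar>" for z :: real
proof -
  obtain t where t: "\<bar>t\<bar> \<le> \<bar>z\<bar>" "exp z = (\<Sum>m<2. z ^ m / fact m) + exp t / fact 2 * z ^ 2"
    using Maclaurin_exp_le[of z 2] by blast
  then have "exp z - 1 - z = exp t / 2 * z\<^sup>2" by (simp add: numeral_2_eq_2)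
  moreover have "exp t / 2 \<le> exp \<bar>z\<bar>" using t(1) by (smt (verit) exp_le_cancel_iff exp_gt_zero field_sum_of_halves)
  ultimately have "\<bar>exp z - 1 - z\<bar> \<le> exp \<bar>z\<bar> * z\<^sup>2"
    by (simp only: abs_mult) (intro mult_mono, auto)
  then show ?thesis by (simp add: mult.commute)
qed

lemma laplace_has_derivative:
  fixes u :: "'a::euclidean_space \<Rightarrow> real"
  assumes u: "exp_integrable u"
  shows "(laplace c u has_derivative (\<lambda>v. laplace c (\<lambda>y. c * ((v \<bullet> y) * u y)) x)) (at x)"
proof -
  have [measurable]: "u \<in> borel_measurable borel" using u by (simp add: exp_integrable_def)
  define D where "D v = laplace c (\<lambda>y. c * ((v \<bullet> y) * u y)) x" for v
  have intD: "integrable lborel (\<lambda>y. exp (c * (x \<bullet> y)) * (c * ((v \<bullet> y) * u y)))" for v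
    by (rule integrable_laplace[OF exp_integrable_inner_mult[OF u]])
  have lin: "linear D"
  proof
    show "D (v + w) = D v + D w" for v w
      unfolding D_def laplace_def
      by (subst Bochner_Integration.integral_add[symmetric, OF intD intD])
         (auto intro!: Bochner_Integration.integral_cong simp: inner_add_left algebra_simps)
    show "D (a *\<^sub>R v) = a *\<^sub>R D v" for a v
      unfolding D_def laplace_def
      by (subst integral_scaleR_right[symmetric])
         (auto intro!: Bochner_Integration.integral_cong simp: algebra_simps)
  qed
  define b where "b = \<bar>c\<bar> * (norm x + 1) + 1"
  define C where "C = (\<integral>y. 2 * c\<^sup>2 * (exp (b * norm y) * \<bar>u y\<bar>) \<partial>lborel)"
  have intC: "integrable lborel (\<lambda>y. 2 * c\<^sup>2 * (exp (b * norm y) * \<bar>u y\<bar>))"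
    using u by (simp add: exp_integrable_def)
  show ?thesis
    unfolding D_def[symmetric]
  proof (rule has_derivative_quadratic_remainder)
    show "bounded_linear D" using lin by (rule linear_conv_bounded_linear[THEN iffD1])
  next
    fix h :: 'a assume h: "norm h \<le> 1"
    have i1: "integrable lborel (\<lambda>y. exp (c * ((x + h) \<bullet> y)) * u y)"
         and i2: "integrable lborel (\<lambda>y. exp (c * (x \<bullet> y)) * u y)"
      by (rule integrable_laplace[OF u])+
    have eq: "laplace c u (x + h) - laplace c u x - D h
        = (\<integral>y. exp (c * ((x + h) \<bullet> y)) * u y - exp (c * (x \<bullet> y)) * u y
              - exp (c * (x \<bullet> y)) * (c * ((h \<bullet> y) * u y)) \<partial>lborel)"
      unfolding D_def laplace_def
      by (simp only: Bochner_Integration.integral_diff[OF i1 i2]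
          Bochner_Integration.integral_diff[OF Bochner_Integration.integrable_diff[OF i1 i2] intD])
    have ptw: "\<bar>exp (c * ((x + h) \<bullet> y)) * u y - exp (c * (x \<bullet> y)) * u y
              - exp (c * (x \<bullet> y)) * (c * ((h \<bullet> y) * u y))\<bar>
           \<le> (norm h)\<^sup>2 * (2 * c\<^sup>2 * (exp (b * norm y) * \<bar>u y\<bar>))" for y
    proof -
      define z where "z = c * (h \<bullet> y)"
      have z: "\<bar>z\<bar> \<le> \<bar>c\<bar> * norm h * norm y"
        unfolding z_def abs_mult mult.assoc by (intro mult_left_mono Cauchy_Schwarz_ineq2) auto
      have xy: "c * (x \<bullet> y) \<le> \<bar>c\<bar> * norm x * norm y"
      proof -
        have "c * (x \<bullet> y) \<le> \<bar>c\<bar> * \<bar>x \<bullet> y\<bar>" by (metis abs_ge_self abs_mult)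
        also have "\<dots> \<le> \<bar>c\<bar> * (norm x * norm y)" by (intro mult_left_mono Cauchy_Schwarz_ineq2) auto
        finally show ?thesis by (simp add: mult.assoc)
      qed
      have hy: "\<bar>c\<bar> * norm h * norm y \<le> \<bar>c\<bar> * norm y"
        using h by (intro mult_right_mono mult_left_le) auto
      have "(norm y)\<^sup>2 / 2 \<le> exp (norm y)"
        using exp_lower_Taylor_quadratic[of "norm y"] norm_ge_zero[of y] by linarith
      then have y2: "(norm y)\<^sup>2 \<le> 2 * exp (norm y)" by simp
      have "z\<^sup>2 \<le> (\<bar>c\<bar> * norm h * norm y)\<^sup>2" using z by (metis abs_le_square_iff abs_of_nonneg abs_ge_zero order_trans)
      also have "\<dots> = c\<^sup>2 * (norm h)\<^sup>2 * (norm y)\<^sup>2" by (simp add: power_mult_distrib)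
      also have "\<dots> \<le> c\<^sup>2 * (norm h)\<^sup>2 * (2 * exp (norm y))" by (intro mult_left_mono y2) auto
      finally have z2: "z\<^sup>2 \<le> c\<^sup>2 * (norm h)\<^sup>2 * (2 * exp (norm y))" .
      have e: "exp \<bar>z\<bar> \<le> exp (\<bar>c\<bar> * norm y)" using z hy by simp
      have "\<bar>exp (c * ((x + h) \<bullet> y)) * u y - exp (c * (x \<bullet> y)) * u y - exp (c * (x \<bullet> y)) * (c * ((h \<bullet> y) * u y))\<bar>
          = exp (c * (x \<bullet> y)) * \<bar>exp z - 1 - z\<bar> * \<bar>u y\<bar>"
      proof -
        have "exp (c * ((x + h) \<bullet> y)) * u y - exp (c * (x \<bullet> y)) * u y - exp (c * (x \<bullet> y)) * (c * ((h \<bullet> y) * u y))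
            = exp (c * (x \<bullet> y)) * (exp z - 1 - z) * u y"
          unfolding z_def by (simp add: inner_add_left ring_distribs exp_add algebra_simps)
        then show ?thesis by (simp add: abs_mult)
      qed
      also have "\<dots> \<le> exp (\<bar>c\<bar> * norm x * norm y) * (c\<^sup>2 * (norm h)\<^sup>2 * (2 * exp (norm y)) * exp (\<bar>c\<bar> * norm y)) * \<bar>u y\<bar>"
      proof (intro mult_right_mono mult_mono)
        show "exp (c * (x \<bullet> y)) \<le> exp (\<bar>c\<bar> * norm x * norm y)" using xy by simp
        have "\<bar>exp z - 1 - z\<bar> \<le> z\<^sup>2 * exp \<bar>z\<bar>" by (rule exp_remainder)
        also have "\<dots> \<le> c\<^sup>2 * (norm h)\<^sup>2 * (2 * exp (norm y)) * exp (\<bar>c\<bar> * norm y)"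
          by (intro mult_mono z2 e) auto
        finally show "\<bar>exp z - 1 - z\<bar> \<le> c\<^sup>2 * (norm h)\<^sup>2 * (2 * exp (norm y)) * exp (\<bar>c\<bar> * norm y)" .
      qed auto
      also have "\<dots> = (norm h)\<^sup>2 * (2 * c\<^sup>2 * (exp (b * norm y) * \<bar>u y\<bar>))"
      proof -
        have "exp (b * norm y) = exp (\<bar>c\<bar> * norm x * norm y) * exp (\<bar>c\<bar> * norm y) * exp (norm y)"
          unfolding b_def exp_add[symmetric] by (simp add: algebra_simps)
        then show ?thesis by (simp add: mult_ac)
      qed
      finally show ?thesis .
    qed
    have "\<bar>laplace c u (x + h) - laplace c u x - D h\<bar>
       \<le> (\<integral>y. (norm h)\<^sup>2 * (2 * c\<^sup>2 * (exp (b * norm y) * \<bar>u y\<bar>)) \<partial>lborel)"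
      unfolding eq
      by (rule order_trans[OF integral_abs_bound], rule integral_mono)
         (use ptw intC i1 i2 intD in \<open>auto\<close>)
    then show "\<bar>laplace c u (x + h) - laplace c u x - D h\<bar> \<le> C * (norm h)\<^sup>2"
      unfolding C_def integral_mult_right_zero[of _ "(norm h)\<^sup>2"] by (simp only: mult.commute)
  qed
qed

text \<open>
  Each directional derivative of a Laplace transform is the transform of a function in the
  same class, so smoothness follows by induction on the order.
\<close>

lemma C_k_laplace: "exp_integrable u \<Longrightarrow> C_k n (laplace c u)"
proof (induction n arbitrary: u)
  case 0
  show ?case
    using has_derivative_continuous[OF laplace_has_derivative[OF 0]]
    by (auto intro!: continuous_at_imp_continuous_on)
next
  case (Suc n)
  show ?case
    by (rule C_k_SucI[OF laplace_has_derivative[OF Suc.prems]])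
       (rule Suc.IH[OF exp_integrable_inner_mult[OF Suc.prems]])
qed

section \<open>A lower bound for the Gaussian Jensen gap\<close>

lemma Holder_interpolation:
  fixes a b :: "'b \<Rightarrow> real"
  assumes a: "integrable M a" "\<And>x. a x \<ge> 0" and b: "integrable M b" "\<And>x. b x \<ge> 0"
    and th: "0 < \<theta>" "\<theta> < 1"
  shows "integrable M (\<lambda>x. a x powr \<theta> * b x powr (1 - \<theta>))"
    and "(\<integral>x. a x powr \<theta> * b x powr (1 - \<theta>) \<partial>M) \<le> (\<integral>x. a x \<partial>M) powr \<theta> * (\<integral>x. b x \<partial>M) powr (1 - \<theta>)"
proof -
  have [measurable]: "a \<in> borel_measurable M" "b \<in> borel_measurable M" using a b by auto
  have young: "u powr \<theta> * v powr (1 - \<theta>) \<le> \<theta> * u + (1 - \<theta>) * v" if "u \<ge> 0" "v \<ge> 0" for u v :: real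
  proof (cases "u = 0 \<or> v = 0")
    case False
    then show ?thesis using Youngs_inequality_0[of \<theta> "1 - \<theta>" u v] th that by auto
  qed (use th that in auto)
  show int: "integrable M (\<lambda>x. a x powr \<theta> * b x powr (1 - \<theta>))"
    by (rule Bochner_Integration.integrable_bound[of M "\<lambda>x. \<theta> * a x + (1 - \<theta>) * b x"])
       (use a b th young[OF a(2) b(2)] in \<open>auto intro!: AE_I2\<close>)
  define A B where "A = (\<integral>x. a x \<partial>M)" and "B = (\<integral>x. b x \<partial>M)"
  have AB: "A \<ge> 0" "B \<ge> 0" unfolding A_def B_def using a b by auto
  show "(\<integral>x. a x powr \<theta> * b x powr (1 - \<theta>) \<partial>M) \<le> (\<integral>x. a x \<partial>M) powr \<theta> * (\<integral>x. b x \<partial>M) powr (1 - \<theta>)"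
  proof (cases "A = 0 \<or> B = 0")
    case True
    then have "(AE x in M. a x = 0) \<or> (AE x in M. b x = 0)"
      using integral_nonneg_eq_0_iff_AE[OF a(1)] integral_nonneg_eq_0_iff_AE[OF b(1)] a b
      by (auto simp: A_def B_def)
    then have "AE x in M. a x powr \<theta> * b x powr (1 - \<theta>) = 0"
    proof
      assume "AE x in M. a x = 0"
      then show ?thesis by eventually_elim simp
    next
      assume "AE x in M. b x = 0"
      then show ?thesis by eventually_elim simp
    qed
    then have "(\<integral>x. a x powr \<theta> * b x powr (1 - \<theta>) \<partial>M) = 0"
      by (subst integral_cong_AE[where g = "\<lambda>_. 0"]) auto
    then show ?thesis by simp
  next
    case False
    then have pos: "A > 0" "B > 0" using AB by auto
    have ptw: "a x powr \<theta> * b x powr (1 - \<theta>)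
       \<le> A powr \<theta> * B powr (1 - \<theta>) * (\<theta> * (a x / A) + (1 - \<theta>) * (b x / B))" for x
    proof -
      have "a x powr \<theta> * b x powr (1 - \<theta>)
          = A powr \<theta> * B powr (1 - \<theta>) * ((a x / A) powr \<theta> * (b x / B) powr (1 - \<theta>))"
        using pos a b by (simp add: powr_divide)
      also have "\<dots> \<le> A powr \<theta> * B powr (1 - \<theta>) * (\<theta> * (a x / A) + (1 - \<theta>) * (b x / B))"
        by (intro mult_left_mono young) (use pos a b in auto)
      finally show ?thesis .
    qed
    have "(\<integral>x. a x powr \<theta> * b x powr (1 - \<theta>) \<partial>M)
        \<le> (\<integral>x. A powr \<theta> * B powr (1 - \<theta>) * (\<theta> * (a x / A) + (1 - \<theta>) * (b x / B)) \<partial>M)"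
      by (rule integral_mono[OF int _ ptw]) (use a b in auto)
    also have "\<dots> = A powr \<theta> * B powr (1 - \<theta>) * (\<theta> * (A / A) + (1 - \<theta>) * (B / B))"
      using a b by (simp add: A_def B_def)
    also have "\<dots> = A powr \<theta> * B powr (1 - \<theta>)" using pos by simp
    finally show ?thesis by (simp add: A_def B_def)
  qed
qed

text \<open>
  Integrate the tangent line of the exponential at the weighted mean of \<open>z\<close>.
\<close>

lemma Jensen_exp_weighted:
  fixes v z :: "'b \<Rightarrow> real"
  assumes v: "integrable M v" "\<And>x. v x \<ge> 0" and pos: "(\<integral>x. v x \<partial>M) > 0"
    and vz: "integrable M (\<lambda>x. v x * z x)" and ve: "integrable M (\<lambda>x. v x * exp (z x))"
  shows "(\<integral>x. v x \<partial>M) * exp ((\<integral>x. v x * z x \<partial>M) / (\<integral>x. v x \<partial>M)) \<le> (\<integral>x. v x * exp (z x) \<partial>M)"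
proof -
  define W where "W = (\<integral>x. v x \<partial>M)"
  define z0 where "z0 = (\<integral>x. v x * z x \<partial>M) / W"
  have W: "W > 0" using pos by (simp add: W_def)
  have ptw: "exp z0 * (v x * (1 - z0) + v x * z x) \<le> v x * exp (z x)" for x
  proof -
    have "exp z0 * (1 + (z x - z0)) \<le> exp z0 * exp (z x - z0)"
      by (intro mult_left_mono exp_ge_add_one_self) auto
    then have "exp z0 * (1 - z0 + z x) \<le> exp (z x)"
      by (simp add: exp_add[symmetric] algebra_simps)
    from mult_left_mono[OF this v(2)[of x]] show ?thesis by (simp add: algebra_simps)
  qed
  have "(\<integral>x. exp z0 * (v x * (1 - z0) + v x * z x) \<partial>M) \<le> (\<integral>x. v x * exp (z x) \<partial>M)"
    by (rule integral_mono[OF _ ve ptw]) (use v vz in auto)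
  also have "(\<integral>x. exp z0 * (v x * (1 - z0) + v x * z x) \<partial>M) = exp z0 * (W * (1 - z0) + W * z0)"
    using v vz W by (simp add: W_def z0_def)
  finally show ?thesis by (simp add: W_def z0_def algebra_simps)
qed

definition gauss_avg :: "real \<Rightarrow> ('a::euclidean_space \<Rightarrow> real) \<Rightarrow> 'a \<Rightarrow> real" where
  "gauss_avg \<eta> v x = (\<integral>y. v y \<partial>isotropic_gaussian \<eta> x)"

lemma integrable_gaussian_bounded:
  fixes v :: "'a::euclidean_space \<Rightarrow> real"
  assumes "\<eta> > 0" "v \<in> borel_measurable borel" "\<And>y. \<bar>v y\<bar> \<le> B"
  shows "integrable (isotropic_gaussian \<eta> x) v"
proof -
  interpret prob_space "isotropic_gaussian \<eta> x" by (rule prob_space_isotropic_gaussian[OF assms(1)])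
  show ?thesis by (rule integrable_const_bound[of _ B]) (use assms in auto)
qed

lemma gauss_avg_bound:
  fixes v :: "'a::euclidean_space \<Rightarrow> real"
  assumes "\<eta> > 0" "v \<in> borel_measurable borel" "\<And>y. \<bar>v y\<bar> \<le> B" "\<And>y. v y \<ge> 0"
  shows "0 \<le> gauss_avg \<eta> v x" "gauss_avg \<eta> v x \<le> B"
proof -
  interpret prob_space "isotropic_gaussian \<eta> x" by (rule prob_space_isotropic_gaussian[OF assms(1)])
  show "0 \<le> gauss_avg \<eta> v x" unfolding gauss_avg_def by (rule Bochner_Integration.integral_nonneg) (use assms in auto)
  have "v y \<le> B" for y using assms(3)[of y] by simp
  then show "gauss_avg \<eta> v x \<le> B"
    unfolding gauss_avg_def
    by (intro integral_le_const integrable_gaussian_bounded[OF assms(1-3)]) auto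
qed

text \<open>Half of the Gaussian exponent absorbs the linear exponential.\<close>

lemma exp_integrable_gaussian_mult:
  fixes v :: "'a::euclidean_space \<Rightarrow> real"
  assumes \<eta>: "\<eta> > 0" and [measurable]: "v \<in> borel_measurable borel" and B: "\<And>y. \<bar>v y\<bar> \<le> B"
  shows "exp_integrable (\<lambda>y. exp (- (norm y)\<^sup>2 / (2 * \<eta>)) * v y)"
  unfolding exp_integrable_def
proof (intro conjI allI)
  fix c :: real
  have c0: "gauss_const TYPE('a) (2 * \<eta>) > 0" using \<eta> by (simp add: gauss_const_pos)
  show "integrable lborel (\<lambda>y. exp (c * norm y) * \<bar>exp (- (norm y)\<^sup>2 / (2 * \<eta>)) * v y\<bar>)"
  proof (rule Bochner_Integration.integrable_bound)
    show "integrable lborel (\<lambda>y::'a. B * exp (c\<^sup>2 * \<eta>) / gauss_const TYPE('a) (2 * \<eta>) * gauss_kernel (2 * \<eta>) 0 y)"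
      using \<eta> by (intro integrable_mult_right integrable_gauss_kernel) auto
    have "norm (exp (c * norm y) * \<bar>exp (- (norm y)\<^sup>2 / (2 * \<eta>)) * v y\<bar>)
        \<le> norm (B * exp (c\<^sup>2 * \<eta>) / gauss_const TYPE('a) (2 * \<eta>) * gauss_kernel (2 * \<eta>) 0 y)" for y
    proof -
      \<comment> \<open>Complete the square against half of the quadratic term.\<close>
      have "c * norm y - (norm y)\<^sup>2 / (2 * \<eta>)
          = c\<^sup>2 * \<eta> - (norm y)\<^sup>2 / (4 * \<eta>) - (norm y - 2 * \<eta> * c)\<^sup>2 / (4 * \<eta>)"
        using \<eta> by (simp add: field_simps power2_eq_square)
      then have "c * norm y - (norm y)\<^sup>2 / (2 * \<eta>) \<le> c\<^sup>2 * \<eta> - (norm y)\<^sup>2 / (4 * \<eta>)"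
        using \<eta> by simp
      then have "exp (c * norm y) * exp (- (norm y)\<^sup>2 / (2 * \<eta>)) \<le> exp (c\<^sup>2 * \<eta>) * exp (- (norm y)\<^sup>2 / (4 * \<eta>))"
        by (simp add: exp_add[symmetric])
      then have "exp (c * norm y) * exp (- (norm y)\<^sup>2 / (2 * \<eta>)) * \<bar>v y\<bar>
              \<le> exp (c\<^sup>2 * \<eta>) * exp (- (norm y)\<^sup>2 / (4 * \<eta>)) * B"
        by (rule mult_mono) (use B in auto)
      moreover have "B \<ge> 0" using B[of y] by linarith
      ultimately show ?thesis using c0 by (simp add: gauss_kernel_def abs_mult mult_ac)
    qed
    then show "AE y in lborel. norm (exp (c * norm y) * \<bar>exp (- (norm y)\<^sup>2 / (2 * \<eta>)) * v y\<bar>)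
        \<le> norm (B * exp (c\<^sup>2 * \<eta>) / gauss_const TYPE('a) (2 * \<eta>) * gauss_kernel (2 * \<eta>) 0 y)" by simp
  qed simp
qed measurable

text \<open>
  Expanding the square makes a Gaussian average an explicit factor times a Laplace transform
  in \<open>x\<close>. Gaussian averages of bounded functions inherit its smoothness and its
  derivative formula.
\<close>

lemma gauss_kernel_laplace:
  fixes x y :: "'a::euclidean_space"
  assumes "\<eta> > 0"
  shows "gauss_kernel \<eta> x y = gauss_const TYPE('a) \<eta> * exp (- (1 / (2 * \<eta>)) * (norm x)\<^sup>2)
           * (exp (1 / \<eta> * (x \<bullet> y)) * exp (- (norm y)\<^sup>2 / (2 * \<eta>)))"
proof -
  have "- (norm (y - x))\<^sup>2 / (2 * \<eta>)
      = - (1 / (2 * \<eta>)) * (norm x)\<^sup>2 + (1 / \<eta> * (x \<bullet> y) + - (norm y)\<^sup>2 / (2 * \<eta>))"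
    unfolding power2_norm_eq_inner using assms
    by (simp add: inner_diff_left inner_diff_right inner_commute field_simps)
  then show ?thesis unfolding gauss_kernel_def by (simp only: exp_add mult.assoc)
qed

lemma gauss_avg_laplace:
  fixes v :: "'a::euclidean_space \<Rightarrow> real"
  assumes "\<eta> > 0" "v \<in> borel_measurable borel"
  shows "gauss_avg \<eta> v x = gauss_const TYPE('a) \<eta> * exp (- (1 / (2 * \<eta>)) * (norm x)\<^sup>2)
           * laplace (1 / \<eta>) (\<lambda>y. exp (- (norm y)\<^sup>2 / (2 * \<eta>)) * v y) x"
  unfolding gauss_avg_def integral_isotropic_gaussian[OF assms] laplace_def
  by (subst integral_mult_right_zero[symmetric])
     (simp add: gauss_kernel_laplace[OF assms(1)] mult.assoc)

lemma C_k_gauss_avg: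
  fixes v :: "'a::euclidean_space \<Rightarrow> real"
  assumes "\<eta> > 0" "v \<in> borel_measurable borel" "\<And>y. \<bar>v y\<bar> \<le> B"
  shows "C_k n (gauss_avg \<eta> v)"
proof -
  have "gauss_avg \<eta> v = (\<lambda>x. gauss_const TYPE('a) \<eta> * exp (- (1 / (2 * \<eta>)) * (norm x)\<^sup>2)
           * laplace (1 / \<eta>) (\<lambda>y. exp (- (norm y)\<^sup>2 / (2 * \<eta>)) * v y) x)"
    by (rule ext) (rule gauss_avg_laplace[OF assms(1,2)])
  then show ?thesis
    by (simp only:) (intro C_k_mult C_k_const C_k_exp_neg_norm_sq C_k_laplace
        exp_integrable_gaussian_mult[OF assms])
qed

lemma gauss_avg_has_derivative:
  fixes v :: "'a::euclidean_space \<Rightarrow> real"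
  assumes \<eta>: "\<eta> > 0" and [measurable]: "v \<in> borel_measurable borel" and B: "\<And>y. \<bar>v y\<bar> \<le> B"
  shows "integrable (isotropic_gaussian \<eta> x) (\<lambda>y. v y * (h \<bullet> (y - x)))"
    and "(gauss_avg \<eta> v has_derivative
           (\<lambda>h. (\<integral>y. v y * (h \<bullet> (y - x)) \<partial>isotropic_gaussian \<eta> x) / \<eta>)) (at x)"
proof -
  define u where "u = (\<lambda>y. exp (- (norm y)\<^sup>2 / (2 * \<eta>)) * v y)"
  define e where "e = (\<lambda>x::'a. exp (- (1 / (2 * \<eta>)) * (norm x)\<^sup>2))"
  let ?c = "gauss_const TYPE('a) \<eta>"
  have u: "exp_integrable u" unfolding u_def by (rule exp_integrable_gaussian_mult[OF assms])
  have eqf: "gauss_avg \<eta> v = (\<lambda>x. ?c * e x * laplace (1 / \<eta>) u x)"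
    unfolding u_def e_def by (rule ext) (rule gauss_avg_laplace[OF assms(1,2)])
  have de: "(e has_derivative (\<lambda>h. - (1 / \<eta>) * ((h \<bullet> x) * e x))) (at x)"
    unfolding e_def power2_norm_eq_inner using \<eta>
    by (auto intro!: derivative_eq_intros simp: inner_commute field_simps fun_eq_iff)
  have k: "gauss_kernel \<eta> x y * (v y * (h \<bullet> (y - x)))
      = ?c * e x * (\<eta> * (exp (1 / \<eta> * (x \<bullet> y)) * (1 / \<eta> * ((h \<bullet> y) * u y))) - (h \<bullet> x) * (exp (1 / \<eta> * (x \<bullet> y)) * u y))" for h y
    using \<eta> unfolding gauss_kernel_laplace[OF \<eta>] e_def u_def
    by (simp add: inner_diff_right right_diff_distrib left_diff_distrib mult_ac)
  have i1: "integrable lborel (\<lambda>y. \<eta> * (exp (1 / \<eta> * (x \<bullet> y)) * (1 / \<eta> * ((h \<bullet> y) * u y))))" for h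
    by (intro integrable_mult_right integrable_laplace[OF exp_integrable_inner_mult[OF u]])
  have i2: "integrable lborel (\<lambda>y. (h \<bullet> x) * (exp (1 / \<eta> * (x \<bullet> y)) * u y))" for h
    by (intro integrable_mult_right integrable_laplace[OF u])
  show "integrable (isotropic_gaussian \<eta> x) (\<lambda>y. v y * (h \<bullet> (y - x)))"
    by (subst integrable_isotropic_gaussian_iff[OF \<eta>], measurable, unfold k,
        intro integrable_mult_right Bochner_Integration.integrable_diff i1 i2)
  have val: "(\<integral>y. v y * (h \<bullet> (y - x)) \<partial>isotropic_gaussian \<eta> x)
      = ?c * e x * (\<eta> * laplace (1 / \<eta>) (\<lambda>y. 1 / \<eta> * ((h \<bullet> y) * u y)) x - (h \<bullet> x) * laplace (1 / \<eta>) u x)" for h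
    unfolding laplace_def
    by (subst integral_isotropic_gaussian[OF \<eta>], measurable, unfold k integral_mult_right_zero
        Bochner_Integration.integral_diff[OF i1 i2], rule refl)
  show "(gauss_avg \<eta> v has_derivative
           (\<lambda>h. (\<integral>y. v y * (h \<bullet> (y - x)) \<partial>isotropic_gaussian \<eta> x) / \<eta>)) (at x)"
    unfolding eqf val
    by (rule has_derivative_eq_rhs[OF has_derivative_mult[OF
          has_derivative_mult[OF has_derivative_const de] laplace_has_derivative[OF u]]])
       (use \<eta> in \<open>simp add: fun_eq_iff field_simps\<close>)
qed

lemma gradient_inner:
  assumes "(g has_derivative D) (at x)"
  shows "gradient g x \<bullet> h = D h"
proof -
  have fd: "frechet_derivative g (at x) = D" using frechet_derivative_at[OF assms] by simp
  have lin: "linear D" using assms has_derivative_linear by blast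
  have "D h = D (\<Sum>b\<in>Basis. (h \<bullet> b) *\<^sub>R b)" by (simp add: euclidean_representation)
  also have "\<dots> = (\<Sum>b\<in>Basis. (h \<bullet> b) * D b)"
    by (simp add: linear_sum[OF lin] linear_scale[OF lin])
  finally show ?thesis
    unfolding gradient_def fd by (simp add: inner_sum_left inner_sum_right inner_commute mult.commute)
qed

text \<open>
  Both sides of the inequality bound the mean of \<open>v\<close> times an exponential tilt
  \<open>exp (l \<bullet> (y - x))\<close>. From below, Jensen's inequality under the law
  weighted by \<open>v\<close> applies, because the weighted mean of \<open>y - x\<close> is
  \<open>\<eta>\<close> times the gradient of the logarithm of the average. From above,
  Hoelder's inequality separates \<open>v powr \<kappa>\<close> from the tilt, whose mean is
  known. The direction \<open>l\<close> is the optimal one.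
\<close>

lemma gauss_avg_powr_gradient:
  fixes v :: "'a::euclidean_space \<Rightarrow> real"
  assumes \<eta>: "\<eta> > 0" and [measurable]: "v \<in> borel_measurable borel" and B: "\<And>y. \<bar>v y\<bar> \<le> B"
    and nn: "\<And>y. v y \<ge> 0" and k: "\<kappa> > 1" and pos: "gauss_avg \<eta> v x > 0"
  shows "gauss_avg \<eta> v x powr \<kappa>
          * exp ((\<kappa> - 1) * \<eta> / 2 * ((norm (gradient (gauss_avg \<eta> v) x))\<^sup>2 / (gauss_avg \<eta> v x)\<^sup>2))
        \<le> gauss_avg \<eta> (\<lambda>y. v y powr \<kappa>) x"
proof -
  define w where "w = gauss_avg \<eta> v x"
  define d where "d = gradient (gauss_avg \<eta> v) x"
  define S where "S = (norm d)\<^sup>2 / w\<^sup>2"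
  \<comment> \<open>The tilt that maximises the difference of the linear lower exponent and the quadratic upper one.\<close>
  define l where "l = ((\<kappa> - 1) / \<kappa> / w) *\<^sub>R d"
  let ?N = "isotropic_gaussian \<eta> x"
  have w: "w > 0" using pos by (simp add: w_def)
  have vint: "integrable ?N v" by (rule integrable_gaussian_bounded[OF \<eta> assms(2) B])
  have d: "(\<integral>y. v y * (h \<bullet> (y - x)) \<partial>?N) = \<eta> * (d \<bullet> h)" for h
    using gradient_inner[OF gauss_avg_has_derivative(2)[OF \<eta> assms(2) B], of x h] \<eta>
    by (simp add: d_def)
  have ve: "integrable ?N (\<lambda>y. v y * exp (l \<bullet> (y - x)))"
  proof (rule Bochner_Integration.integrable_bound)
    show "integrable ?N (\<lambda>y. B * exp (l \<bullet> (y - x)))"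
      using gauss_mgf(1)[OF \<eta>] by (rule integrable_mult_right)
    have "\<bar>v y\<bar> \<le> \<bar>B\<bar>" for y using B[of y] by linarith
    then show "AE y in ?N. norm (v y * exp (l \<bullet> (y - x))) \<le> norm (B * exp (l \<bullet> (y - x)))"
      by (simp add: abs_mult mult_right_mono)
  qed simp
  have "w * exp (\<eta> * (d \<bullet> l) / w) \<le> (\<integral>y. v y * exp (l \<bullet> (y - x)) \<partial>?N)"
    using Jensen_exp_weighted[OF vint nn _ gauss_avg_has_derivative(1)[OF \<eta> assms(2) B] ve] w
    by (simp add: d w_def gauss_avg_def)
  moreover have "\<eta> * (d \<bullet> l) / w = \<eta> * ((\<kappa> - 1) / \<kappa>) * S"
    unfolding S_def power2_norm_eq_inner using w by (simp add: l_def power2_eq_square mult.assoc)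
  ultimately have low: "w * exp (\<eta> * ((\<kappa> - 1) / \<kappa>) * S) \<le> (\<integral>y. v y * exp (l \<bullet> (y - x)) \<partial>?N)" by simp
  define m where "m = (\<kappa> / (\<kappa> - 1)) *\<^sub>R l"
  have m: "m = (1 / w) *\<^sub>R d" using k w by (simp add: m_def l_def field_simps)
  have vk: "integrable ?N (\<lambda>y. v y powr \<kappa>)"
    by (rule integrable_gaussian_bounded[OF \<eta>, of _ "B powr \<kappa>"]) (use B nn k in \<open>auto intro!: powr_mono2 simp: abs_le_iff\<close>)
  have "v y * exp (l \<bullet> (y - x)) = (v y powr \<kappa>) powr (1 / \<kappa>) * exp (m \<bullet> (y - x)) powr (1 - 1 / \<kappa>)" for y
    using k nn[of y] by (simp add: powr_powr m_def exp_powr_real field_simps)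
  then have "(\<integral>y. v y * exp (l \<bullet> (y - x)) \<partial>?N)
     \<le> gauss_avg \<eta> (\<lambda>y. v y powr \<kappa>) x powr (1 / \<kappa>) * exp (\<eta> * (norm m)\<^sup>2 / 2) powr (1 - 1 / \<kappa>)"
    using Holder_interpolation(2)[OF vk _ gauss_mgf(1)[OF \<eta>, of x m], of "1 / \<kappa>"] k
    by (simp add: gauss_mgf(2)[OF \<eta>] gauss_avg_def)
  also have "exp (\<eta> * (norm m)\<^sup>2 / 2) powr (1 - 1 / \<kappa>) = exp (\<eta> * ((\<kappa> - 1) / \<kappa>) * S / 2)"
    using k w by (simp add: m S_def exp_powr_real power_mult_distrib power_divide field_simps)
  finally have up: "(\<integral>y. v y * exp (l \<bullet> (y - x)) \<partial>?N)
     \<le> gauss_avg \<eta> (\<lambda>y. v y powr \<kappa>) x powr (1 / \<kappa>) * exp (\<eta> * ((\<kappa> - 1) / \<kappa>) * S / 2)" .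
  let ?E = "\<eta> * ((\<kappa> - 1) / \<kappa>) * S / 2"
  have "w * exp (?E + ?E) \<le> gauss_avg \<eta> (\<lambda>y. v y powr \<kappa>) x powr (1 / \<kappa>) * exp ?E"
    using order_trans[OF low up] by (simp only: field_sum_of_halves)
  then have "w * exp ?E \<le> gauss_avg \<eta> (\<lambda>y. v y powr \<kappa>) x powr (1 / \<kappa>)"
    unfolding exp_add mult.assoc[symmetric] by simp
  then have "(w * exp ?E) powr \<kappa> \<le> (gauss_avg \<eta> (\<lambda>y. v y powr \<kappa>) x powr (1 / \<kappa>)) powr \<kappa>"
    using w k by (intro powr_mono2) auto
  moreover have "gauss_avg \<eta> (\<lambda>y. v y powr \<kappa>) x \<ge> 0"
    unfolding gauss_avg_def by (rule Bochner_Integration.integral_nonneg) simp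
  ultimately have "w powr \<kappa> * exp (\<kappa> * ?E) \<le> gauss_avg \<eta> (\<lambda>y. v y powr \<kappa>) x"
    using k w by (simp add: powr_powr powr_mult exp_powr_real mult.commute)
  moreover have "\<kappa> * ?E = (\<kappa> - 1) * \<eta> / 2 * S" using k by simp
  ultimately show ?thesis by (simp add: w_def d_def S_def)
qed

section \<open>Dissipation for bounded densities\<close>

lemma C_k_measurable: "C_k n g \<Longrightarrow> g \<in> borel_measurable borel"
proof -
  assume "C_k n g"
  then have "continuous_on UNIV g"
    by (induction n) (use C_k_Suc_imp in auto)
  then show ?thesis by (rule borel_measurable_continuous_onI)
qed

lemma gradient_measurable:
  assumes "C_k (Suc n) g"
  shows "gradient g \<in> borel_measurable borel"
proof -
  have [measurable]: "(\<lambda>x. frechet_derivative g (at x) b) \<in> borel_measurable borel" for b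
    using assms by (auto intro: C_k_measurable)
  show ?thesis unfolding gradient_def by measurable
qed

lemma gauss_avg_measurable:
  fixes v :: "'a::euclidean_space \<Rightarrow> real"
  assumes "\<eta> > 0" "v \<in> borel_measurable borel" "\<And>y. \<bar>v y\<bar> \<le> B"
  shows "gauss_avg \<eta> v \<in> borel_measurable borel"
  by (rule C_k_measurable[OF C_k_gauss_avg[OF assms, where n = 0]])

text \<open>
  The Gaussian kernel is positive everywhere, so an average that vanishes at one point
  vanishes at all points. This makes averages strictly positive, hence their real powers
  smooth.
\<close>

lemma gauss_avg_eq_0:
  fixes v :: "'a::euclidean_space \<Rightarrow> real"
  assumes \<eta>: "\<eta> > 0" and [measurable]: "v \<in> borel_measurable borel"
    and B: "\<And>y. \<bar>v y\<bar> \<le> B" and nn: "\<And>y. v y \<ge> 0"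
  shows "gauss_avg \<eta> v x = 0 \<longleftrightarrow> (AE y in lborel. v y = 0)"
proof -
  have "integrable lborel (\<lambda>y. gauss_kernel \<eta> x y * v y)"
    using integrable_gaussian_bounded[OF assms(1-3)] integrable_isotropic_gaussian_iff[OF assms(1,2)] by blast
  then show ?thesis
    unfolding gauss_avg_def integral_isotropic_gaussian[OF assms(1,2)]
    using gauss_kernel_pos[OF \<eta>, of x]
    by (subst integral_nonneg_eq_0_iff_AE)
       (auto simp: nn less_imp_le less_imp_neq[symmetric])
qed

lemma gauss_avg_powr_mono:
  fixes g :: "'a::euclidean_space \<Rightarrow> real"
  assumes \<eta>: "\<eta> > 0" and [measurable]: "g \<in> borel_measurable borel"
    and B: "\<And>y. g y \<le> B" and nn: "\<And>y. g y \<ge> 0" and m: "m \<ge> 1"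
  shows "gauss_avg \<eta> g x powr m \<le> gauss_avg \<eta> (\<lambda>y. g y powr m) x"
proof (cases "m = 1")
  case True
  then show ?thesis using nn gauss_avg_bound(1)[OF assms(1,2), of B x] B by simp
next
  case False
  interpret prob_space "isotropic_gaussian \<eta> x" by (rule prob_space_isotropic_gaussian[OF \<eta>])
  have int: "integrable (isotropic_gaussian \<eta> x) (\<lambda>y. g y powr m)"
    by (rule integrable_gaussian_bounded[OF \<eta>, of _ "B powr m"]) (use B nn m in \<open>auto intro!: powr_mono2\<close>)
  have "(\<lambda>y. (g y powr m) powr (1 / m) * 1 powr (1 - 1 / m)) = g"
    using m nn by (auto simp: powr_powr fun_eq_iff)
  then have le: "gauss_avg \<eta> g x \<le> gauss_avg \<eta> (\<lambda>y. g y powr m) x powr (1 / m)"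
    using Holder_interpolation(2)[OF int, of "\<lambda>_. 1" "1 / m"] m False
    by (simp add: gauss_avg_def prob_space[unfolded space_isotropic_gaussian])
  have "gauss_avg \<eta> g x powr m \<le> (gauss_avg \<eta> (\<lambda>y. g y powr m) x powr (1 / m)) powr m"
    by (rule powr_mono2[OF _ _ le])
       (use m gauss_avg_bound(1)[OF assms(1,2), of B x] B nn in auto)
  also have "\<dots> = gauss_avg \<eta> (\<lambda>y. g y powr m) x"
    using m gauss_avg_bound(1)[OF assms(1), of "\<lambda>y. g y powr m" "B powr m" x] B nn
    by (simp add: powr_powr powr_mono2)
  finally show ?thesis .
qed

text \<open>
  Hoelder interpolation between the exponents 1 and \<open>q\<close>, used for the inner
  average and again for the outer integral.
\<close>

lemma gauss_avg_interpolation: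
  fixes g :: "'a::euclidean_space \<Rightarrow> real"
  assumes "prob_space \<pi>" and sets: "sets \<pi> = sets borel" and \<eta>: "\<eta> > 0"
    and [measurable]: "g \<in> borel_measurable borel"
    and B: "\<And>y. g y \<le> B" and nn: "\<And>y. g y \<ge> 0"
    and m: "1 \<le> m" "m < q" and one: "(\<integral>x. gauss_avg \<eta> g x \<partial>\<pi>) \<le> 1"
    and G: "(\<integral>x. gauss_avg \<eta> (\<lambda>y. g y powr q) x \<partial>\<pi>) > 0"
  shows "(\<integral>x. gauss_avg \<eta> (\<lambda>y. g y powr m) x \<partial>\<pi>)
       \<le> (\<integral>x. gauss_avg \<eta> (\<lambda>y. g y powr q) x \<partial>\<pi>) powr ((m - 1) / (q - 1))"
proof (cases "m = 1")
  case True
  then show ?thesis using one nn G by simp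
next
  case False
  interpret prob_space \<pi> by fact
  define \<theta> where "\<theta> = (m - 1) / (q - 1)"
  have th: "0 < \<theta>" "\<theta> < 1" using m False by (auto simp: \<theta>_def)
  have bd: "\<bar>g y powr s\<bar> \<le> B powr s" if "s \<ge> 0" for y s using B nn that by (auto intro!: powr_mono2)
  have bd1: "\<bar>g y\<bar> \<le> B" for y using B nn by simp
  have [measurable]: "gauss_avg \<eta> (\<lambda>y. g y powr s) \<in> borel_measurable \<pi>" if "s \<ge> 0" for s
    unfolding measurable_cong_sets[OF sets refl] using that
    by (intro gauss_avg_measurable[OF \<eta>, of _ "B powr s"] bd) auto
  have [measurable]: "gauss_avg \<eta> g \<in> borel_measurable \<pi>"
    unfolding measurable_cong_sets[OF sets refl]
    by (intro gauss_avg_measurable[OF \<eta>, of _ B] bd1) auto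
  have avgq: "0 \<le> gauss_avg \<eta> (\<lambda>y. g y powr s) x" "gauss_avg \<eta> (\<lambda>y. g y powr s) x \<le> B powr s"
    if "s \<ge> 0" for s x
    using that by (intro gauss_avg_bound[OF \<eta> _ bd]; simp)+
  have avg1: "0 \<le> gauss_avg \<eta> g x" "gauss_avg \<eta> g x \<le> B" for x
    by (intro gauss_avg_bound[OF \<eta> _ bd1]; simp add: nn)+
  have intq: "integrable \<pi> (gauss_avg \<eta> (\<lambda>y. g y powr s))" if "s \<ge> 0" for s
    using avgq[OF that] that by (intro integrable_const_bound[of _ "B powr s"]) auto
  have int1: "integrable \<pi> (gauss_avg \<eta> g)"
    using avg1 by (intro integrable_const_bound[of _ B]) auto
  have ig: "integrable (isotropic_gaussian \<eta> x) (\<lambda>y. g y powr q)" for x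
    using m by (intro integrable_gaussian_bounded[OF \<eta> _ bd]) auto
  have ig1: "integrable (isotropic_gaussian \<eta> x) g" for x
    by (intro integrable_gaussian_bounded[OF \<eta> _ bd1]) auto
  have "g y powr m = (g y powr q) powr \<theta> * g y powr (1 - \<theta>)" for y
  proof -
    have "q * \<theta> + (1 - \<theta>) = 1 + (q - 1) * \<theta>" by (simp add: algebra_simps)
    also have "\<dots> = m" using m by (simp add: \<theta>_def)
    finally have "q * \<theta> + (1 - \<theta>) = m" .
    then show ?thesis by (simp add: powr_powr powr_add[symmetric])
  qed
  then have ptw: "gauss_avg \<eta> (\<lambda>y. g y powr m) x
      \<le> gauss_avg \<eta> (\<lambda>y. g y powr q) x powr \<theta> * gauss_avg \<eta> g x powr (1 - \<theta>)" for x
    using Holder_interpolation(2)[OF ig _ ig1 nn th] by (simp add: gauss_avg_def)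
  have nnq: "gauss_avg \<eta> (\<lambda>y. g y powr q) x \<ge> 0" and nn1: "gauss_avg \<eta> g x \<ge> 0" for x
    using m avgq avg1 by auto
  note H = Holder_interpolation[OF intq nnq int1 nn1 th]
  have "(\<integral>x. gauss_avg \<eta> (\<lambda>y. g y powr m) x \<partial>\<pi>)
     \<le> (\<integral>x. gauss_avg \<eta> (\<lambda>y. g y powr q) x powr \<theta> * gauss_avg \<eta> g x powr (1 - \<theta>) \<partial>\<pi>)"
    using m by (intro integral_mono[OF intq H(1) ptw]) auto
  also have "\<dots> \<le> (\<integral>x. gauss_avg \<eta> (\<lambda>y. g y powr q) x \<partial>\<pi>) powr \<theta> * (\<integral>x. gauss_avg \<eta> g x \<partial>\<pi>) powr (1 - \<theta>)"
    using m by (intro H(2)) auto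
  also have "\<dots> \<le> (\<integral>x. gauss_avg \<eta> (\<lambda>y. g y powr q) x \<partial>\<pi>) powr \<theta> * 1"
  proof (rule mult_left_mono)
    have "(\<integral>x. gauss_avg \<eta> g x \<partial>\<pi>) \<ge> 0" by (rule Bochner_Integration.integral_nonneg[OF nn1])
    then have "(\<integral>x. gauss_avg \<eta> g x \<partial>\<pi>) powr (1 - \<theta>) \<le> 1 powr (1 - \<theta>)"
      using one th by (intro powr_mono2) auto
    then show "(\<integral>x. gauss_avg \<eta> g x \<partial>\<pi>) powr (1 - \<theta>) \<le> 1" by simp
  qed simp
  finally show ?thesis by (simp add: \<theta>_def)
qed

lemma latala_oleszkiewiczD:
  assumes "latala_oleszkiewicz \<pi> r \<alpha>" "\<alpha> > 0" "smooth \<psi>" "bounded (range \<psi>)" "\<And>x. 0 \<le> \<psi> x"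
    and p: "1 < p" "p < 2" and int: "integrable \<pi> (\<lambda>x. (norm (gradient \<psi> x))\<^sup>2)"
  shows "(\<integral>x. (\<psi> x)\<^sup>2 \<partial>\<pi>) - (\<integral>x. \<psi> x powr p \<partial>\<pi>) powr (2 / p)
     \<le> (2 - p) powr (2 * (1 - 1 / r)) / \<alpha> * (\<integral>x. (norm (gradient \<psi> x))\<^sup>2 \<partial>\<pi>)"
proof -
  let ?T = "\<integral>x. (norm (gradient \<psi> x))\<^sup>2 \<partial>\<pi>"
  let ?X = "(\<integral>x. (\<psi> x)\<^sup>2 \<partial>\<pi>) - (\<integral>x. \<psi> x powr p \<partial>\<pi>) powr (2 / p)"
  have "ereal (?X / (2 - p) powr (2 * (1 - 1 / r)))
     \<le> ereal (1 / \<alpha>) * enn2ereal (\<integral>\<^sup>+x. ennreal ((norm (gradient \<psi> x))\<^sup>2) \<partial>\<pi>)"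
    using assms(1)[unfolded latala_oleszkiewicz_def, rule_format, of \<psi>] assms(3-5) p
    by (intro order_trans[OF SUP_upper[of p]]) auto
  also have "(\<integral>\<^sup>+x. ennreal ((norm (gradient \<psi> x))\<^sup>2) \<partial>\<pi>) = ennreal ?T"
    by (rule nn_integral_eq_integral[OF int]) simp
  finally have "?X / (2 - p) powr (2 * (1 - 1 / r)) \<le> 1 / \<alpha> * ?T"
    by (simp add: enn2ereal_ennreal Bochner_Integration.integral_nonneg)
  moreover have "(2 - p) powr (2 * (1 - 1 / r)) > 0" using p by simp
  ultimately show ?thesis by (simp add: field_simps)
qed

text \<open>
  Here \<open>A\<close> is the integral of the square of the test function
  \<open>\<psi>\<close> of the proof. The gradient bound for Gaussian averages, integrated
  with Jensen's inequality, bounds the Dirichlet integral of \<open>\<psi>\<close> from above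
  in terms of \<open>ln G - ln A\<close>, and the functional inequality with exponent
  \<open>2 - t\<close> bounds it from below. The bound on \<open>g\<close> makes
  \<open>\<psi>\<close> bounded, as the functional inequality requires, and all integrals
  finite.
\<close>

lemma dissipation_bounded:
  fixes g :: "'a::euclidean_space \<Rightarrow> real"
  assumes "prob_space \<pi>" and sets: "sets \<pi> = sets borel"
    and loi: "latala_oleszkiewicz \<pi> r \<alpha>" and \<alpha>: "\<alpha> > 0" and \<eta>: "\<eta> > 0"
    and [measurable]: "g \<in> borel_measurable borel"
    and B: "\<And>y. g y \<le> B" and nn: "\<And>y. g y \<ge> 0"
    and one: "(\<integral>x. gauss_avg \<eta> g x \<partial>\<pi>) \<le> 1"
    and posg: "\<And>x. gauss_avg \<eta> g x > 0"
    and \<kappa>: "2 \<le> \<kappa>" "\<kappa> \<le> q" and t: "0 < t" "t < 1"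
  defines "G \<equiv> (\<integral>x. gauss_avg \<eta> (\<lambda>y. g y powr q) x \<partial>\<pi>)"
    and "A \<equiv> (\<integral>x. gauss_avg \<eta> (\<lambda>y. g y powr (q / \<kappa>)) x powr \<kappa> \<partial>\<pi>)"
  shows "0 < A" "A \<le> G" "(\<integral>x. gauss_avg \<eta> g x powr q \<partial>\<pi>) \<le> A"
    and "2 * (\<kappa> - 1) / \<kappa>\<^sup>2 * (\<alpha> * \<eta>) * t powr (- (2 * (1 - 1 / r)))
          * (1 - exp (- (t / (2 - t)) * (ln G / (q - 1) - (ln G - ln A) / (\<kappa> - 1))))
        \<le> ln G - ln A"
proof -
  interpret prob_space \<pi> by fact
  define m where "m = q / \<kappa>"
  have m: "1 \<le> m" "m < q" "m * \<kappa> = q" using \<kappa> by (auto simp: m_def field_simps)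
  define v where "v = (\<lambda>y. g y powr m)"
  define w where "w = gauss_avg \<eta> v"
  have [measurable]: "v \<in> borel_measurable borel" by (simp add: v_def)
  have vB: "\<bar>v y\<bar> \<le> B powr m" for y unfolding v_def using B nn m by (auto intro!: powr_mono2)
  have vnn: "v y \<ge> 0" for y by (simp add: v_def)
  have gB: "\<bar>g y\<bar> \<le> B" for y using B nn by simp
  have vk: "v y powr \<kappa> = g y powr q" for y using m by (simp add: v_def powr_powr)
  have qB: "\<bar>g y powr q\<bar> \<le> B powr q" for y using B nn m by (auto intro!: powr_mono2)
  have w: "w x > 0" for x
  proof -
    have "w x \<ge> 0" unfolding w_def by (rule gauss_avg_bound(1)[OF \<eta> _ vB vnn]) simp
    moreover have "w x \<noteq> 0"
    proof
      assume "w x = 0"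
      then have "AE y in lborel. v y = 0" unfolding w_def
        using gauss_avg_eq_0[where v = v and x = x, OF \<eta> _ vB vnn] by simp
      then have "AE y in lborel. g y = 0" by eventually_elim (simp add: v_def)
      then show False using gauss_avg_eq_0[where v = g and x = x, OF \<eta> _ gB nn] posg[of x] by simp
    qed
    ultimately show ?thesis by simp
  qed
  have wB: "w x \<le> B powr m" for x unfolding w_def by (rule gauss_avg_bound(2)[OF \<eta> _ vB vnn]) simp
  have wC: "C_k n w" for n unfolding w_def by (rule C_k_gauss_avg[OF \<eta> _ vB]) simp
  have [measurable]: "w \<in> borel_measurable borel" by (rule C_k_measurable[OF wC[of 0]])
  define Q where "Q = gauss_avg \<eta> (\<lambda>y. g y powr q)"
  have [measurable]: "Q \<in> borel_measurable borel"
    unfolding Q_def by (rule gauss_avg_measurable[OF \<eta> _ qB]) simp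
  have QB: "0 \<le> Q x" "Q x \<le> B powr q" for x
    unfolding Q_def by (intro gauss_avg_bound[OF \<eta> _ qB]; simp)+
  note sets[measurable_cong]
  have intQ: "integrable \<pi> Q"
    using QB by (intro integrable_const_bound[of _ "B powr q"]) auto
  define \<psi> where "\<psi> = (\<lambda>x. w x powr (\<kappa> / 2))"
  have psiC: "C_k n \<psi>" for n unfolding \<psi>_def by (rule C_k_powr[OF wC w])
  then have sm: "smooth \<psi>" by (simp add: smooth_def)
  have [measurable]: "\<psi> \<in> borel_measurable borel" by (rule C_k_measurable[OF psiC[of 0]])
  have psi0: "\<psi> x > 0" for x using w[of x] by (simp add: \<psi>_def)
  have psi2: "(\<psi> x)\<^sup>2 = w x powr \<kappa>" for x
    using w[of x] by (simp add: \<psi>_def power2_eq_square powr_add[symmetric])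
  have psiB: "\<psi> x \<le> (B powr m) powr (\<kappa> / 2)" for x
    unfolding \<psi>_def using wB w \<kappa> by (intro powr_mono2) (auto intro: less_imp_le)
  then have bdd: "bounded (range \<psi>)"
    using psi0 by (intro boundedI[of _ "(B powr m) powr (\<kappa> / 2)"]) (auto simp: abs_of_pos)
  define T where "T = (\<lambda>x. (norm (gradient \<psi> x))\<^sup>2)"
  have [measurable]: "T \<in> borel_measurable borel"
    unfolding T_def using gradient_measurable[OF psiC] by measurable
  define c where "c = 2 * (\<kappa> - 1) * \<eta> / \<kappa>\<^sup>2"
  have c: "c > 0" using \<kappa> \<eta> by (simp add: c_def)
  have grad: "gradient \<psi> x = (\<kappa> / 2 * w x powr (\<kappa> / 2 - 1)) *\<^sub>R gradient w x" for x
  proof (rule vector_eq_rdot[THEN iffD1], rule allI)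
    fix h
    have wd: "(w has_derivative frechet_derivative w (at x)) (at x)"
      by (rule C_k_Suc_has_derivative[OF wC[of "Suc 0"]])
    show "gradient \<psi> x \<bullet> h = ((\<kappa> / 2 * w x powr (\<kappa> / 2 - 1)) *\<^sub>R gradient w x) \<bullet> h"
      using gradient_inner[OF has_derivative_powr_const[OF wd w, of "\<kappa> / 2"], of h] gradient_inner[OF wd, of h]
      by (simp add: \<psi>_def)
  qed
  have Teq: "T x = \<kappa>\<^sup>2 / 4 * (\<psi> x)\<^sup>2 * ((norm (gradient w x))\<^sup>2 / (w x)\<^sup>2)" for x
  proof -
    have "(w x powr (\<kappa> / 2 - 1))\<^sup>2 = (\<psi> x)\<^sup>2 / (w x)\<^sup>2"
      using w[of x] by (simp add: \<psi>_def powr_diff power_divide)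
    then show ?thesis
      unfolding T_def grad by (simp add: power_mult_distrib power_divide)
  qed
  have loc: "(\<psi> x)\<^sup>2 * exp (c * T x / (\<psi> x)\<^sup>2) \<le> Q x" for x
  proof -
    have k0: "\<kappa> \<noteq> 0" using \<kappa> by simp
    have "c * T x / (\<psi> x)\<^sup>2 = (\<kappa> - 1) * \<eta> / 2 * ((norm (gradient w x))\<^sup>2 / (w x)\<^sup>2)"
      unfolding Teq c_def using k0 less_imp_neq[OF psi0[of x]] less_imp_neq[OF w[of x]]
      by simp (simp add: field_simps)
    then show ?thesis
      using gauss_avg_powr_gradient[where v = v and \<kappa> = \<kappa> and x = x, OF \<eta> _ vB vnn] w[of x] \<kappa>
      by (simp add: psi2 Q_def vk w_def)
  qed
  have T0: "T x \<ge> 0" for x by (simp add: T_def)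
  have loc2: "(\<psi> x)\<^sup>2 + c * T x \<le> Q x" for x
  proof -
    have "(\<psi> x)\<^sup>2 * (1 + c * T x / (\<psi> x)\<^sup>2) \<le> (\<psi> x)\<^sup>2 * exp (c * T x / (\<psi> x)\<^sup>2)"
      by (intro mult_left_mono exp_ge_add_one_self) auto
    moreover have "(\<psi> x)\<^sup>2 * (1 + c * T x / (\<psi> x)\<^sup>2) = (\<psi> x)\<^sup>2 + c * T x"
      using psi0[of x] by (simp add: field_simps)
    ultimately show ?thesis using loc[of x] by simp
  qed
  have psiQ: "(\<psi> x)\<^sup>2 \<le> Q x" for x
    using loc2[of x] mult_nonneg_nonneg[OF less_imp_le[OF c] T0[of x]] by linarith
  have int2: "integrable \<pi> (\<lambda>x. (\<psi> x)\<^sup>2)"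
  proof (rule Bochner_Integration.integrable_bound[OF intQ])
    show "AE x in \<pi>. norm ((\<psi> x)\<^sup>2) \<le> norm (Q x)" using psiQ QB by simp
  qed simp
  have intcT: "integrable \<pi> (\<lambda>x. c * T x)"
  proof (rule Bochner_Integration.integrable_bound[OF intQ])
    have "c * T x \<le> Q x" for x using loc2[of x] zero_le_power2[of "\<psi> x"] by linarith
    then show "AE x in \<pi>. norm (c * T x) \<le> norm (Q x)" using T0 c QB by simp
  qed simp
  then have intT: "integrable \<pi> T" using c by simp
  have A_eq: "A = (\<integral>x. (\<psi> x)\<^sup>2 \<partial>\<pi>)"
    unfolding A_def psi2 w_def v_def m_def by simp
  have A: "A > 0"
  proof -
    have "A \<noteq> 0"
      unfolding A_eq using integral_nonneg_eq_0_iff_AE[OF int2] psi0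
      by (simp add: less_imp_neq[symmetric] AE_False)
    moreover have "A \<ge> 0" unfolding A_eq by (rule Bochner_Integration.integral_nonneg) simp
    ultimately show ?thesis by simp
  qed
  show "0 < A" by (rule A)
  have GQ: "G = (\<integral>x. Q x \<partial>\<pi>)" by (simp add: G_def Q_def)
  show AG: "A \<le> G"
    unfolding A_eq GQ by (intro integral_mono[OF int2 intQ] psiQ)
  have G: "G > 0" using A AG by simp
  show "(\<integral>x. gauss_avg \<eta> g x powr q \<partial>\<pi>) \<le> A"
    unfolding A_eq
  proof (rule integral_mono'[OF int2])
    fix x
    have "gauss_avg \<eta> g x powr q = (gauss_avg \<eta> g x powr m) powr \<kappa>"
      using m by (simp add: powr_powr)
    also have "\<dots> \<le> w x powr \<kappa>"
      unfolding w_def v_def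
      by (intro powr_mono2 gauss_avg_powr_mono[OF \<eta> _ B nn]) (use m \<kappa> in auto)
    finally show "gauss_avg \<eta> g x powr q \<le> (\<psi> x)\<^sup>2" by (simp add: psi2)
  qed simp
  define ET where "ET = (\<integral>x. T x \<partial>\<pi>)"
  define D where "D = ln G - ln A"
  define R where "R = ln G / (q - 1)"
  have D: "c * ET \<le> A * D"
  proof -
    have eqz: "(\<psi> x)\<^sup>2 * (c * T x / (\<psi> x)\<^sup>2) = c * T x" for x using psi0[of x] by simp
    have inte: "integrable \<pi> (\<lambda>x. (\<psi> x)\<^sup>2 * exp (c * T x / (\<psi> x)\<^sup>2))"
      by (rule Bochner_Integration.integrable_bound[OF intQ]) (use loc QB in \<open>auto simp: abs_mult\<close>)
    have "A * exp (c * ET / A) \<le> (\<integral>x. (\<psi> x)\<^sup>2 * exp (c * T x / (\<psi> x)\<^sup>2) \<partial>\<pi>)"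
      using Jensen_exp_weighted[OF int2 _ _ _ inte] A intcT
      unfolding eqz A_eq[symmetric] by (simp add: ET_def)
    also have "\<dots> \<le> G" unfolding GQ by (rule integral_mono[OF inte intQ loc])
    finally have "exp (c * ET / A) \<le> G / A" using A by (simp add: field_simps)
    then have "c * ET / A \<le> ln (G / A)" using A G by (simp add: ln_ge_iff)
    then show ?thesis using A G by (simp add: D_def ln_div field_simps)
  qed
  define p where "p = 2 - t"
  have p: "1 < p" "p < 2" using t by (auto simp: p_def)
  \<comment> \<open>The weight for which \<open>w powr (\<kappa> * p / 2)\<close> interpolates between \<open>w powr \<kappa>\<close> and \<open>w\<close>.\<close>
  define \<theta> where "\<theta> = (\<kappa> * p / 2 - 1) / (\<kappa> - 1)"
  have "2 * 1 < \<kappa> * p" using \<kappa> p by (intro mult_le_less_imp_less) auto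
  moreover have "\<kappa> * p < \<kappa> * 2" using \<kappa> p by simp
  ultimately have th: "0 < \<theta>" "\<theta> < 1" using \<kappa> by (auto simp: \<theta>_def)
  define H where "H = (\<integral>x. \<psi> x powr p \<partial>\<pi>)"
  have H0: "H \<ge> 0" unfolding H_def by (rule Bochner_Integration.integral_nonneg) simp
  have intw: "integrable \<pi> w"
    using wB w by (intro integrable_const_bound[of _ "B powr m"]) (auto simp: abs_of_pos)
  have Ew: "(\<integral>x. w x \<partial>\<pi>) \<le> G powr ((m - 1) / (q - 1))"
    unfolding w_def v_def G_def
    by (rule gauss_avg_interpolation[OF assms(1) sets \<eta> _ B nn m(1,2) one])
       (use G in \<open>auto simp: G_def\<close>)
  have "\<psi> x powr p = (w x powr \<kappa>) powr \<theta> * w x powr (1 - \<theta>)" for x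
  proof -
    have "\<kappa> * \<theta> + (1 - \<theta>) = 1 + (\<kappa> - 1) * \<theta>" by (simp add: algebra_simps)
    also have "\<dots> = \<kappa> / 2 * p" using \<kappa> by (simp add: \<theta>_def)
    finally have "\<kappa> * \<theta> + (1 - \<theta>) = \<kappa> / 2 * p" .
    then show ?thesis by (simp only: \<psi>_def powr_powr powr_add[symmetric])
  qed
  then have "H \<le> A powr \<theta> * (\<integral>x. w x \<partial>\<pi>) powr (1 - \<theta>)"
    using Holder_interpolation(2)[OF int2[unfolded psi2] _ intw _ th] w
    by (simp add: H_def A_eq psi2 less_imp_le)
  also have "\<dots> \<le> A powr \<theta> * (G powr ((m - 1) / (q - 1))) powr (1 - \<theta>)"
    using th by (intro mult_left_mono powr_mono2 Ew Bochner_Integration.integral_nonneg less_imp_le[OF w]) auto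
  also have "\<dots> = exp (\<theta> * ln A + (1 - \<theta>) * ((m - 1) * R))"
    using A G by (simp add: powr_def exp_add R_def mult_ac)
  finally have "H powr (2 / p) \<le> exp (\<theta> * ln A + (1 - \<theta>) * ((m - 1) * R)) powr (2 / p)"
    using H0 p by (intro powr_mono2) auto
  also have "\<dots> = exp (2 / p * (\<theta> * ln A + (1 - \<theta>) * ((m - 1) * R)))"
    by (simp add: exp_powr_real mult.commute)
  also have "2 / p * (\<theta> * ln A + (1 - \<theta>) * ((m - 1) * R))
      = ln A + (- (t / (2 - t)) * (R - D / (\<kappa> - 1)))"
  proof -
    have lA: "ln A = (q - 1) * R - D" using m by (simp add: D_def R_def)
    have t_eq: "t / (2 - t) = (2 - p) / p" by (simp add: p_def)
    have k1: "\<kappa> - 1 \<noteq> 0" "p \<noteq> 0" "\<kappa> \<noteq> 0" using \<kappa> p by auto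
    have q: "q = m * \<kappa>" using m by simp
    have th1: "1 - \<theta> = \<kappa> * (2 - p) / (2 * (\<kappa> - 1))" using k1 by (simp add: \<theta>_def field_simps)
    have th2: "\<theta> = (\<kappa> * p - 2) / (2 * (\<kappa> - 1))" using k1 by (simp add: \<theta>_def field_simps)
    show ?thesis
      unfolding th1 lA t_eq unfolding th2 q
      using k1 by (simp add: divide_simps) (simp add: algebra_simps)
  qed
  also have "exp (ln A + (- (t / (2 - t)) * (R - D / (\<kappa> - 1))))
      = A * exp (- (t / (2 - t)) * (R - D / (\<kappa> - 1)))"
    using A by (simp only: exp_add exp_ln)
  finally have HA: "H powr (2 / p) \<le> A * exp (- (t / (2 - t)) * (R - D / (\<kappa> - 1)))" .
  let ?a = "2 * (1 - 1 / r)"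
  have "A - H powr (2 / p) \<le> t powr ?a / \<alpha> * ET"
    using latala_oleszkiewiczD[OF loi \<alpha> sm bdd less_imp_le[OF psi0] p] intT
    by (simp add: A_eq H_def ET_def T_def p_def)
  then have "A * (1 - exp (- (t / (2 - t)) * (R - D / (\<kappa> - 1)))) \<le> t powr ?a / \<alpha> * ET"
    using HA by (simp add: algebra_simps)
  then have "\<alpha> * t powr (- ?a) * c * (A * (1 - exp (- (t / (2 - t)) * (R - D / (\<kappa> - 1)))))
       \<le> \<alpha> * t powr (- ?a) * c * (t powr ?a / \<alpha> * ET)"
    using \<alpha> t c by (intro mult_left_mono) auto
  also have "\<dots> = (t powr (- ?a) * t powr ?a) * (c * ET)" using \<alpha> by simp
  also have "t powr (- ?a) * t powr ?a = 1"
    using t by (simp only: powr_add[symmetric]) simp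
  also have "1 * (c * ET) \<le> A * D" using D by simp
  finally have "A * (c * \<alpha> * t powr (- ?a) * (1 - exp (- (t / (2 - t)) * (R - D / (\<kappa> - 1))))) \<le> A * D"
    by (simp only: mult_ac)
  then have "c * \<alpha> * t powr (- ?a) * (1 - exp (- (t / (2 - t)) * (R - D / (\<kappa> - 1)))) \<le> D"
    using A by simp
  moreover have "c * \<alpha> = 2 * (\<kappa> - 1) / \<kappa>\<^sup>2 * (\<alpha> * \<eta>)" by (simp add: c_def)
  ultimately show "2 * (\<kappa> - 1) / \<kappa>\<^sup>2 * (\<alpha> * \<eta>) * t powr (- (2 * (1 - 1 / r)))
          * (1 - exp (- (t / (2 - t)) * (ln G / (q - 1) - (ln G - ln A) / (\<kappa> - 1))))
        \<le> ln G - ln A"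
    by (simp add: R_def D_def)
qed

section \<open>Dissipation for unbounded densities\<close>

lemma nn_integral_isotropic_gaussian:
  fixes v :: "'a::euclidean_space \<Rightarrow> ennreal"
  assumes "\<eta> > 0" and [measurable]: "v \<in> borel_measurable borel"
  shows "(\<integral>\<^sup>+y. v y \<partial>isotropic_gaussian \<eta> x) = (\<integral>\<^sup>+y. ennreal (gauss_kernel \<eta> x y) * v y \<partial>lborel)"
  unfolding isotropic_gaussian_eq[OF assms(1)] by (subst nn_integral_density) auto

lemma measurable_nn_integral_gaussian:
  fixes v :: "'a::euclidean_space \<Rightarrow> ennreal"
  assumes "\<eta> > 0" and [measurable]: "v \<in> borel_measurable borel"
  shows "(\<lambda>x. \<integral>\<^sup>+y. v y \<partial>isotropic_gaussian \<eta> x) \<in> borel_measurable borel"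
  unfolding nn_integral_isotropic_gaussian[OF assms] by measurable

lemma gauss_avg_eq_enn2real:
  fixes v :: "'a::euclidean_space \<Rightarrow> real"
  assumes [measurable]: "v \<in> borel_measurable borel" and "\<And>y. v y \<ge> 0"
  shows "gauss_avg \<eta> v x = enn2real (\<integral>\<^sup>+y. ennreal (v y) \<partial>isotropic_gaussian \<eta> x)"
  unfolding gauss_avg_def by (rule integral_eq_nn_integral) (use assms in auto)

lemma gauss_avg_measurable_nonneg:
  fixes v :: "'a::euclidean_space \<Rightarrow> real"
  assumes \<eta>: "\<eta> > 0" and [measurable]: "v \<in> borel_measurable borel" and nn: "\<And>y. v y \<ge> 0"
  shows "gauss_avg \<eta> v \<in> borel_measurable borel"
proof -
  have [measurable]: "(\<lambda>x. \<integral>\<^sup>+y. ennreal (v y) \<partial>isotropic_gaussian \<eta> x) \<in> borel_measurable borel"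
    by (rule measurable_nn_integral_gaussian[OF \<eta>]) measurable
  have "gauss_avg \<eta> v = (\<lambda>x. enn2real (\<integral>\<^sup>+y. ennreal (v y) \<partial>isotropic_gaussian \<eta> x))"
    using gauss_avg_eq_enn2real[OF assms(2,3)] by auto
  then show ?thesis by simp
qed

lemma ennreal_gauss_avg:
  fixes v :: "'a::euclidean_space \<Rightarrow> real"
  assumes "integrable (isotropic_gaussian \<eta> x) v" "\<And>y. v y \<ge> 0"
  shows "ennreal (gauss_avg \<eta> v x) = (\<integral>\<^sup>+y. ennreal (v y) \<partial>isotropic_gaussian \<eta> x)"
  unfolding gauss_avg_def using assms by (simp add: nn_integral_eq_integral)

lemma ennreal_integral_gauss_avg:
  fixes v :: "'a::euclidean_space \<Rightarrow> real"
  assumes "prob_space \<pi>" and sets[measurable_cong]: "sets \<pi> = sets borel" and \<eta>: "\<eta> > 0"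
    and [measurable]: "v \<in> borel_measurable borel" and nn: "\<And>y. v y \<ge> 0" and B: "\<And>y. v y \<le> B"
  shows "ennreal (\<integral>x. gauss_avg \<eta> v x \<partial>\<pi>) = (\<integral>\<^sup>+x. \<integral>\<^sup>+y. ennreal (v y) \<partial>isotropic_gaussian \<eta> x \<partial>\<pi>)"
proof -
  interpret prob_space \<pi> by fact
  have B': "\<bar>v y\<bar> \<le> B" for y using nn B by simp
  have [measurable]: "gauss_avg \<eta> v \<in> borel_measurable borel" by (rule gauss_avg_measurable_nonneg[OF \<eta> _ nn]) simp
  have bd: "0 \<le> gauss_avg \<eta> v x" "gauss_avg \<eta> v x \<le> B" for x
    by (intro gauss_avg_bound[OF \<eta> _ B']; simp add: nn)+
  have "integrable \<pi> (gauss_avg \<eta> v)" by (rule integrable_const_bound[of _ B]) (use bd in auto)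
  then have "ennreal (\<integral>x. gauss_avg \<eta> v x \<partial>\<pi>) = (\<integral>\<^sup>+x. ennreal (gauss_avg \<eta> v x) \<partial>\<pi>)"
    using bd by (simp add: nn_integral_eq_integral)
  also have "\<dots> = (\<integral>\<^sup>+x. \<integral>\<^sup>+y. ennreal (v y) \<partial>isotropic_gaussian \<eta> x \<partial>\<pi>)"
    by (subst ennreal_gauss_avg[OF integrable_gaussian_bounded[OF \<eta> _ B'] nn]) auto
  finally show ?thesis .
qed

text \<open>
  Truncate \<open>g\<close> and let the level tend to infinity. The inequality gets weaker
  when \<open>A\<close> is replaced by the smaller integral of
  \<open>gauss_avg \<eta> g x powr q\<close>, for which the limit is given by monotone
  convergence.
\<close>

lemma dissipation:
  fixes g :: "'a::euclidean_space \<Rightarrow> real"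
  assumes "prob_space \<pi>" and sets[measurable_cong]: "sets \<pi> = sets borel"
    and loi: "latala_oleszkiewicz \<pi> r \<alpha>" and \<alpha>: "\<alpha> > 0" and \<eta>: "\<eta> > 0"
    and [measurable]: "g \<in> borel_measurable borel" and nn: "\<And>y. g y \<ge> 0"
    and one: "(\<integral>\<^sup>+x. \<integral>\<^sup>+y. ennreal (g y) \<partial>isotropic_gaussian \<eta> x \<partial>\<pi>) = 1"
    and fin: "(\<integral>\<^sup>+x. \<integral>\<^sup>+y. ennreal (g y powr q) \<partial>isotropic_gaussian \<eta> x \<partial>\<pi>) < \<infinity>"
    and q: "q \<ge> 2"
  defines "G \<equiv> enn2real (\<integral>\<^sup>+x. \<integral>\<^sup>+y. ennreal (g y powr q) \<partial>isotropic_gaussian \<eta> x \<partial>\<pi>)"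
    and "F \<equiv> enn2real (\<integral>\<^sup>+x. ennreal (gauss_avg \<eta> g x powr q) \<partial>\<pi>)"
  shows "(\<integral>\<^sup>+x. ennreal (gauss_avg \<eta> g x powr q) \<partial>\<pi>) < \<infinity>" "0 < F" "F \<le> G"
    and "\<And>\<kappa> t. 2 \<le> \<kappa> \<Longrightarrow> \<kappa> \<le> q \<Longrightarrow> 0 < t \<Longrightarrow> t < 1 \<Longrightarrow>
          2 * (\<kappa> - 1) / \<kappa>\<^sup>2 * (\<alpha> * \<eta>) * t powr (- (2 * (1 - 1 / r)))
          * (1 - exp (- (t / (2 - t)) * (ln G / (q - 1) - (ln G - ln F) / (\<kappa> - 1))))
        \<le> ln G - ln F"
proof -
  interpret prob_space \<pi> by fact
  \<comment> \<open>The successor keeps every truncation level positive, so that no truncation is identically zero.\<close>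
  define u where "u n = (\<lambda>y. min (g y) (real (Suc n)))" for n
  define Gn where "Gn n = (\<integral>x. gauss_avg \<eta> (\<lambda>y. u n y powr q) x \<partial>\<pi>)" for n
  define Fn where "Fn n = (\<integral>x. gauss_avg \<eta> (u n) x powr q \<partial>\<pi>)" for n
  define An where "An \<kappa> n = (\<integral>x. gauss_avg \<eta> (\<lambda>y. u n y powr (q / \<kappa>)) x powr \<kappa> \<partial>\<pi>)" for \<kappa> n
  have [measurable]: "u n \<in> borel_measurable borel" for n by (simp add: u_def)
  have u0: "u n y \<ge> 0" and uB: "u n y \<le> real (Suc n)" and ug: "u n y \<le> g y" for n y
    using nn[of y] by (auto simp: u_def)
  have uB': "\<bar>u n y\<bar> \<le> real (Suc n)" for n y using u0[of n y] uB[of n y] by simp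
  have umono: "u n y \<le> u (Suc n) y" for n y by (auto simp: u_def)
  have ulim: "(\<lambda>n. u n y) \<longlonglongrightarrow> g y" for y
  proof (rule tendsto_eventually)
    obtain n0 :: nat where "g y \<le> real n0" using real_arch_simple by blast
    then show "\<forall>\<^sub>F n in sequentially. u n y = g y"
      by (intro eventually_sequentiallyI[of n0]) (auto simp: u_def)
  qed
  have uq: "0 \<le> u n y powr q" "u n y powr q \<le> real (Suc n) powr q" for n y
    using u0[of n y] uB[of n y] q by (auto intro!: powr_mono2)
  note [measurable] = measurable_nn_integral_gaussian[OF \<eta>]
  have inc: "(\<integral>\<^sup>+y. ennreal (u n y powr q) \<partial>isotropic_gaussian \<eta> x)
           \<le> (\<integral>\<^sup>+y. ennreal (u (Suc n) y powr q) \<partial>isotropic_gaussian \<eta> x)" for n x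
    using umono u0 q by (intro nn_integral_mono ennreal_leI powr_mono2) auto
  have lim_in: "(\<lambda>n. \<integral>\<^sup>+y. ennreal (u n y powr q) \<partial>isotropic_gaussian \<eta> x)
      \<longlonglongrightarrow> (\<integral>\<^sup>+y. ennreal (g y powr q) \<partial>isotropic_gaussian \<eta> x)" for x
  proof (rule nn_integral_LIMSEQ)
    show "incseq (\<lambda>n y. ennreal (u n y powr q))"
      using umono u0 q by (intro incseq_SucI le_funI ennreal_leI powr_mono2) auto
    show "(\<lambda>n. ennreal (u n y powr q)) \<longlonglongrightarrow> ennreal (g y powr q)" for y
      using q u0 by (intro tendsto_ennrealI tendsto_powr' ulim tendsto_const) auto
  qed measurable
  have Gn_eq: "ennreal (Gn n) = (\<integral>\<^sup>+x. \<integral>\<^sup>+y. ennreal (u n y powr q) \<partial>isotropic_gaussian \<eta> x \<partial>\<pi>)" for n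
    unfolding Gn_def by (rule ennreal_integral_gauss_avg[OF assms(1) sets \<eta> _ uq]) measurable
  have "(\<lambda>n. ennreal (Gn n)) \<longlonglongrightarrow> (\<integral>\<^sup>+x. \<integral>\<^sup>+y. ennreal (g y powr q) \<partial>isotropic_gaussian \<eta> x \<partial>\<pi>)"
    unfolding Gn_eq
    by (rule nn_integral_LIMSEQ) (auto intro!: incseq_SucI le_funI inc lim_in)
  moreover have "(\<integral>\<^sup>+x. \<integral>\<^sup>+y. ennreal (g y powr q) \<partial>isotropic_gaussian \<eta> x \<partial>\<pi>) = ennreal G"
    unfolding G_def using fin by (simp add: ennreal_enn2real_if)
  ultimately have "(\<lambda>n. ennreal (Gn n)) \<longlonglongrightarrow> ennreal G" by simp
  moreover have Gn0: "Gn n \<ge> 0" for n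
    unfolding Gn_def gauss_avg_def by (intro Bochner_Integration.integral_nonneg) simp
  moreover have G0: "G \<ge> 0" by (simp add: G_def)
  ultimately have Glim: "Gn \<longlonglongrightarrow> G"
    by (simp add: tendsto_ennreal_iff[OF always_eventually])
  have uint: "integrable (isotropic_gaussian \<eta> x) (u n)" for x n
    by (rule integrable_gaussian_bounded[OF \<eta> _ uB']) simp
  have avg_le: "gauss_avg \<eta> (u n) x \<le> gauss_avg \<eta> (u (Suc n)) x" for n x
    unfolding gauss_avg_def by (rule integral_mono[OF uint uint umono])
  have avg0: "0 \<le> gauss_avg \<eta> (u n) x" for n x
    unfolding gauss_avg_def by (intro Bochner_Integration.integral_nonneg u0)
  have avgB: "gauss_avg \<eta> (u n) x \<le> real (Suc n)" for n x
    by (rule gauss_avg_bound(2)[OF \<eta> _ uB' u0]) simp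
  have [measurable]: "gauss_avg \<eta> (u n) \<in> borel_measurable borel" for n
    by (rule gauss_avg_measurable_nonneg[OF \<eta> _ u0]) simp
  have [measurable]: "gauss_avg \<eta> g \<in> borel_measurable borel"
    by (rule gauss_avg_measurable_nonneg[OF \<eta> _ nn]) simp
  have "AE x in \<pi>. (\<integral>\<^sup>+y. ennreal (g y) \<partial>isotropic_gaussian \<eta> x) \<noteq> \<infinity>"
    by (rule nn_integral_PInf_AE) (use one in auto)
  then have gint: "AE x in \<pi>. integrable (isotropic_gaussian \<eta> x) g"
    by eventually_elim (auto intro!: integrableI_nonneg simp: nn less_top)
  have intF: "integrable \<pi> (\<lambda>x. gauss_avg \<eta> (u n) x powr q)" for n
    using q by (intro integrable_const_bound[of _ "real (Suc n) powr q"])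
      (auto intro!: AE_I2 powr_mono2 avg0 order_trans[OF avgB])
  have Fn_eq: "ennreal (Fn n) = (\<integral>\<^sup>+x. ennreal (gauss_avg \<eta> (u n) x powr q) \<partial>\<pi>)" for n
    unfolding Fn_def by (rule nn_integral_eq_integral[OF intF, symmetric]) simp
  have Finc: "incseq (\<lambda>n. ennreal (gauss_avg \<eta> (u n) x powr q))" for x
    using avg0 avg_le q by (intro incseq_SucI ennreal_leI powr_mono2) auto
  have "(\<integral>\<^sup>+x. (SUP n. ennreal (gauss_avg \<eta> (u n) x powr q)) \<partial>\<pi>) = (SUP n. ennreal (Fn n))"
    unfolding Fn_eq
    by (rule nn_integral_monotone_convergence_SUP) (use Finc in \<open>auto simp: incseq_def le_fun_def\<close>)
  moreover have "(\<integral>\<^sup>+x. (SUP n. ennreal (gauss_avg \<eta> (u n) x powr q)) \<partial>\<pi>)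
       = (\<integral>\<^sup>+x. ennreal (gauss_avg \<eta> g x powr q) \<partial>\<pi>)"
  proof (rule nn_integral_cong_AE)
    show "AE x in \<pi>. (SUP n. ennreal (gauss_avg \<eta> (u n) x powr q)) = ennreal (gauss_avg \<eta> g x powr q)"
      using gint
    proof eventually_elim
      case (elim x)
      have "(\<lambda>n. gauss_avg \<eta> (u n) x) \<longlonglongrightarrow> gauss_avg \<eta> g x"
        unfolding gauss_avg_def
        by (rule integral_dominated_convergence[OF _ _ elim]) (use ulim ug u0 in auto)
      then have "(\<lambda>n. ennreal (gauss_avg \<eta> (u n) x powr q)) \<longlonglongrightarrow> ennreal (gauss_avg \<eta> g x powr q)"
        using q avg0 by (intro tendsto_ennrealI tendsto_powr' tendsto_const) auto
      then show ?case using LIMSEQ_SUP[OF Finc] LIMSEQ_unique by blast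
    qed
  qed
  ultimately have FSUP: "(\<integral>\<^sup>+x. ennreal (gauss_avg \<eta> g x powr q) \<partial>\<pi>) = (SUP n. ennreal (Fn n))" by simp
  have posu: "gauss_avg \<eta> (u n) x > 0" for n x
  proof (rule ccontr)
    assume "\<not> gauss_avg \<eta> (u n) x > 0"
    then have "gauss_avg \<eta> (u n) x = 0" using avg0[of n x] by simp
    then have "AE y in lborel. u n y = 0"
      using gauss_avg_eq_0[where v = "u n" and x = x, OF \<eta> _ uB' u0] by simp
    then have ae: "AE y in lborel. ennreal (g y) = 0"
      by eventually_elim (use nn in \<open>auto simp: u_def min_def split: if_splits\<close>)
    have "(\<integral>\<^sup>+y. ennreal (g y) \<partial>isotropic_gaussian \<eta> z) = 0" for z
      unfolding nn_integral_isotropic_gaussian[OF \<eta> measurable_compose[OF assms(6) measurable_ennreal]]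
      by (subst nn_integral_0_iff_AE) (use ae in auto)
    then show False using one by simp
  qed
  have oneu: "(\<integral>x. gauss_avg \<eta> (u n) x \<partial>\<pi>) \<le> 1" for n
  proof -
    have "ennreal (\<integral>x. gauss_avg \<eta> (u n) x \<partial>\<pi>) \<le> 1"
      unfolding ennreal_integral_gauss_avg[where v = "u n", OF assms(1) sets \<eta> \<open>u n \<in> borel_measurable borel\<close> u0 uB] one[symmetric]
      by (intro nn_integral_mono ennreal_leI ug)
    then show ?thesis by simp
  qed
  note main = dissipation_bounded[where g = "u n" and q = q for n,
      OF assms(1) sets loi \<alpha> \<eta> \<open>u _ \<in> borel_measurable borel\<close> uB u0 oneu posu, folded Gn_def Fn_def An_def]
  have Fn_Gn: "Fn n \<le> Gn n" for n
    using main(2)[of 2 "1/2" n] main(3)[of 2 "1/2" n] q by simp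
  have Fn0: "0 < Fn n" for n
  proof -
    have "Fn n \<noteq> 0"
      unfolding Fn_def using integral_nonneg_eq_0_iff_AE[OF intF, of n] posu
      by (simp add: less_imp_neq[symmetric] AE_False)
    moreover have "Fn n \<ge> 0" unfolding Fn_def by (rule Bochner_Integration.integral_nonneg) simp
    ultimately show ?thesis by simp
  qed
  have incG: "incseq Gn"
  proof (rule incseq_SucI)
    fix n
    have "ennreal (Gn n) \<le> ennreal (Gn (Suc n))" unfolding Gn_eq by (intro nn_integral_mono inc)
    then show "Gn n \<le> Gn (Suc n)" using Gn0[of "Suc n"] by (simp add: ennreal_le_iff)
  qed
  have "Gn n \<le> G" for n using incseq_le[OF incG Glim] .
  then have FnG: "Fn n \<le> G" for n using Fn_Gn[of n] by (meson order_trans)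
  then have "(SUP n. ennreal (Fn n)) \<le> ennreal G" by (intro SUP_least ennreal_leI)
  then have Fle: "(\<integral>\<^sup>+x. ennreal (gauss_avg \<eta> g x powr q) \<partial>\<pi>) \<le> ennreal G" using FSUP by simp
  show Ffin: "(\<integral>\<^sup>+x. ennreal (gauss_avg \<eta> g x powr q) \<partial>\<pi>) < \<infinity>"
    using Fle by (simp add: order_le_less_trans)
  have F_eq: "ennreal F = (SUP n. ennreal (Fn n))"
    unfolding F_def FSUP[symmetric] using Ffin by (intro ennreal_enn2real) simp
  have incF: "incseq Fn"
    using avg_le avg0 q intF unfolding Fn_def
    by (intro incseq_SucI integral_mono) (auto intro!: powr_mono2)
  have F0: "F \<ge> 0" by (simp add: F_def)
  have "(\<lambda>n. ennreal (Fn n)) \<longlonglongrightarrow> ennreal F"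
    unfolding F_eq using incF by (intro LIMSEQ_SUP) (auto simp: incseq_def intro!: ennreal_leI)
  then have Flim: "Fn \<longlonglongrightarrow> F"
    using F0 Fn0 by (simp add: tendsto_ennreal_iff[OF always_eventually] less_imp_le)
  show Fpos: "0 < F" using incseq_le[OF incF Flim, of 0] Fn0[of 0] by simp
  show FG: "F \<le> G" by (rule LIMSEQ_le_const2[OF Flim]) (use FnG in auto)
  show "2 * (\<kappa> - 1) / \<kappa>\<^sup>2 * (\<alpha> * \<eta>) * t powr (- (2 * (1 - 1 / r)))
          * (1 - exp (- (t / (2 - t)) * (ln G / (q - 1) - (ln G - ln F) / (\<kappa> - 1))))
        \<le> ln G - ln F"
    if \<kappa>: "2 \<le> \<kappa>" "\<kappa> \<le> q" and t: "0 < t" "t < 1" for \<kappa> t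
  proof -
    define C where "C = 2 * (\<kappa> - 1) / \<kappa>\<^sup>2 * (\<alpha> * \<eta>) * t powr (- (2 * (1 - 1 / r)))"
    define \<tau> where "\<tau> = t / (2 - t)"
    have C: "C \<ge> 0" unfolding C_def using \<kappa> \<alpha> \<eta> by auto
    have tau: "\<tau> \<ge> 0" using t by (simp add: \<tau>_def)
    have step: "C * (1 - exp (- \<tau> * (ln (Gn n) / (q - 1) - (ln (Gn n) - ln (Fn n)) / (\<kappa> - 1))))
        \<le> ln (Gn n) - ln (Fn n)" for n
    proof -
      note M = main[OF \<kappa> t, of n]
      have lnle: "ln (Fn n) \<le> ln (An \<kappa> n)" using M(1,3) Fn0[of n] by simp
      have "C * (1 - exp (- \<tau> * (ln (Gn n) / (q - 1) - (ln (Gn n) - ln (Fn n)) / (\<kappa> - 1))))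
         \<le> C * (1 - exp (- \<tau> * (ln (Gn n) / (q - 1) - (ln (Gn n) - ln (An \<kappa> n)) / (\<kappa> - 1))))"
      proof -
        have "(ln (Gn n) - ln (An \<kappa> n)) / (\<kappa> - 1) \<le> (ln (Gn n) - ln (Fn n)) / (\<kappa> - 1)"
          using lnle \<kappa> by (intro divide_right_mono) auto
        then have "\<tau> * (ln (Gn n) / (q - 1) - (ln (Gn n) - ln (Fn n)) / (\<kappa> - 1))
          \<le> \<tau> * (ln (Gn n) / (q - 1) - (ln (Gn n) - ln (An \<kappa> n)) / (\<kappa> - 1))"
          using tau by (intro mult_left_mono) auto
        then show ?thesis using C by (intro mult_left_mono) auto
      qed
      also have "\<dots> \<le> ln (Gn n) - ln (An \<kappa> n)" using M(4) by (simp only: C_def \<tau>_def)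
      also have "\<dots> \<le> ln (Gn n) - ln (Fn n)" using lnle by simp
      finally show ?thesis .
    qed
    have Gpos: "G > 0" using Fpos FG by simp
    have "(\<lambda>n. C * (1 - exp (- \<tau> * (ln (Gn n) / (q - 1) - (ln (Gn n) - ln (Fn n)) / (\<kappa> - 1)))))
       \<longlonglongrightarrow> C * (1 - exp (- \<tau> * (ln G / (q - 1) - (ln G - ln F) / (\<kappa> - 1))))"
      using Gpos Fpos q \<kappa> by (intro tendsto_intros Glim Flim) auto
    moreover have "(\<lambda>n. ln (Gn n) - ln (Fn n)) \<longlonglongrightarrow> ln G - ln F"
      using Gpos Fpos by (intro tendsto_intros Glim Flim) auto
    ultimately have "C * (1 - exp (- \<tau> * (ln G / (q - 1) - (ln G - ln F) / (\<kappa> - 1)))) \<le> ln G - ln F"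
      by (rule LIMSEQ_le) (use step in auto)
    then show ?thesis by (simp only: C_def \<tau>_def)
  qed
qed

section \<open>From implicit dissipation to decay of the divergence\<close>

text \<open>
  An antiderivative of the reciprocal of \<open>decay_rate\<close>, normalised to vanish at 1.
  Along the differential equation in which \<open>R\<close> decreases at speed
  \<open>decay_rate s R\<close> it decreases at unit speed.
\<close>

definition decay_clock :: "real \<Rightarrow> real \<Rightarrow> real" where
  "decay_clock s R = (if R \<le> 1 then ln R else (R powr s - 1) / s)"

text \<open>
  The power of \<open>R\<close> with exponent \<open>1 - s\<close> when \<open>R\<close> is at
  least 1, and \<open>R\<close> itself below 1.
\<close>

definition decay_rate :: "real \<Rightarrow> real \<Rightarrow> real" where
  "decay_rate s R = R * max 1 R powr (- s)"

lemma powr_le_tangent: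
  fixes x y :: real
  assumes "0 \<le> y" "y \<le> 1" "x > 0"
  shows "x powr y \<le> 1 + y * (x - 1)"
  using Youngs_inequality_0[of y "1 - y" x 1] assms by (simp add: algebra_simps)

lemma ln_le_powr:
  fixes R :: real
  assumes "s > 0" "R > 0"
  shows "ln R \<le> (R powr s - 1) / s"
proof -
  have "1 + s * ln R \<le> exp (s * ln R)" by (rule exp_ge_add_one_self)
  then show ?thesis using assms by (simp add: powr_def field_simps)
qed

lemma ln_le_decay_clock: "s > 0 \<Longrightarrow> R > 0 \<Longrightarrow> ln R \<le> decay_clock s R"
  unfolding decay_clock_def using ln_le_powr by auto

lemma decay_clock_le:
  "s > 0 \<Longrightarrow> R > 0 \<Longrightarrow> decay_clock s R \<le> (R powr s - 1) / s"
  unfolding decay_clock_def using ln_le_powr by auto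

lemma decay_rate_le: "s > 0 \<Longrightarrow> R \<ge> 0 \<Longrightarrow> decay_rate s R \<le> R"
  unfolding decay_rate_def by (intro mult_left_le) (auto simp: powr_minus_divide ge_one_powr_ge_zero)

lemma decay_rate_pos: "R > 0 \<Longrightarrow> decay_rate s R > 0"
  by (simp add: decay_rate_def)

lemma decay_rate_half:
  assumes "s > 0" "R / 2 \<le> R'" "R' \<le> R" "R > 0"
  shows "decay_rate s R / 2 \<le> decay_rate s R'"
proof -
  have "(R / 2) * max 1 R powr (- s) \<le> R' * max 1 R' powr (- s)"
    using assms by (intro mult_mono powr_mono2') auto
  then show ?thesis by (simp add: decay_rate_def)
qed

text \<open>Concavity of the clock: its slope at the upper end point is the smallest one.\<close>

lemma decay_clock_drop_linear:
  assumes s: "0 < s" "s \<le> 1" and R: "0 < R'" "R' \<le> R"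
  shows "(R - R') / decay_rate s R \<le> decay_clock s R - decay_clock s R'"
proof -
  have low: "1 - u \<le> - ln u" if "u > 0" for u :: real
    using ln_le_minus_one[OF that] by simp
  have high: "(z - w) * z powr (s - 1) \<le> (z powr s - w powr s) / s" if "0 < w" "w \<le> z" for z w :: real
  proof -
    have "w powr s = z powr s * (w / z) powr s" using that by (simp add: powr_divide)
    also have "\<dots> \<le> z powr s * (1 + s * (w / z - 1))"
      using that s by (intro mult_left_mono powr_le_tangent) auto
    finally have "s * (z powr s * (1 - w / z)) \<le> z powr s - w powr s" by (simp add: algebra_simps)
    moreover have "z powr s * (1 - w / z) = (z - w) * z powr (s - 1)"
      using that by (simp add: powr_diff field_simps)
    ultimately show ?thesis using s by (simp add: field_simps)
  qed
  consider "R \<le> 1" | "1 < R'" | "R' \<le> 1" "1 < R" by linarith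
  then show ?thesis
  proof cases
    case 1
    have "1 - R' / R \<le> - ln (R' / R)" using R by (intro low) auto
    then show ?thesis
      using 1 R by (simp add: decay_clock_def decay_rate_def ln_div diff_divide_distrib)
  next
    case 2
    have dr: "decay_rate s R = R powr (1 - s)"
      using 2 R by (simp add: decay_rate_def powr_diff powr_minus_divide)
    have "(R - R') / decay_rate s R = (R - R') * R powr (s - 1)"
      unfolding dr using powr_minus[of R "1 - s"] by (simp add: divide_inverse)
    then show ?thesis
      using high[OF R] 2 R by (simp add: decay_clock_def diff_divide_distrib)
  next
    case 3
    have dr: "decay_rate s R = R powr (1 - s)"
      using 3 R by (simp add: decay_rate_def powr_diff powr_minus_divide)
    have "(R - R') / decay_rate s R = (R - 1) * R powr (s - 1) + (1 - R') * R powr (s - 1)"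
      unfolding dr using powr_minus[of R "1 - s"] by (simp add: divide_inverse algebra_simps)
    also have "\<dots> \<le> (R powr s - 1) / s + (1 - R') * 1"
    proof (rule add_mono)
      show "(R - 1) * R powr (s - 1) \<le> (R powr s - 1) / s" using high[of 1 R] 3 by simp
      have "R powr (s - 1) \<le> R powr 0" using 3 s by (intro powr_mono) auto
      then show "(1 - R') * R powr (s - 1) \<le> (1 - R') * 1" using 3 by (intro mult_left_mono) auto
    qed
    also have "\<dots> \<le> (R powr s - 1) / s - ln R'" using low[OF R(1)] by simp
    finally show ?thesis using 3 by (simp add: decay_clock_def)
  qed
qed

text \<open>
  For an implicit Euler step, where the rate is evaluated at the new value, a long step of
  length \<open>x\<close> still advances the clock by \<open>ln (1 + x)\<close>. The worst
  case is that of a rate proportional to \<open>R\<close>.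
\<close>

lemma decay_clock_drop_log:
  assumes s: "0 < s" "s \<le> 1" and R': "0 < R'" and x: "x \<ge> 0"
    and R: "R' + x * decay_rate s R' \<le> R"
  shows "ln (1 + x) \<le> decay_clock s R - decay_clock s R'"
proof (cases "R' \<le> 1")
  case True
  then have "R' * (1 + x) \<le> R" using R by (simp add: decay_rate_def algebra_simps)
  moreover have "R' * (1 + x) > 0" using R' x by auto
  ultimately have "ln (R' * (1 + x)) \<le> ln R" by simp
  then have "ln R' + ln (1 + x) \<le> ln R" using R' x by (simp add: ln_mult)
  also have "\<dots> \<le> decay_clock s R"
    using \<open>R' * (1 + x) \<le> R\<close> \<open>R' * (1 + x) > 0\<close> s by (intro ln_le_decay_clock) auto
  finally show ?thesis using True by (simp add: decay_clock_def)
next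
  case False
  define y where "y = R' powr (- s)"
  have y: "0 < y" "y \<le> 1" using False s
    by (auto simp: y_def powr_minus_divide ge_one_powr_ge_zero)
  have Ry: "R' * (1 + x * y) \<le> R" using R False by (simp add: decay_rate_def y_def algebra_simps)
  have xy: "x * y \<ge> 0" using x y by simp
  have "R' * 1 \<le> R' * (1 + x * y)" using xy R' by (intro mult_left_mono) auto
  then have R1: "R > 1" using Ry False by linarith
  define z where "z = R / R'"
  have z: "1 + x * y \<le> z" using Ry R' by (simp add: z_def field_simps)
  have "y * ln (1 + x) = ln ((1 + x) powr y)" using x by (simp add: ln_powr)
  also have "\<dots> \<le> ln (1 + y * x)"
  proof (rule iffD2[OF ln_le_cancel_iff])
    show "0 < (1 + x) powr y" using x by simp
    show "0 < 1 + y * x" using xy by (simp add: mult.commute[of y])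
    show "(1 + x) powr y \<le> 1 + y * x" using powr_le_tangent[of y "1 + x"] y x by simp
  qed
  also have "\<dots> \<le> ln z" using z xy by (simp add: mult.commute)
  also have "\<dots> \<le> (z powr s - 1) / s" using z xy s by (intro ln_le_powr) auto
  finally have "ln (1 + x) \<le> ((z powr s - 1) / s) / y"
    unfolding pos_le_divide_eq[OF y(1)] by (simp only: mult.commute)
  also have "\<dots> = ((z * R') powr s - R' powr s) / s"
    using R' z xy by (simp add: y_def powr_minus powr_mult divide_inverse algebra_simps)
  also have "z * R' = R" using R' by (simp add: z_def)
  finally show ?thesis using R1 False by (simp add: decay_clock_def diff_divide_distrib)
qed

text \<open>
  The choice \<open>t = 1 / (2 * max 1 R)\<close> makes the exponent of order
  \<open>min R 1\<close>, where the exponential is comparable with its linearisation, while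
  the power of \<open>t\<close> supplies the factor \<open>max 1 R powr (1 - s)\<close>.
\<close>

lemma implicit_dissipation:
  assumes s: "0 < s" "s \<le> 1" and K: "K > 0" and \<kappa>: "\<kappa> \<ge> 2" and R: "R > 0"
    and H: "\<And>t. 0 < t \<Longrightarrow> t < 1 \<Longrightarrow>
      2 * (\<kappa> - 1) / \<kappa>\<^sup>2 * K * t powr (- (1 - s)) * (1 - exp (- (t / (2 - t)) * R)) \<le> X"
  shows "(\<kappa> - 1) * (2 / 5 * K / \<kappa>\<^sup>2 * decay_rate s R) \<le> X"
proof -
  define M where "M = max 1 R"
  define t where "t = 1 / (2 * M)"
  have M: "M \<ge> 1" "R \<le> M" by (auto simp: M_def)
  have t: "0 < t" "t < 1" using M by (auto simp: t_def)
  define y where "y = R / (4 * M)"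
  have y: "0 \<le> y" "y \<le> 1 / 4" using M R by (auto simp: y_def field_simps)
  have "exp (- (t / (2 - t)) * R) \<le> exp (- y)"
  proof -
    have "t / 2 \<le> t / (2 - t)" using t by (intro divide_left_mono) auto
    then have "t / 2 * R \<le> t / (2 - t) * R" using R by (intro mult_right_mono) auto
    moreover have "t / 2 * R = y" by (simp add: t_def y_def)
    ultimately show ?thesis by simp
  qed
  also have "\<dots> \<le> 1 - 4 / 5 * y"
  proof -
    have "exp (- y) = inverse (exp y)" by (rule exp_minus)
    also have "\<dots> \<le> inverse (1 + y)" using y by (intro le_imp_inverse_le exp_ge_add_one_self) auto
    also have "\<dots> = 1 / (1 + y)" by (rule inverse_eq_divide)
    also have "\<dots> \<le> 1 - 4 / 5 * y"
    proof -
      have "(1 - 4 / 5 * y) * (1 + y) = 1 + y * (1 / 5 - 4 / 5 * y)" by algebra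
      moreover have "y * (1 / 5 - 4 / 5 * y) \<ge> 0" using y by (intro mult_nonneg_nonneg) auto
      ultimately have "1 \<le> (1 - 4 / 5 * y) * (1 + y)" by linarith
      moreover have "0 < 1 + y" using y by linarith
      ultimately show ?thesis by (simp only: pos_divide_le_eq)
    qed
    finally show ?thesis .
  qed
  finally have e: "4 / 5 * y \<le> 1 - exp (- (t / (2 - t)) * R)" by simp
  have "M powr (1 - s) \<le> (2 * M) powr (1 - s)" using M s by (intro powr_mono2) auto
  also have "\<dots> = t powr (- (1 - s))"
    unfolding t_def using M powr_minus_divide[of "2 * M" "- (1 - s)"] powr_divide[of 1 "2 * M" "- (1 - s)"]
    by simp
  finally have p: "M powr (1 - s) \<le> t powr (- (1 - s))" .
  have c: "2 * (\<kappa> - 1) / \<kappa>\<^sup>2 * K \<ge> 0" using \<kappa> K by simp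
  have "(\<kappa> - 1) * (2 / 5 * K / \<kappa>\<^sup>2 * decay_rate s R) = 2 * (\<kappa> - 1) / \<kappa>\<^sup>2 * K * M powr (1 - s) * (4 / 5 * y)"
  proof -
    have "M powr (1 - s) = M * M powr (- s)" using M powr_add[of M 1 "- s"] by simp
    then have "decay_rate s R = M powr (1 - s) * (4 * y)"
      using M by (simp add: decay_rate_def y_def flip: M_def)
    then show ?thesis by (simp add: left_diff_distrib right_diff_distrib) (simp add: field_simps)
  qed
  also have "\<dots> \<le> 2 * (\<kappa> - 1) / \<kappa>\<^sup>2 * K * t powr (- (1 - s)) * (1 - exp (- (t / (2 - t)) * R))"
    using y by (intro mult_mono[OF mult_left_mono[OF p c] e] mult_nonneg_nonneg[OF c]) auto
  also have "\<dots> \<le> X" by (rule H[OF t])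
  finally show ?thesis .
qed

text \<open>
  With \<open>L = ln (1 + K)\<close>, three choices of \<open>\<kappa>\<close> cover all
  \<open>K\<close> and \<open>q\<close>. For \<open>L \<le> 34\<close> take
  \<open>\<kappa> = 2\<close>. For larger \<open>L\<close> take
  \<open>\<kappa> = 2 + L / 34\<close>; then \<open>K\<close>, which is exponentially large in
  \<open>L\<close>, dominates \<open>\<kappa>\<^sup>2\<close>. If this exceeds
  \<open>q\<close>, take \<open>\<kappa> = q\<close>: the inequality then is a genuine
  implicit Euler step, and its logarithmic gain is of order \<open>L\<close>.
\<close>

lemma decay_clock_step:
  assumes s: "0 < s" "s \<le> 1" and K: "K > 0" and q: "q \<ge> 2" and R: "0 < R'" "R' \<le> R"
    and H: "\<And>\<kappa> t. 2 \<le> \<kappa> \<Longrightarrow> \<kappa> \<le> q \<Longrightarrow> 0 < t \<Longrightarrow> t < 1 \<Longrightarrow>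
      2 * (\<kappa> - 1) / \<kappa>\<^sup>2 * K * t powr (- (1 - s))
        * (1 - exp (- (t / (2 - t)) * (R - (q - 1) * (R - R') / (\<kappa> - 1)))) \<le> (q - 1) * (R - R')"
  shows "decay_clock s R' \<le> decay_clock s R - ln (1 + K) / (68 * q)"
proof -
  define L where "L = ln (1 + K)"
  have L: "0 < L" "L \<le> K" using K ln_add_one_self_le_self[of K] by (auto simp: L_def)
  have K_eq: "K = exp L - 1" using K by (simp add: L_def)
  have R0: "R > 0" using R by simp
  have linear: "(\<kappa> - 1) / q * (min (2 / 5 * K / \<kappa>\<^sup>2) 1 / 2) \<le> decay_clock s R - decay_clock s R'"
    if \<kappa>: "2 \<le> \<kappa>" "\<kappa> \<le> q" for \<kappa>
  proof -
    \<comment> \<open>The implicit point: the drop \<open>R - R'\<close> is the fraction \<open>(\<kappa> - 1) / (q - 1)\<close> of \<open>R - Z\<close>.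
      Either \<open>Z\<close> is at least \<open>R / 2\<close>, where the rates at \<open>Z\<close> and \<open>R\<close> are comparable,
      or the drop to \<open>Z\<close> exceeds \<open>R / 2\<close> already.\<close>
    define Z where "Z = R - (q - 1) * (R - R') / (\<kappa> - 1)"
    define x where "x = 2 / 5 * K / \<kappa>\<^sup>2"
    define \<mu> where "\<mu> = min x 1"
    have \<mu>: "0 \<le> \<mu>" "\<mu> \<le> x" "\<mu> \<le> 1" using K by (auto simp: \<mu>_def x_def)
    have eqZ: "(\<kappa> - 1) * (R - Z) = (q - 1) * (R - R')" using \<kappa> by (simp add: Z_def)
    have ZR: "R - Z \<ge> 0" using R \<kappa> q by (simp add: Z_def)
    have dr: "decay_rate s R > 0" by (rule decay_rate_pos[OF R0])
    have "\<mu> / 2 * decay_rate s R \<le> R - Z"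
    proof (cases "R / 2 \<le> Z")
      case True
      then have "Z > 0" using R0 by simp
      have "(\<kappa> - 1) * (x * decay_rate s Z) \<le> (q - 1) * (R - R')"
        unfolding x_def
        by (rule implicit_dissipation[OF s K \<kappa>(1) \<open>Z > 0\<close>]) (use H[OF \<kappa>] in \<open>simp add: Z_def\<close>)
      then have "x * decay_rate s Z \<le> R - Z" unfolding eqZ[symmetric] using \<kappa> by simp
      moreover have "\<mu> * (decay_rate s R / 2) \<le> x * decay_rate s Z"
        using decay_rate_half[OF s(1) True _ R0] ZR \<mu> dr by (intro mult_mono) auto
      ultimately show ?thesis by simp
    next
      case False
      have "\<mu> / 2 * decay_rate s R \<le> 1 / 2 * R"
        using \<mu> decay_rate_le[OF s(1), of R] R0 dr by (intro mult_mono) auto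
      then show ?thesis using False by simp
    qed
    then have "(\<kappa> - 1) * (\<mu> / 2 * decay_rate s R) \<le> (q - 1) * (R - R')"
      unfolding eqZ[symmetric] using \<kappa> by (intro mult_left_mono) auto
    also have "\<dots> \<le> q * (R - R')" using R by (intro mult_right_mono) auto
    finally have "(\<kappa> - 1) / q * (\<mu> / 2) \<le> (R - R') / decay_rate s R"
      using q dr by (simp add: field_simps)
    also have "\<dots> \<le> decay_clock s R - decay_clock s R'" by (rule decay_clock_drop_linear[OF s R])
    finally show ?thesis by (simp add: \<mu>_def x_def)
  qed
  have "L / (68 * q) \<le> decay_clock s R - decay_clock s R'"
  proof (cases "L \<le> 34")
    case True
    have "L / 34 \<le> min (2 / 5 * K / 2\<^sup>2) 1" using True L by simp
    then have "L / (68 * q) \<le> (2 - 1) / q * (min (2 / 5 * K / 2\<^sup>2) 1 / 2)"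
      using q by (simp add: field_simps)
    also have "\<dots> \<le> decay_clock s R - decay_clock s R'" using q by (intro linear) auto
    finally show ?thesis .
  next
    case False
    then have L34: "L > 34" by simp
    have K2: "L\<^sup>2 / 2 \<le> K" using exp_lower_Taylor_quadratic[of L] L by (simp add: K_eq)
    define \<kappa> where "\<kappa> = 2 + L / 34"
    have \<kappa>: "2 \<le> \<kappa>" "\<kappa> \<le> L / 10" using L34 by (auto simp: \<kappa>_def)
    have sq: "\<kappa>\<^sup>2 \<le> L\<^sup>2 / 100" using power_mono[OF \<kappa>(2), of 2] \<kappa>(1) by (simp add: power_divide)
    show ?thesis
    proof (cases "\<kappa> \<le> q")
      case True
      have "\<kappa>\<^sup>2 \<le> 2 / 5 * K" using sq K2 zero_le_power2[of L] by linarith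
      then have "min (2 / 5 * K / \<kappa>\<^sup>2) 1 = 1" using \<kappa> by (simp add: min_def)
      then have "(\<kappa> - 1) / q * (1 / 2) \<le> decay_clock s R - decay_clock s R'"
        using linear[OF \<kappa>(1) True] by simp
      moreover have "L / (68 * q) \<le> (\<kappa> - 1) / q * (1 / 2)"
        using q by (simp add: \<kappa>_def field_simps)
      ultimately show ?thesis by simp
    next
      case False
      define x where "x = 2 / 5 * K / q\<^sup>2"
      have x: "x \<ge> 0" using K by (simp add: x_def)
      have "(q - 1) * (x * decay_rate s R') \<le> (q - 1) * (R - R')"
        unfolding x_def
        by (rule implicit_dissipation[OF s K q R(1)]) (use H[OF q order_refl] q in simp)
      then have "R' + x * decay_rate s R' \<le> R" using q by simp
      from decay_clock_drop_log[OF s R(1) x this]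
      have drop: "ln (1 + x) \<le> decay_clock s R - decay_clock s R'" .
      have E: "exp (L / 2) * (L\<^sup>2 / 8) \<le> K"
      proof -
        have "exp (L / 2) * (1 + (L / 2) + (L / 2)\<^sup>2 / 2) \<le> exp (L / 2) * exp (L / 2)"
          using L by (intro mult_left_mono exp_lower_Taylor_quadratic) auto
        also have "\<dots> = exp L" by (simp flip: exp_add)
        finally have "exp (L / 2) * (L / 2) + exp (L / 2) + exp (L / 2) * (L\<^sup>2 / 8) \<le> exp L"
          by (simp add: algebra_simps power_divide)
        moreover have "1 \<le> exp (L / 2)" "0 \<le> exp (L / 2) * (L / 2)" using L by auto
        ultimately show ?thesis unfolding K_eq by linarith
      qed
      have "q\<^sup>2 \<le> \<kappa>\<^sup>2" using False q by (intro power_mono) auto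
      then have q2: "q\<^sup>2 \<le> L\<^sup>2 / 100" using sq by simp
      have "exp (L / 2) * q\<^sup>2 \<le> exp (L / 2) * (L\<^sup>2 / 100)" by (intro mult_left_mono q2) auto
      also have "\<dots> \<le> 2 / 5 * (exp (L / 2) * (L\<^sup>2 / 8))" by simp
      also have "\<dots> \<le> 2 / 5 * K" using E by (intro mult_left_mono) auto
      finally have "exp (L / 2) \<le> x" using q by (simp add: x_def le_divide_eq)
      then have "exp (L / 2) \<le> 1 + x" by simp
      then have "L / 2 \<le> ln (1 + x)" using x by (subst ln_ge_iff) auto
      moreover have "L / (68 * q) \<le> L / 2" using L q by (intro divide_left_mono) auto
      ultimately show ?thesis using drop by simp
    qed
  qed
  then show ?thesis by (simp add: L_def)
qed

section \<open>The posterior as a Gibbs measure\<close>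

definition gibbs_density :: "('a::euclidean_space \<Rightarrow> real) \<Rightarrow> 'a \<Rightarrow> real" where
  "gibbs_density V x = exp (- V x) / (\<integral>z. exp (- V z) \<partial>lborel)"

lemma gibbs_eq: "gibbs V = density lborel (\<lambda>x. ennreal (gibbs_density V x))"
  by (simp add: gibbs_def gibbs_density_def)

text \<open>
  Measurability of the potential comes from that of its Gibbs weight, as the logarithm
  recovers it.
\<close>

lemma potential_measurable:
  fixes V :: "'a::euclidean_space \<Rightarrow> real"
  assumes "integrable lborel (\<lambda>x. exp (- V x))"
  shows "V \<in> borel_measurable borel"
proof -
  have [measurable]: "(\<lambda>x. exp (- V x)) \<in> borel_measurable borel" using assms by auto
  have "V = (\<lambda>x. - ln (exp (- V x)))" by simp
  also have "\<dots> \<in> borel_measurable borel" by measurable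
  finally show ?thesis .
qed

lemma partition_pos:
  fixes V :: "'a::euclidean_space \<Rightarrow> real"
  assumes "integrable lborel (\<lambda>x. exp (- V x))"
  shows "(\<integral>z. exp (- V z) \<partial>lborel) > 0"
proof -
  have "(\<integral>z. exp (- V z) \<partial>lborel) \<noteq> 0"
    using integral_nonneg_eq_0_iff_AE[OF assms] by (simp add: eventually_False ae_filter_eq_bot_iff)
  moreover have "(\<integral>z. exp (- V z) \<partial>lborel) \<ge> 0" by (rule Bochner_Integration.integral_nonneg) simp
  ultimately show ?thesis by linarith
qed

lemma gibbs_density_pos:
  "integrable lborel (\<lambda>x. exp (- V x)) \<Longrightarrow> gibbs_density V (x::'a::euclidean_space) > 0"
  by (simp add: gibbs_density_def partition_pos)

lemma gibbs_density_measurable: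
  "integrable lborel (\<lambda>x. exp (- V x)) \<Longrightarrow> gibbs_density V \<in> borel_measurable borel"
  unfolding gibbs_density_def using potential_measurable[of V] by measurable

lemma nn_integral_gibbs_density:
  fixes V :: "'a::euclidean_space \<Rightarrow> real"
  assumes "integrable lborel (\<lambda>x. exp (- V x))"
  shows "(\<integral>\<^sup>+x. ennreal (gibbs_density V x) \<partial>lborel) = 1"
proof -
  have "(\<integral>\<^sup>+x. ennreal (gibbs_density V x) \<partial>lborel) = ennreal (\<integral>x. gibbs_density V x \<partial>lborel)"
    using assms gibbs_density_pos[OF assms]
    by (intro nn_integral_eq_integral) (auto simp: gibbs_density_def less_imp_le)
  also have "(\<integral>x. gibbs_density V x \<partial>lborel) = 1"
    using partition_pos[OF assms] by (simp add: gibbs_density_def)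
  finally show ?thesis by simp
qed

lemma sets_gibbs [simp, measurable_cong]: "sets (gibbs V) = sets borel"
  by (simp add: gibbs_def)

lemma space_gibbs [simp]: "space (gibbs V) = UNIV"
  by (simp add: gibbs_def)

lemma prob_space_gibbs:
  fixes V :: "'a::euclidean_space \<Rightarrow> real"
  assumes "integrable lborel (\<lambda>x. exp (- V x))"
  shows "prob_space (gibbs V)"
proof (rule prob_spaceI)
  note [measurable] = gibbs_density_measurable[OF assms]
  show "emeasure (gibbs V) (space (gibbs V)) = 1"
    unfolding gibbs_eq by (simp add: emeasure_density nn_integral_gibbs_density[OF assms])
qed

lemma nn_integral_gibbs:
  fixes V :: "'a::euclidean_space \<Rightarrow> real"
  assumes "integrable lborel (\<lambda>x. exp (- V x))" and [measurable]: "h \<in> borel_measurable borel"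
  shows "(\<integral>\<^sup>+x. h x \<partial>gibbs V) = (\<integral>\<^sup>+x. ennreal (gibbs_density V x) * h x \<partial>lborel)"
proof -
  note [measurable] = gibbs_density_measurable[OF assms(1)]
  show ?thesis unfolding gibbs_eq by (subst nn_integral_density) auto
qed

definition posterior_potential :: "('a::euclidean_space \<Rightarrow> real) \<Rightarrow> real \<Rightarrow> 'a \<Rightarrow> 'a \<Rightarrow> real" where
  "posterior_potential f \<eta> y x = f x + (norm (x - y))\<^sup>2 / (2 * \<eta>)"

lemma prox_backward_eq: "prox_backward f \<eta> y = gibbs (posterior_potential f \<eta> y)"
  by (simp add: prox_backward_def posterior_potential_def[abs_def])

lemma integrable_posterior:
  fixes f :: "'a::euclidean_space \<Rightarrow> real"
  assumes f: "integrable lborel (\<lambda>x. exp (- f x))" and \<eta>: "\<eta> > 0"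
  shows "integrable lborel (\<lambda>x. exp (- posterior_potential f \<eta> y x))"
proof -
  have [measurable]: "f \<in> borel_measurable borel" by (rule potential_measurable[OF f])
  show ?thesis
    by (rule Bochner_Integration.integrable_bound[OF f])
       (use \<eta> in \<open>auto simp: posterior_potential_def\<close>)
qed

text \<open>The density of the second marginal of the joint law.\<close>

definition smoothed_density :: "('a::euclidean_space \<Rightarrow> real) \<Rightarrow> real \<Rightarrow> 'a \<Rightarrow> real" where
  "smoothed_density f \<eta> y = (\<integral>x. gibbs_density f x * gauss_kernel \<eta> x y \<partial>lborel)"

text \<open>
  Bayes' rule: the joint density factors through the second marginal and the posterior.
\<close>

lemma gibbs_density_gauss_kernel:
  fixes f :: "'a::euclidean_space \<Rightarrow> real"
  assumes f: "integrable lborel (\<lambda>x. exp (- f x))" and \<eta>: "\<eta> > 0"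
  shows "smoothed_density f \<eta> y > 0"
    and "gibbs_density f x * gauss_kernel \<eta> x y
       = smoothed_density f \<eta> y * gibbs_density (posterior_potential f \<eta> y) x"
proof -
  let ?P = "posterior_potential f \<eta> y"
  define Z where "Z = (\<integral>z. exp (- f z) \<partial>lborel)"
  define Y where "Y = (\<integral>z. exp (- ?P z) \<partial>lborel)"
  define c where "c = gauss_const TYPE('a) \<eta>"
  have Z: "Z > 0" unfolding Z_def by (rule partition_pos[OF f])
  have Y: "Y > 0" unfolding Y_def by (rule partition_pos[OF integrable_posterior[OF f \<eta>]])
  have c: "c > 0" unfolding c_def by (rule gauss_const_pos[OF \<eta>])
  have eq: "gibbs_density f z * gauss_kernel \<eta> z y = c / Z * exp (- ?P z)" for z
    unfolding gibbs_density_def gauss_kernel_def Z_def[symmetric] c_def[symmetric] posterior_potential_def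
    by (simp add: exp_add exp_diff norm_minus_commute exp_minus field_simps)
  have s: "smoothed_density f \<eta> y = c / Z * Y"
    unfolding smoothed_density_def eq by (simp add: Y_def)
  show "smoothed_density f \<eta> y > 0" unfolding s using Z Y c by simp
  show "gibbs_density f x * gauss_kernel \<eta> x y = smoothed_density f \<eta> y * gibbs_density ?P x"
    unfolding eq s using Y by (simp add: gibbs_density_def Y_def[symmetric])
qed

lemma Bayes_ennreal:
  fixes f :: "'a::euclidean_space \<Rightarrow> real"
  assumes f: "integrable lborel (\<lambda>x. exp (- f x))" and \<eta>: "\<eta> > 0"
  shows "ennreal (gibbs_density f x) * ennreal (gauss_kernel \<eta> x y)
       = ennreal (smoothed_density f \<eta> y) * ennreal (gibbs_density (posterior_potential f \<eta> y) x)"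
  using gibbs_density_gauss_kernel(1)[OF f \<eta>, of y] gibbs_density_gauss_kernel(2)[OF f \<eta>, of x y]
    gibbs_density_pos[OF f, of x] gibbs_density_pos[OF integrable_posterior[OF f \<eta>], of y x]
    gauss_kernel_pos[OF \<eta>, of x y]
  by (simp add: ennreal_mult'[symmetric] less_imp_le)

lemma smoothed_density_measurable:
  fixes f :: "'a::euclidean_space \<Rightarrow> real"
  assumes f: "integrable lborel (\<lambda>x. exp (- f x))"
  shows "smoothed_density f \<eta> \<in> borel_measurable borel"
proof -
  note [measurable] = gibbs_density_measurable[OF f]
  show ?thesis unfolding smoothed_density_def
    by (rule sigma_finite_measure.borel_measurable_lebesgue_integral[OF sigma_finite_lborel]) measurable
qed

lemma posterior_density_measurable:
  fixes f :: "'a::euclidean_space \<Rightarrow> real"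
  assumes f: "integrable lborel (\<lambda>x. exp (- f x))" and \<eta>: "\<eta> > 0"
  shows "(\<lambda>z. gibbs_density (posterior_potential f \<eta> (fst z)) (snd z)) \<in> borel_measurable (borel \<Otimes>\<^sub>M borel)"
proof -
  note [measurable] = gibbs_density_measurable[OF f] smoothed_density_measurable[OF f, of \<eta>]
  have "gibbs_density (posterior_potential f \<eta> (fst z)) (snd z)
      = gibbs_density f (snd z) * gauss_kernel \<eta> (snd z) (fst z) / smoothed_density f \<eta> (fst z)" for z
    using gibbs_density_gauss_kernel(1)[OF f \<eta>, of "fst z"] gibbs_density_gauss_kernel(2)[OF f \<eta>, of "snd z" "fst z"]
    by (simp add: field_simps)
  then show ?thesis by simp
qed

text \<open>Fubini's theorem for a Markov kernel with a jointly measurable density.\<close>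

lemma bind_density_kernel:
  fixes a :: "'a::euclidean_space \<Rightarrow> ennreal" and k :: "'a \<Rightarrow> 'a \<Rightarrow> real"
  assumes [measurable]: "a \<in> borel_measurable borel"
    and k[measurable]: "(\<lambda>z. k (fst z) (snd z)) \<in> borel_measurable (borel \<Otimes>\<^sub>M borel)"
    and one: "\<And>x. (\<integral>\<^sup>+y. ennreal (k x y) \<partial>lborel) = 1"
  shows "density lborel a \<bind> (\<lambda>x. density lborel (\<lambda>y. ennreal (k x y)))
       = density lborel (\<lambda>y. \<integral>\<^sup>+x. a x * ennreal (k x y) \<partial>lborel)"
proof -
  have k2[measurable]: "(\<lambda>(x, y). k x y) \<in> borel_measurable (borel \<Otimes>\<^sub>M borel)"
    using k by (simp add: case_prod_unfold)
  have k1[measurable]: "k x \<in> borel_measurable borel" for x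
    using measurable_compose[OF measurable_Pair1' k, of x] by simp
  have [measurable]: "(\<lambda>x. density lborel (\<lambda>y. ennreal (k x y))) \<in> borel \<rightarrow>\<^sub>M subprob_algebra borel"
  proof (rule measurable_subprob_algebra)
    fix x :: 'a
    have "prob_space (density lborel (\<lambda>y. ennreal (k x y)))"
      by (rule prob_spaceI) (simp add: emeasure_density one)
    then show "subprob_space (density lborel (\<lambda>y. ennreal (k x y)))"
      by (rule prob_space_imp_subprob_space)
  next
    fix A :: "'a set" assume [measurable]: "A \<in> sets borel"
    have "(\<lambda>x. \<integral>\<^sup>+y. ennreal (k x y) * indicator A y \<partial>lborel) \<in> borel_measurable borel"
      by measurable
    then show "(\<lambda>x. emeasure (density lborel (\<lambda>y. ennreal (k x y))) A) \<in> borel_measurable borel"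
      by (simp add: emeasure_density)
  qed simp
  show ?thesis
  proof (rule measure_eqI)
    show "sets (density lborel a \<bind> (\<lambda>x. density lborel (\<lambda>y. ennreal (k x y))))
      = sets (density lborel (\<lambda>y. \<integral>\<^sup>+x. a x * ennreal (k x y) \<partial>lborel))"
      by (subst sets_bind[where N = borel]) auto
    fix A assume "A \<in> sets (density lborel a \<bind> (\<lambda>x. density lborel (\<lambda>y. ennreal (k x y))))"
    then have [measurable]: "A \<in> sets borel" by (subst (asm) sets_bind[where N = borel]) auto
    have "emeasure (density lborel a \<bind> (\<lambda>x. density lborel (\<lambda>y. ennreal (k x y)))) A
        = (\<integral>\<^sup>+x. emeasure (density lborel (\<lambda>y. ennreal (k x y))) A \<partial>density lborel a)"
      by (rule emeasure_bind[where N = borel]) auto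
    also have "\<dots> = (\<integral>\<^sup>+x. a x * (\<integral>\<^sup>+y. ennreal (k x y) * indicator A y \<partial>lborel) \<partial>lborel)"
      by (simp add: nn_integral_density emeasure_density)
    also have "\<dots> = (\<integral>\<^sup>+x. \<integral>\<^sup>+y. a x * ennreal (k x y) * indicator A y \<partial>lborel \<partial>lborel)"
      by (simp add: nn_integral_cmult[symmetric] mult.assoc)
    also have "\<dots> = (\<integral>\<^sup>+y. \<integral>\<^sup>+x. a x * ennreal (k x y) * indicator A y \<partial>lborel \<partial>lborel)"
      by (rule lborel_pair.Fubini') measurable
    also have "\<dots> = (\<integral>\<^sup>+y. (\<integral>\<^sup>+x. a x * ennreal (k x y) \<partial>lborel) * indicator A y \<partial>lborel)"
      by (simp add: nn_integral_multc)
    also have "\<dots> = emeasure (density lborel (\<lambda>y. \<integral>\<^sup>+x. a x * ennreal (k x y) \<partial>lborel)) A"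
      by (simp add: emeasure_density)
    finally show "emeasure (density lborel a \<bind> (\<lambda>x. density lborel (\<lambda>y. ennreal (k x y)))) A
        = emeasure (density lborel (\<lambda>y. \<integral>\<^sup>+x. a x * ennreal (k x y) \<partial>lborel)) A" .
  qed
qed

lemma Jensen_powr_prob:
  fixes h :: "'b \<Rightarrow> real"
  assumes "prob_space M" and [measurable]: "h \<in> borel_measurable M" and nn: "\<And>x. h x \<ge> 0" and q: "q > 1"
  shows "ennreal ((\<integral>x. h x \<partial>M) powr q) \<le> (\<integral>\<^sup>+x. ennreal (h x powr q) \<partial>M)"
proof (cases "(\<integral>\<^sup>+x. ennreal (h x powr q) \<partial>M) < \<infinity>")
  case True
  interpret prob_space M by fact
  have int: "integrable M (\<lambda>x. h x powr q)" by (rule integrableI_nonneg) (use True in auto)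
  have "(\<lambda>x. (h x powr q) powr (1 / q) * 1 powr (1 - 1 / q)) = h"
    using q nn by (auto simp: powr_powr fun_eq_iff)
  then have le: "(\<integral>x. h x \<partial>M) \<le> (\<integral>x. h x powr q \<partial>M) powr (1 / q)"
    using Holder_interpolation(2)[OF int, of "\<lambda>_. 1" "1 / q"] q by (simp add: prob_space)
  have "(\<integral>x. h x \<partial>M) powr q \<le> ((\<integral>x. h x powr q \<partial>M) powr (1 / q)) powr q"
    using q by (intro powr_mono2 le Bochner_Integration.integral_nonneg nn) auto
  also have "\<dots> = (\<integral>x. h x powr q \<partial>M)"
    using q Bochner_Integration.integral_nonneg[of M "\<lambda>x. h x powr q"] by (simp add: powr_powr)
  finally show ?thesis using int by (simp add: nn_integral_eq_integral ennreal_leI)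
qed (simp add: not_less top_unique)

text \<open>
  The conditional expectation of \<open>h (X)\<close> given that the second coordinate is
  \<open>y\<close>. It takes the default value 0 where \<open>h\<close> is not integrable;
  when \<open>h\<close> is a probability density relative to the target, this happens only on
  a null set.
\<close>

definition posterior_mean :: "('a::euclidean_space \<Rightarrow> real) \<Rightarrow> real \<Rightarrow> ('a \<Rightarrow> real) \<Rightarrow> 'a \<Rightarrow> real" where
  "posterior_mean f \<eta> h y = (\<integral>x. h x \<partial>prox_backward f \<eta> y)"

lemma nn_integral_Bayes:
  fixes f :: "'a::euclidean_space \<Rightarrow> real" and v :: "'a \<Rightarrow> ennreal"
  assumes f: "integrable lborel (\<lambda>x. exp (- f x))" and \<eta>: "\<eta> > 0"
    and [measurable]: "v \<in> borel_measurable borel"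
  shows "(\<integral>\<^sup>+x. ennreal (gibbs_density f x) * (ennreal (gauss_kernel \<eta> x y) * v x) \<partial>lborel)
       = ennreal (smoothed_density f \<eta> y) * (\<integral>\<^sup>+x. v x \<partial>prox_backward f \<eta> y)"
proof -
  note [measurable] = gibbs_density_measurable[OF integrable_posterior[OF f \<eta>]]
  have eq: "ennreal (gibbs_density f x) * (ennreal (gauss_kernel \<eta> x y) * v x)
      = ennreal (smoothed_density f \<eta> y) * (ennreal (gibbs_density (posterior_potential f \<eta> y) x) * v x)" for x
    unfolding mult.assoc[symmetric] using Bayes_ennreal[OF f \<eta>] by simp
  show ?thesis
    unfolding eq prox_backward_eq
    by (simp add: nn_integral_cmult nn_integral_gibbs[OF integrable_posterior[OF f \<eta>]])
qed

text \<open>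
  The expectation of \<open>v X Y\<close> under the joint law, disintegrated in either order.
\<close>

lemma nn_integral_smoothed:
  fixes f :: "'a::euclidean_space \<Rightarrow> real" and v :: "'a \<Rightarrow> 'a \<Rightarrow> ennreal"
  assumes f: "integrable lborel (\<lambda>x. exp (- f x))" and \<eta>: "\<eta> > 0"
    and [measurable]: "(\<lambda>(x, y). v x y) \<in> borel_measurable (borel \<Otimes>\<^sub>M borel)"
  shows "(\<integral>\<^sup>+x. \<integral>\<^sup>+y. v x y \<partial>isotropic_gaussian \<eta> x \<partial>gibbs f)
       = (\<integral>\<^sup>+y. ennreal (smoothed_density f \<eta> y) * (\<integral>\<^sup>+x. v x y \<partial>prox_backward f \<eta> y) \<partial>lborel)"
proof -
  note [measurable] = gibbs_density_measurable[OF f]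
  have [measurable]: "v x \<in> borel_measurable borel" for x
    using measurable_compose[OF measurable_Pair1' assms(3), of x] by simp
  have [measurable]: "(\<lambda>x. v x y) \<in> borel_measurable borel" for y
    using measurable_compose[OF measurable_Pair2' assms(3), of y] by simp
  have "(\<integral>\<^sup>+x. \<integral>\<^sup>+y. v x y \<partial>isotropic_gaussian \<eta> x \<partial>gibbs f)
      = (\<integral>\<^sup>+x. ennreal (gibbs_density f x) * (\<integral>\<^sup>+y. ennreal (gauss_kernel \<eta> x y) * v x y \<partial>lborel) \<partial>lborel)"
    by (simp add: nn_integral_isotropic_gaussian[OF \<eta>] nn_integral_gibbs[OF f])
  also have "\<dots> = (\<integral>\<^sup>+x. \<integral>\<^sup>+y. ennreal (gibbs_density f x) * (ennreal (gauss_kernel \<eta> x y) * v x y) \<partial>lborel \<partial>lborel)"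
    by (simp add: nn_integral_cmult)
  also have "\<dots> = (\<integral>\<^sup>+y. \<integral>\<^sup>+x. ennreal (gibbs_density f x) * (ennreal (gauss_kernel \<eta> x y) * v x y) \<partial>lborel \<partial>lborel)"
    by (rule lborel_pair.Fubini') measurable
  also have "\<dots> = (\<integral>\<^sup>+y. ennreal (smoothed_density f \<eta> y) * (\<integral>\<^sup>+x. v x y \<partial>prox_backward f \<eta> y) \<partial>lborel)"
    by (simp add: nn_integral_Bayes[OF f \<eta>])
  finally show ?thesis .
qed

section \<open>One iteration as a map on densities\<close>

lemma prox_forward_eq:
  "\<eta> > 0 \<Longrightarrow> prox_forward \<eta> = (\<lambda>x. density lborel (\<lambda>y. ennreal (gauss_kernel \<eta> x y)))"
  by (rule ext) (simp add: prox_forward_def isotropic_gaussian_eq)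

lemma sets_prox_backward [simp, measurable_cong]: "sets (prox_backward f \<eta> y) = sets borel"
  by (simp add: prox_backward_eq)

lemma posterior_mean_eq_enn2real:
  fixes f :: "'a::euclidean_space \<Rightarrow> real"
  assumes [measurable]: "h \<in> borel_measurable borel" and nn: "\<And>x. h x \<ge> 0"
  shows "posterior_mean f \<eta> h y = enn2real (\<integral>\<^sup>+x. ennreal (h x) \<partial>prox_backward f \<eta> y)"
  unfolding posterior_mean_def by (rule integral_eq_nn_integral) (use nn in auto)

lemma measurable_nn_integral_posterior:
  fixes f :: "'a::euclidean_space \<Rightarrow> real"
  assumes f: "integrable lborel (\<lambda>x. exp (- f x))" and \<eta>: "\<eta> > 0"
    and [measurable]: "v \<in> borel_measurable borel"
  shows "(\<lambda>y. \<integral>\<^sup>+x. v x \<partial>prox_backward f \<eta> y) \<in> borel_measurable borel"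
proof -
  note [measurable] = posterior_density_measurable[OF f \<eta>]
  show ?thesis
    unfolding prox_backward_eq nn_integral_gibbs[OF integrable_posterior[OF f \<eta>] assms(3)]
    by measurable
qed

text \<open>
  By Bayes' rule the forward step takes a density to its posterior mean, relative to the
  smoothed target. The factor \<open>smoothed_density\<close> then cancels against the
  normalisation of the backward kernel, which leaves a Gaussian average relative to the
  target.
\<close>

lemma prox_step_density:
  fixes f :: "'a::euclidean_space \<Rightarrow> real"
  assumes f: "integrable lborel (\<lambda>x. exp (- f x))" and \<eta>: "\<eta> > 0"
    and [measurable]: "h \<in> borel_measurable borel" and nn: "\<And>x. h x \<ge> 0"
    and one: "(\<integral>\<^sup>+x. ennreal (h x) \<partial>gibbs f) = 1"
  defines "g \<equiv> posterior_mean f \<eta> h"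
  shows "g \<in> borel_measurable borel"
    and "(\<integral>\<^sup>+x. \<integral>\<^sup>+y. ennreal (g y) \<partial>isotropic_gaussian \<eta> x \<partial>gibbs f) = 1"
    and "(density (gibbs f) (\<lambda>x. ennreal (h x)) \<bind> prox_forward \<eta>) \<bind> prox_backward f \<eta>
       = density (gibbs f) (\<lambda>x. ennreal (gauss_avg \<eta> g x))"
proof -
  let ?P = "posterior_potential f \<eta>"
  note [measurable] = gibbs_density_measurable[OF f] smoothed_density_measurable[OF f, of \<eta>]
    posterior_density_measurable[OF f \<eta>] measurable_nn_integral_posterior[OF f \<eta>]
    measurable_nn_integral_gaussian[OF \<eta>]
  have mpos: "smoothed_density f \<eta> y > 0" for y by (rule gibbs_density_gauss_kernel(1)[OF f \<eta>])
  have massN: "emeasure (isotropic_gaussian \<eta> x) UNIV = 1" for x :: 'a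
    using prob_space.emeasure_space_1[OF prob_space_isotropic_gaussian[OF \<eta>, of x]] by simp
  have massB: "emeasure (prox_backward f \<eta> y) UNIV = 1" for y
    using prob_space.emeasure_space_1[OF prob_space_gibbs[OF integrable_posterior[OF f \<eta>, of y]]]
    by (simp add: prox_backward_eq)
  have g_eq: "g = (\<lambda>y. enn2real (\<integral>\<^sup>+x. ennreal (h x) \<partial>prox_backward f \<eta> y))"
    unfolding g_def using posterior_mean_eq_enn2real[OF assms(3) nn] by auto
  show g[measurable]: "g \<in> borel_measurable borel" unfolding g_eq by measurable
  have g0: "g y \<ge> 0" for y by (simp add: g_eq)
  have "(\<integral>\<^sup>+x. \<integral>\<^sup>+y. ennreal (h x) \<partial>isotropic_gaussian \<eta> x \<partial>gibbs f)
     = (\<integral>\<^sup>+y. ennreal (smoothed_density f \<eta> y) * (\<integral>\<^sup>+x. ennreal (h x) \<partial>prox_backward f \<eta> y) \<partial>lborel)"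
    by (rule nn_integral_smoothed[OF f \<eta>]) measurable
  then have tot: "(\<integral>\<^sup>+y. ennreal (smoothed_density f \<eta> y) * (\<integral>\<^sup>+x. ennreal (h x) \<partial>prox_backward f \<eta> y) \<partial>lborel) = 1"
    using one by (simp add: massN)
  have "AE y in lborel. ennreal (smoothed_density f \<eta> y) * (\<integral>\<^sup>+x. ennreal (h x) \<partial>prox_backward f \<eta> y) \<noteq> \<infinity>"
    by (rule nn_integral_PInf_AE) (use tot in auto)
  then have g_ae: "AE y in lborel. ennreal (smoothed_density f \<eta> y) * (\<integral>\<^sup>+x. ennreal (h x) \<partial>prox_backward f \<eta> y)
      = ennreal (smoothed_density f \<eta> y) * ennreal (g y)"
  proof eventually_elim
    case (elim y)
    then have "(\<integral>\<^sup>+x. ennreal (h x) \<partial>prox_backward f \<eta> y) \<noteq> \<infinity>"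
      using mpos[of y] by (auto simp: ennreal_mult_eq_top_iff)
    then show ?case by (simp add: g_eq less_top)
  qed
  have "(\<integral>\<^sup>+x. \<integral>\<^sup>+y. ennreal (g y) \<partial>isotropic_gaussian \<eta> x \<partial>gibbs f)
     = (\<integral>\<^sup>+y. ennreal (smoothed_density f \<eta> y) * (\<integral>\<^sup>+x. ennreal (g y) \<partial>prox_backward f \<eta> y) \<partial>lborel)"
    by (rule nn_integral_smoothed[OF f \<eta>]) measurable
  also have "\<dots> = (\<integral>\<^sup>+y. ennreal (smoothed_density f \<eta> y) * ennreal (g y) \<partial>lborel)"
    by (simp add: massB prox_backward_eq[symmetric] space_gibbs[of "?P _", folded prox_backward_eq])
  also have "\<dots> = 1"
    unfolding tot[symmetric] by (rule nn_integral_cong_AE) (use g_ae in auto)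
  finally show gone: "(\<integral>\<^sup>+x. \<integral>\<^sup>+y. ennreal (g y) \<partial>isotropic_gaussian \<eta> x \<partial>gibbs f) = 1" .
  have dens: "density (gibbs f) v = density lborel (\<lambda>x. ennreal (gibbs_density f x) * v x)"
    if "v \<in> borel_measurable borel" for v
    unfolding gibbs_eq using that by (subst density_density_eq) auto
  have "density (gibbs f) (\<lambda>x. ennreal (h x)) \<bind> prox_forward \<eta>
     = density lborel (\<lambda>y. \<integral>\<^sup>+x. ennreal (gibbs_density f x) * ennreal (h x) * ennreal (gauss_kernel \<eta> x y) \<partial>lborel)"
    unfolding prox_forward_eq[OF \<eta>]
    by (subst dens) (auto intro!: bind_density_kernel simp: nn_integral_gauss_kernel[OF \<eta>])
  also have "\<dots> = density lborel (\<lambda>y. ennreal (smoothed_density f \<eta> y) * (\<integral>\<^sup>+x. ennreal (h x) \<partial>prox_backward f \<eta> y))"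
    by (subst nn_integral_Bayes[OF f \<eta>, symmetric]) (auto simp: mult_ac)
  also have "\<dots> = density lborel (\<lambda>y. ennreal (smoothed_density f \<eta> y) * ennreal (g y))"
    by (rule density_cong[OF _ _ g_ae]) measurable
  finally have Y: "density (gibbs f) (\<lambda>x. ennreal (h x)) \<bind> prox_forward \<eta>
     = density lborel (\<lambda>y. ennreal (smoothed_density f \<eta> y) * ennreal (g y))" .
  have "(density (gibbs f) (\<lambda>x. ennreal (h x)) \<bind> prox_forward \<eta>) \<bind> prox_backward f \<eta>
     = density lborel (\<lambda>y. ennreal (smoothed_density f \<eta> y) * ennreal (g y))
        \<bind> (\<lambda>y. density lborel (\<lambda>x. ennreal (gibbs_density (?P y) x)))"
    unfolding Y by (simp add: prox_backward_eq[abs_def] gibbs_eq)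
  also have "\<dots> = density lborel (\<lambda>x. \<integral>\<^sup>+y. ennreal (smoothed_density f \<eta> y) * ennreal (g y) * ennreal (gibbs_density (?P y) x) \<partial>lborel)"
    by (rule bind_density_kernel) (auto simp: nn_integral_gibbs_density[OF integrable_posterior[OF f \<eta>]])
  also have "\<dots> = density lborel (\<lambda>x. ennreal (gibbs_density f x) * (\<integral>\<^sup>+y. ennreal (g y) \<partial>isotropic_gaussian \<eta> x))"
  proof (rule arg_cong[where f = "density lborel"], rule ext)
    fix x :: 'a
    have eq: "ennreal (smoothed_density f \<eta> y) * ennreal (g y) * ennreal (gibbs_density (?P y) x)
        = ennreal (gibbs_density f x) * (ennreal (gauss_kernel \<eta> x y) * ennreal (g y))" for y
      using Bayes_ennreal[OF f \<eta>, of x y] by (simp add: mult_ac)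
    show "(\<integral>\<^sup>+y. ennreal (smoothed_density f \<eta> y) * ennreal (g y) * ennreal (gibbs_density (?P y) x) \<partial>lborel)
        = ennreal (gibbs_density f x) * (\<integral>\<^sup>+y. ennreal (g y) \<partial>isotropic_gaussian \<eta> x)"
      unfolding eq by (simp add: nn_integral_cmult nn_integral_isotropic_gaussian[OF \<eta>])
  qed
  also have "\<dots> = density (gibbs f) (\<lambda>x. \<integral>\<^sup>+y. ennreal (g y) \<partial>isotropic_gaussian \<eta> x)"
    by (rule dens[symmetric]) measurable
  also have "\<dots> = density (gibbs f) (\<lambda>x. ennreal (gauss_avg \<eta> g x))"
  proof (rule density_cong)
    have [measurable]: "gauss_avg \<eta> g \<in> borel_measurable borel"
      by (rule gauss_avg_measurable_nonneg[OF \<eta> g g0])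
    show "(\<lambda>x. ennreal (gauss_avg \<eta> g x)) \<in> borel_measurable (gibbs f)" by measurable
    have "AE x in gibbs f. (\<integral>\<^sup>+y. ennreal (g y) \<partial>isotropic_gaussian \<eta> x) \<noteq> \<infinity>"
      by (rule nn_integral_PInf_AE) (use gone in auto)
    then show "AE x in gibbs f. (\<integral>\<^sup>+y. ennreal (g y) \<partial>isotropic_gaussian \<eta> x) = ennreal (gauss_avg \<eta> g x)"
      by eventually_elim (simp add: gauss_avg_eq_enn2real[OF g g0] less_top)
  qed measurable
  finally show "(density (gibbs f) (\<lambda>x. ennreal (h x)) \<bind> prox_forward \<eta>) \<bind> prox_backward f \<eta>
       = density (gibbs f) (\<lambda>x. ennreal (gauss_avg \<eta> g x))" .
qed

text \<open>
  The data processing inequality for the forward step: conditional Jensen, integrated over the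
  second marginal.
\<close>

lemma posterior_mean_powr_integral_le:
  fixes f :: "'a::euclidean_space \<Rightarrow> real"
  assumes f: "integrable lborel (\<lambda>x. exp (- f x))" and \<eta>: "\<eta> > 0"
    and h[measurable]: "h \<in> borel_measurable borel" and nn: "\<And>x. h x \<ge> 0" and q: "q > 1"
    and g[measurable]: "posterior_mean f \<eta> h \<in> borel_measurable borel"
  shows "(\<integral>\<^sup>+x. \<integral>\<^sup>+y. ennreal (posterior_mean f \<eta> h y powr q) \<partial>isotropic_gaussian \<eta> x \<partial>gibbs f)
       \<le> (\<integral>\<^sup>+x. ennreal (h x powr q) \<partial>gibbs f)"
proof -
  have prob: "prob_space (prox_backward f \<eta> y)" for y
    unfolding prox_backward_eq by (rule prob_space_gibbs[OF integrable_posterior[OF f \<eta>]])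
  have massB: "emeasure (prox_backward f \<eta> y) (space (prox_backward f \<eta> y)) = 1" for y
    using prob_space.emeasure_space_1[OF prob] .
  have massN: "emeasure (isotropic_gaussian \<eta> x) (space (isotropic_gaussian \<eta> x)) = 1" for x :: 'a
    using prob_space.emeasure_space_1[OF prob_space_isotropic_gaussian[OF \<eta>]] .
  have "(\<integral>\<^sup>+x. \<integral>\<^sup>+y. ennreal (posterior_mean f \<eta> h y powr q) \<partial>isotropic_gaussian \<eta> x \<partial>gibbs f)
     = (\<integral>\<^sup>+y. ennreal (smoothed_density f \<eta> y) * (\<integral>\<^sup>+x. ennreal (posterior_mean f \<eta> h y powr q) \<partial>prox_backward f \<eta> y) \<partial>lborel)"
    by (rule nn_integral_smoothed[OF f \<eta>]) measurable
  also have "\<dots> \<le> (\<integral>\<^sup>+y. ennreal (smoothed_density f \<eta> y) * (\<integral>\<^sup>+x. ennreal (h x powr q) \<partial>prox_backward f \<eta> y) \<partial>lborel)"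
  proof (rule nn_integral_mono, rule mult_left_mono)
    fix y :: 'a
    show "(\<integral>\<^sup>+x. ennreal (posterior_mean f \<eta> h y powr q) \<partial>prox_backward f \<eta> y)
       \<le> (\<integral>\<^sup>+x. ennreal (h x powr q) \<partial>prox_backward f \<eta> y)"
      using Jensen_powr_prob[where h = h, OF prob _ nn q, of y] by (simp add: posterior_mean_def massB)
  qed simp
  also have "\<dots> = (\<integral>\<^sup>+x. \<integral>\<^sup>+y. ennreal (h x powr q) \<partial>isotropic_gaussian \<eta> x \<partial>gibbs f)"
    by (rule nn_integral_smoothed[OF f \<eta>, symmetric]) measurable
  also have "\<dots> = (\<integral>\<^sup>+x. ennreal (h x powr q) \<partial>gibbs f)" using massN by simp
  finally show ?thesis .
qed

lemma renyi_integral_density: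
  fixes f :: "'a::euclidean_space \<Rightarrow> real"
  assumes f: "integrable lborel (\<lambda>x. exp (- f x))"
    and h[measurable]: "h \<in> borel_measurable borel" and nn: "\<And>x. h x \<ge> 0"
  shows "renyi_integral q (gibbs f) (density (gibbs f) (\<lambda>x. ennreal (h x)))
       = (\<integral>\<^sup>+x. ennreal (h x powr q) \<partial>gibbs f)"
proof -
  note [measurable] = gibbs_density_measurable[OF f]
  note pos = gibbs_density_pos[OF f]
  have ae1: "AE x in lborel. ennreal (gibbs_density f x) = RN_deriv lborel (gibbs f) x"
    by (rule sigma_finite_measure.RN_deriv_unique[OF sigma_finite_lborel]) (auto simp: gibbs_eq)
  have "density (gibbs f) (\<lambda>x. ennreal (h x)) = density lborel (\<lambda>x. ennreal (gibbs_density f x * h x))"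
    unfolding gibbs_eq by (subst density_density_eq) (auto simp: ennreal_mult' less_imp_le[OF pos])
  then have ae2: "AE x in lborel. ennreal (gibbs_density f x * h x)
       = RN_deriv lborel (density (gibbs f) (\<lambda>x. ennreal (h x))) x"
    by (intro sigma_finite_measure.RN_deriv_unique[OF sigma_finite_lborel]) auto
  have "renyi_integral q (gibbs f) (density (gibbs f) (\<lambda>x. ennreal (h x)))
      = (\<integral>\<^sup>+x. ennreal (gibbs_density f x) * ennreal (h x powr q) \<partial>lborel)"
    unfolding renyi_integral_def lebesgue_density_def
  proof (rule nn_integral_cong_AE)
    show "AE x in lborel. ennreal (enn2real (RN_deriv lborel (density (gibbs f) (\<lambda>x. ennreal (h x))) x) powr q
             / enn2real (RN_deriv lborel (gibbs f) x) powr (q - 1))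
         = ennreal (gibbs_density f x) * ennreal (h x powr q)"
      using ae1 ae2
    proof eventually_elim
      case (elim x)
      have "(gibbs_density f x * h x) powr q / gibbs_density f x powr (q - 1) = gibbs_density f x * h x powr q"
        using pos[of x] nn[of x] by (simp add: powr_mult powr_diff)
      then show ?case
        using pos[of x] nn[of x] by (simp add: elim[symmetric] ennreal_mult'[symmetric] less_imp_le)
    qed
  qed
  also have "\<dots> = (\<integral>\<^sup>+x. ennreal (h x powr q) \<partial>gibbs f)"
    by (rule nn_integral_gibbs[OF f, symmetric]) measurable
  finally show ?thesis .
qed

lemma renyi_density:
  fixes f :: "'a::euclidean_space \<Rightarrow> real"
  assumes f: "integrable lborel (\<lambda>x. exp (- f x))"
    and h[measurable]: "h \<in> borel_measurable borel" and nn: "\<And>x. h x \<ge> 0"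
    and fin: "(\<integral>\<^sup>+x. ennreal (h x powr q) \<partial>gibbs f) < \<infinity>"
  shows "renyi q (gibbs f) (density (gibbs f) (\<lambda>x. ennreal (h x)))
       = ereal (ln (enn2real (\<integral>\<^sup>+x. ennreal (h x powr q) \<partial>gibbs f)) / (q - 1))"
proof -
  have "absolutely_continuous (gibbs f) (density (gibbs f) (\<lambda>x. ennreal (h x)))"
    by (rule absolutely_continuousI_density) measurable
  then show ?thesis using fin by (simp add: renyi_def renyi_integral_density[OF f h nn])
qed

lemma density_of_finite_renyi:
  fixes f :: "'a::euclidean_space \<Rightarrow> real"
  assumes f: "integrable lborel (\<lambda>x. exp (- f x))" and "prob_space \<rho>" and sets: "sets \<rho> = sets borel"
    and fin: "renyi q (gibbs f) \<rho> \<noteq> \<infinity>"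
  obtains h :: "'a \<Rightarrow> real" where "h \<in> borel_measurable borel" "\<And>x. h x \<ge> 0"
    "\<rho> = density (gibbs f) (\<lambda>x. ennreal (h x))" "(\<integral>\<^sup>+x. ennreal (h x) \<partial>gibbs f) = 1"
    "(\<integral>\<^sup>+x. ennreal (h x powr q) \<partial>gibbs f) < \<infinity>"
proof -
  interpret pi: prob_space "gibbs f" by (rule prob_space_gibbs[OF f])
  interpret rho: prob_space \<rho> by fact
  have ac: "absolutely_continuous (gibbs f) \<rho>" and ri: "renyi_integral q (gibbs f) \<rho> < \<infinity>"
    using fin by (auto simp: renyi_def split: if_splits)
  have s: "sets \<rho> = sets (gibbs f)" using sets by simp
  define h where "h x = enn2real (RN_deriv (gibbs f) \<rho> x)" for x
  have "(\<lambda>x. h x) \<in> borel_measurable (gibbs f)" unfolding h_def by measurable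
  then have h: "h \<in> borel_measurable borel" by (simp add: measurable_cong_sets[OF sets_gibbs refl])
  have h0: "h x \<ge> 0" for x by (simp add: h_def)
  have ae: "AE x in gibbs f. RN_deriv (gibbs f) \<rho> x = ennreal (h x)"
    using pi.RN_deriv_finite[OF rho.sigma_finite_measure_axioms ac s]
    by eventually_elim (simp add: h_def less_top)
  have "\<rho> = density (gibbs f) (RN_deriv (gibbs f) \<rho>)"
    by (rule pi.density_RN_deriv[OF ac s, symmetric])
  also have "\<dots> = density (gibbs f) (\<lambda>x. ennreal (h x))"
    by (rule density_cong[OF _ _ ae]) (use h in auto)
  finally have rho_eq: "\<rho> = density (gibbs f) (\<lambda>x. ennreal (h x))" .
  have "(\<integral>\<^sup>+x. ennreal (h x) \<partial>gibbs f) = emeasure \<rho> (space \<rho>)"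
    using h by (subst (1 2) rho_eq) (simp add: emeasure_density)
  then have one: "(\<integral>\<^sup>+x. ennreal (h x) \<partial>gibbs f) = 1" by (simp add: rho.emeasure_space_1)
  have "(\<integral>\<^sup>+x. ennreal (h x powr q) \<partial>gibbs f) < \<infinity>"
    using ri renyi_integral_density[OF f h h0, of q] rho_eq by simp
  then show ?thesis using that h h0 rho_eq one by blast
qed

section \<open>Decay along the iterates\<close>

text \<open>
  The divergence of the measure with density \<open>h\<close> relative to
  \<open>\<pi>\<close>; see \<open>renyi_density\<close>.
\<close>

definition renyi_of_density :: "real \<Rightarrow> 'a measure \<Rightarrow> ('a \<Rightarrow> real) \<Rightarrow> real" where
  "renyi_of_density q \<pi> h = ln (enn2real (\<integral>\<^sup>+x. ennreal (h x powr q) \<partial>\<pi>)) / (q - 1)"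

definition finite_renyi_density :: "real \<Rightarrow> 'a::euclidean_space measure \<Rightarrow> ('a \<Rightarrow> real) \<Rightarrow> bool" where
  "finite_renyi_density q \<pi> h \<longleftrightarrow> h \<in> borel_measurable borel \<and> (\<forall>x. h x \<ge> 0)
     \<and> (\<integral>\<^sup>+x. ennreal (h x) \<partial>\<pi>) = 1 \<and> (\<integral>\<^sup>+x. ennreal (h x powr q) \<partial>\<pi>) < \<infinity>"

lemma one_le_renyi_integral:
  fixes f :: "'a::euclidean_space \<Rightarrow> real"
  assumes f: "integrable lborel (\<lambda>x. exp (- f x))" and q: "q > 1"
    and h: "finite_renyi_density q (gibbs f) h"
  shows "1 \<le> enn2real (\<integral>\<^sup>+x. ennreal (h x powr q) \<partial>gibbs f)"
proof -
  have [measurable]: "h \<in> borel_measurable borel" and nn: "\<And>x. h x \<ge> 0"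
    and one: "(\<integral>\<^sup>+x. ennreal (h x) \<partial>gibbs f) = 1" and fin: "(\<integral>\<^sup>+x. ennreal (h x powr q) \<partial>gibbs f) < \<infinity>"
    using h by (auto simp: finite_renyi_density_def)
  have "(\<integral>x. h x \<partial>gibbs f) = 1"
    by (subst integral_eq_nn_integral) (use nn one in auto)
  then have "1 \<le> (\<integral>\<^sup>+x. ennreal (h x powr q) \<partial>gibbs f)"
    using Jensen_powr_prob[OF prob_space_gibbs[OF f], of h q] nn q by simp
  then have "enn2real 1 \<le> enn2real (\<integral>\<^sup>+x. ennreal (h x powr q) \<partial>gibbs f)"
    using fin by (intro enn2real_mono) auto
  then show ?thesis by simp
qed

lemma renyi_of_density_nonneg:
  fixes f :: "'a::euclidean_space \<Rightarrow> real"
  assumes f: "integrable lborel (\<lambda>x. exp (- f x))" and q: "q > 1"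
    and h: "finite_renyi_density q (gibbs f) h"
  shows "0 \<le> renyi_of_density q (gibbs f) h"
  unfolding renyi_of_density_def using one_le_renyi_integral[OF assms] q by simp

lemma decay_clock_mono:
  assumes "0 < s" "s \<le> 1" "0 < R'" "R' \<le> R"
  shows "decay_clock s R' \<le> decay_clock s R"
proof -
  have "0 \<le> (R - R') / decay_rate s R" using assms decay_rate_pos[of R s] by simp
  then show ?thesis using decay_clock_drop_linear[OF assms] by linarith
qed

text \<open>
  The forward step does not increase the divergence, and the backward step satisfies the
  hypothesis of \<open>decay_clock_step\<close>. The clock is meaningful only for a positive
  divergence, hence the premise of the last conclusion.
\<close>

lemma prox_step_decay:
  fixes f :: "'a::euclidean_space \<Rightarrow> real"
  assumes r: "1 \<le> r" "r < 2" and \<alpha>: "\<alpha> > 0" and f: "integrable lborel (\<lambda>x. exp (- f x))"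
    and loi: "latala_oleszkiewicz (gibbs f) r \<alpha>" and \<eta>: "\<eta> > 0" and q: "q \<ge> 2"
    and h: "finite_renyi_density q (gibbs f) h"
  obtains h' where "finite_renyi_density q (gibbs f) h'"
    "(density (gibbs f) (\<lambda>x. ennreal (h x)) \<bind> prox_forward \<eta>) \<bind> prox_backward f \<eta>
      = density (gibbs f) (\<lambda>x. ennreal (h' x))"
    "renyi_of_density q (gibbs f) h' \<le> renyi_of_density q (gibbs f) h"
    "renyi_of_density q (gibbs f) h' > 0 \<Longrightarrow>
       decay_clock (2 / r - 1) (renyi_of_density q (gibbs f) h')
         \<le> decay_clock (2 / r - 1) (renyi_of_density q (gibbs f) h) - ln (1 + \<alpha> * \<eta>) / (68 * q)"
proof -
  let ?\<pi> = "gibbs f"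
  have hm: "h \<in> borel_measurable borel" and nn: "\<And>x. h x \<ge> 0"
    and one: "(\<integral>\<^sup>+x. ennreal (h x) \<partial>?\<pi>) = 1" and fin: "(\<integral>\<^sup>+x. ennreal (h x powr q) \<partial>?\<pi>) < \<infinity>"
    using h by (auto simp: finite_renyi_density_def)
  have q1: "q > 1" using q by simp
  define g where "g = posterior_mean f \<eta> h"
  note step = prox_step_density[OF f \<eta> hm nn one, folded g_def]
  have g0: "g y \<ge> 0" for y unfolding g_def posterior_mean_def
    by (rule Bochner_Integration.integral_nonneg) (rule nn)
  define h' where "h' = gauss_avg \<eta> g"
  have h'm[measurable]: "h' \<in> borel_measurable borel"
    unfolding h'_def by (rule gauss_avg_measurable_nonneg[OF \<eta> step(1) g0])
  have h'0: "h' x \<ge> 0" for x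
    unfolding h'_def gauss_avg_def by (rule Bochner_Integration.integral_nonneg) (rule g0)
  have h'one: "(\<integral>\<^sup>+x. ennreal (h' x) \<partial>?\<pi>) = 1"
    unfolding step(2)[symmetric]
  proof (rule nn_integral_cong_AE)
    note [measurable] = measurable_nn_integral_gaussian[OF \<eta>] step(1)
    have "AE x in ?\<pi>. (\<integral>\<^sup>+y. ennreal (g y) \<partial>isotropic_gaussian \<eta> x) \<noteq> \<infinity>"
      by (rule nn_integral_PInf_AE) (use step(2) in auto)
    then show "AE x in ?\<pi>. ennreal (h' x) = (\<integral>\<^sup>+y. ennreal (g y) \<partial>isotropic_gaussian \<eta> x)"
      by eventually_elim (simp add: h'_def gauss_avg_eq_enn2real[OF step(1) g0] less_top)
  qed
  define G where "G = enn2real (\<integral>\<^sup>+x. \<integral>\<^sup>+y. ennreal (g y powr q) \<partial>isotropic_gaussian \<eta> x \<partial>?\<pi>)"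
  define F where "F = enn2real (\<integral>\<^sup>+x. ennreal (h' x powr q) \<partial>?\<pi>)"
  define H where "H = enn2real (\<integral>\<^sup>+x. ennreal (h x powr q) \<partial>?\<pi>)"
  have le: "(\<integral>\<^sup>+x. \<integral>\<^sup>+y. ennreal (g y powr q) \<partial>isotropic_gaussian \<eta> x \<partial>?\<pi>)
      \<le> (\<integral>\<^sup>+x. ennreal (h x powr q) \<partial>?\<pi>)"
    using posterior_mean_powr_integral_le[OF f \<eta> hm nn q1] step(1) by (simp add: g_def)
  have GH: "G \<le> H" unfolding G_def H_def using le fin by (intro enn2real_mono) auto
  note diss = dissipation[OF prob_space_gibbs[OF f] sets_gibbs loi \<alpha> \<eta> step(1) g0 step(2)
      order_le_less_trans[OF le fin] q, folded h'_def, folded G_def F_def]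
  have h': "finite_renyi_density q ?\<pi> h'"
    using h'0 h'one diss(1) by (simp add: finite_renyi_density_def)
  have F1: "1 \<le> F" unfolding F_def by (rule one_le_renyi_integral[OF f q1 h'])
  have G1: "1 \<le> G" using F1 diss(3) by linarith
  define R where "R = ln G / (q - 1)"
  define R' where "R' = ln F / (q - 1)"
  have R': "renyi_of_density q ?\<pi> h' = R'" by (simp add: renyi_of_density_def R'_def F_def)
  have RH: "R \<le> renyi_of_density q ?\<pi> h"
    unfolding renyi_of_density_def R_def H_def[symmetric]
    using GH G1 q1 by (intro divide_right_mono) auto
  have R'R: "R' \<le> R"
    unfolding R_def R'_def using diss(3) F1 q1 by (intro divide_right_mono) auto
  have s: "0 < 2 / r - 1" "2 / r - 1 \<le> 1" using r by (auto simp: field_simps)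
  have decay: "decay_clock (2 / r - 1) R' \<le> decay_clock (2 / r - 1) (renyi_of_density q ?\<pi> h) - ln (1 + \<alpha> * \<eta>) / (68 * q)"
    if pos: "R' > 0"
  proof -
    have diff: "(q - 1) * (R - R') = ln G - ln F"
      using q1 by (simp add: R_def R'_def diff_divide_distrib[symmetric])
    have "2 * (\<kappa> - 1) / \<kappa>\<^sup>2 * (\<alpha> * \<eta>) * t powr (- (1 - (2 / r - 1)))
        * (1 - exp (- (t / (2 - t)) * (R - (q - 1) * (R - R') / (\<kappa> - 1)))) \<le> (q - 1) * (R - R')"
      if "2 \<le> \<kappa>" "\<kappa> \<le> q" "0 < t" "t < 1" for \<kappa> t
    proof -
      have e: "1 - (2 / r - 1) = 2 * (1 - 1 / r)" by simp
      show ?thesis unfolding diff e unfolding R_def by (rule diss(4)[OF that])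
    qed
    from decay_clock_step[OF s _ q pos R'R this]
    have "decay_clock (2 / r - 1) R' \<le> decay_clock (2 / r - 1) R - ln (1 + \<alpha> * \<eta>) / (68 * q)"
      using \<alpha> \<eta> by simp
    moreover have "decay_clock (2 / r - 1) R \<le> decay_clock (2 / r - 1) (renyi_of_density q ?\<pi> h)"
      using pos R'R RH by (intro decay_clock_mono s) auto
    ultimately show ?thesis by linarith
  qed
  show ?thesis
  proof (rule that[OF h'])
    show "(density ?\<pi> (\<lambda>x. ennreal (h x)) \<bind> prox_forward \<eta>) \<bind> prox_backward f \<eta>
        = density ?\<pi> (\<lambda>x. ennreal (h' x))"
      using step(3) by (simp add: h'_def)
    show "renyi_of_density q ?\<pi> h' \<le> renyi_of_density q ?\<pi> h" using R'R RH by (simp add: R')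
    show "decay_clock (2 / r - 1) (renyi_of_density q ?\<pi> h')
        \<le> decay_clock (2 / r - 1) (renyi_of_density q ?\<pi> h) - ln (1 + \<alpha> * \<eta>) / (68 * q)"
      if "renyi_of_density q ?\<pi> h' > 0"
      using decay that unfolding R' by blast
  qed
qed

text \<open>
  Since the divergence never increases, it stays at zero once it has vanished. This is why the
  clock inequality is only claimed while it is positive.
\<close>

lemma prox_law_decay:
  fixes f :: "'a::euclidean_space \<Rightarrow> real"
  assumes r: "1 \<le> r" "r < 2" and \<alpha>: "\<alpha> > 0" and f: "integrable lborel (\<lambda>x. exp (- f x))"
    and loi: "latala_oleszkiewicz (gibbs f) r \<alpha>" and \<eta>: "\<eta> > 0" and q: "q \<ge> 2"
    and h: "finite_renyi_density q (gibbs f) h"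
  shows "\<exists>h'. finite_renyi_density q (gibbs f) h'
    \<and> prox_law f \<eta> (density (gibbs f) (\<lambda>x. ennreal (h x))) k = density (gibbs f) (\<lambda>x. ennreal (h' x))
    \<and> (renyi_of_density q (gibbs f) h' > 0 \<longrightarrow> renyi_of_density q (gibbs f) h > 0 \<and>
         decay_clock (2 / r - 1) (renyi_of_density q (gibbs f) h')
           \<le> decay_clock (2 / r - 1) (renyi_of_density q (gibbs f) h) - real k * ln (1 + \<alpha> * \<eta>) / (68 * q))"
proof (induction k)
  case 0
  show ?case by (rule exI[of _ h]) (simp add: h)
next
  case (Suc k)
  then obtain h1 where h1: "finite_renyi_density q (gibbs f) h1"
    "prox_law f \<eta> (density (gibbs f) (\<lambda>x. ennreal (h x))) k = density (gibbs f) (\<lambda>x. ennreal (h1 x))"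
    "renyi_of_density q (gibbs f) h1 > 0 \<Longrightarrow> renyi_of_density q (gibbs f) h > 0"
    "renyi_of_density q (gibbs f) h1 > 0 \<Longrightarrow> decay_clock (2 / r - 1) (renyi_of_density q (gibbs f) h1)
       \<le> decay_clock (2 / r - 1) (renyi_of_density q (gibbs f) h) - real k * ln (1 + \<alpha> * \<eta>) / (68 * q)"
    by blast
  obtain h2 where h2: "finite_renyi_density q (gibbs f) h2"
    "(density (gibbs f) (\<lambda>x. ennreal (h1 x)) \<bind> prox_forward \<eta>) \<bind> prox_backward f \<eta>
      = density (gibbs f) (\<lambda>x. ennreal (h2 x))"
    "renyi_of_density q (gibbs f) h2 \<le> renyi_of_density q (gibbs f) h1"
    "renyi_of_density q (gibbs f) h2 > 0 \<Longrightarrow>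
       decay_clock (2 / r - 1) (renyi_of_density q (gibbs f) h2)
         \<le> decay_clock (2 / r - 1) (renyi_of_density q (gibbs f) h1) - ln (1 + \<alpha> * \<eta>) / (68 * q)"
    using prox_step_decay[OF r \<alpha> f loi \<eta> q h1(1)] by metis
  have "real (Suc k) * ln (1 + \<alpha> * \<eta>) / (68 * q)
      = real k * ln (1 + \<alpha> * \<eta>) / (68 * q) + ln (1 + \<alpha> * \<eta>) / (68 * q)"
    by (simp add: add_divide_distrib ring_distribs)
  then show ?case using h1 h2 by (intro exI[of _ h2]) force
qed

lemma le_of_decay_clock_le:
  assumes s: "s > 0" and y: "y \<ge> 0" and R: "R > 0" and le: "decay_clock s R \<le> y"
  shows "R \<le> (1 + s * y) powr (1 / s)"
proof -
  have "R powr s \<le> 1 + s * y"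
  proof (cases "R \<le> 1")
    case True
    then have "R powr s \<le> 1" using R s by (intro powr_le1) auto
    then show ?thesis using s y by (smt (verit) mult_nonneg_nonneg)
  next
    case False
    then show ?thesis using le s by (simp add: decay_clock_def field_simps)
  qed
  then have "(R powr s) powr (1 / s) \<le> (1 + s * y) powr (1 / s)" using s by (intro powr_mono2) auto
  then show ?thesis using s R by (simp add: powr_powr)
qed

theorem theorem5:
  fixes f :: "'a::euclidean_space \<Rightarrow> real"
    and r \<alpha> \<eta> q :: real
    and \<rho>0 :: "'a measure"
    and k :: nat
  assumes "1 \<le> r" and "r < 2" and "\<alpha> > 0"
    and "integrable lborel (\<lambda>x. exp (- f x))"
    and "integrable (gibbs f) (\<lambda>x. (norm x)\<^sup>2)"
    and "latala_oleszkiewicz (gibbs f) r \<alpha>"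
    and "\<eta> > 0" and "q \<ge> 2"
    and "prob_space \<rho>0" and "sets \<rho>0 = sets borel"
  shows "let R0 = renyi q (gibbs f) \<rho>0;
             Rk = renyi q (gibbs f) (prox_law f \<eta> \<rho>0 k);
             c0 = ereal (68 * q / ((2 / r - 1) * ln (1 + \<alpha> * \<eta>)))
                    * (epowr R0 (2 / r - 1) - 1)
         in (ereal (real k) \<le> c0 \<longrightarrow>
               Rk \<le> epowr (epowr R0 (2 / r - 1)
                            - ereal ((2 / r - 1) * real k * ln (1 + \<alpha> * \<eta>) / (68 * q)))
                          (r / (2 - r)))
          \<and> (c0 < \<infinity> \<and> int k \<ge> \<lceil>real_of_ereal c0\<rceil> \<longrightarrow>
               Rk \<le> ereal (1 / (1 + \<alpha> * \<eta>) powr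
                              (real_of_int (int k - \<lceil>real_of_ereal c0\<rceil>) / (68 * q))))"
proof -
  note r = assms(1,2) and \<alpha> = assms(3) and f = assms(4) and loi = assms(6) and \<eta> = assms(7) and q = assms(8)
  define s where "s = 2 / r - 1"
  define L where "L = ln (1 + \<alpha> * \<eta>)"
  have s: "s > 0" using r by (simp add: s_def field_simps)
  have inv_s: "r / (2 - r) = 1 / s" using r by (simp add: s_def field_simps)
  have \<alpha>\<eta>: "\<alpha> * \<eta> > 0" using \<alpha> \<eta> by simp
  have L: "L > 0" using \<alpha>\<eta> by (simp add: L_def)
  have q1: "q > 1" using q by simp
  define R0 where "R0 = renyi q (gibbs f) \<rho>0"
  define Rk where "Rk = renyi q (gibbs f) (prox_law f \<eta> \<rho>0 k)"
  define c0 where "c0 = ereal (68 * q / (s * L)) * (epowr R0 s - 1)"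
  have "(ereal (real k) \<le> c0 \<longrightarrow> Rk \<le> epowr (epowr R0 s - ereal (s * real k * L / (68 * q))) (1 / s))
     \<and> (c0 < \<infinity> \<and> int k \<ge> \<lceil>real_of_ereal c0\<rceil> \<longrightarrow>
          Rk \<le> ereal (1 / (1 + \<alpha> * \<eta>) powr (real_of_int (int k - \<lceil>real_of_ereal c0\<rceil>) / (68 * q))))"
  proof (cases "R0 = \<infinity>")
    case True
    then have "epowr R0 s = \<infinity>" by (simp add: epowr_def)
    then have "c0 = \<infinity>" using q s L by (auto simp: c0_def)
    then show ?thesis using \<open>epowr R0 s = \<infinity>\<close> by (simp add: epowr_def)
  next
    case False
    obtain h :: "'a \<Rightarrow> real" where h: "h \<in> borel_measurable borel" "\<And>x. h x \<ge> 0"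
        "\<rho>0 = density (gibbs f) (\<lambda>x. ennreal (h x))" "(\<integral>\<^sup>+x. ennreal (h x) \<partial>gibbs f) = 1"
        "(\<integral>\<^sup>+x. ennreal (h x powr q) \<partial>gibbs f) < \<infinity>"
      using density_of_finite_renyi[OF f assms(9,10) False[unfolded R0_def]] by blast
    then have hd: "finite_renyi_density q (gibbs f) h" by (simp add: finite_renyi_density_def)
    obtain h' where h': "finite_renyi_density q (gibbs f) h'"
        "prox_law f \<eta> \<rho>0 k = density (gibbs f) (\<lambda>x. ennreal (h' x))"
        "renyi_of_density q (gibbs f) h' > 0 \<Longrightarrow> renyi_of_density q (gibbs f) h > 0"
        "renyi_of_density q (gibbs f) h' > 0 \<Longrightarrow> decay_clock s (renyi_of_density q (gibbs f) h')
           \<le> decay_clock s (renyi_of_density q (gibbs f) h) - real k * L / (68 * q)"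
      using prox_law_decay[OF r \<alpha> f loi \<eta> q hd, of k] unfolding h(3)[symmetric] s_def L_def by blast
    define u where "u = renyi_of_density q (gibbs f) h"
    define v where "v = renyi_of_density q (gibbs f) h'"
    have R0: "R0 = ereal u"
      unfolding R0_def h(3) u_def renyi_of_density_def by (rule renyi_density[OF f h(1,2,5)])
    have Rk: "Rk = ereal v"
      unfolding Rk_def h'(2) v_def renyi_of_density_def
      by (rule renyi_density[OF f]) (use h'(1) in \<open>auto simp: finite_renyi_density_def\<close>)
    have v0: "v \<ge> 0" unfolding v_def by (rule renyi_of_density_nonneg[OF f q1 h'(1)])
    have decay: "decay_clock s v \<le> decay_clock s u - real k * L / (68 * q)" and u: "u > 0" if "v > 0"
      using h'(3,4) that unfolding u_def v_def by auto
    define e where "e = (u powr s - 1) / s"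
    define c where "c = 68 * q / L * e"
    have c0: "c0 = ereal c"
      using s L by (simp add: c0_def R0 epowr_def c_def e_def one_ereal_def)
    have clock: "decay_clock s v \<le> L / (68 * q) * (c - real k)" if "v > 0"
    proof -
      have "decay_clock s u \<le> e" unfolding e_def by (rule decay_clock_le[OF s u[OF that]])
      moreover have "L / (68 * q) * c = e" using L q by (simp add: c_def)
      ultimately show ?thesis
        using decay[OF that] by (simp add: right_diff_distrib diff_divide_distrib mult.commute)
    qed
    show ?thesis
    proof (intro conjI impI)
      assume "ereal (real k) \<le> c0"
      then have kc: "real k \<le> c" by (simp add: c0)
      define y where "y = L / (68 * q) * (c - real k)"
      have y: "y \<ge> 0" using kc L q by (simp add: y_def)
      have eq: "u powr s - s * real k * L / (68 * q) = 1 + s * y"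
      proof -
        have "s * (L / (68 * q) * c) = u powr s - 1" using L q s by (simp add: c_def e_def)
        then show ?thesis by (simp add: y_def right_diff_distrib diff_divide_distrib mult_ac)
      qed
      have "v \<le> (1 + s * y) powr (1 / s)"
      proof (cases "v > 0")
        case True
        then show ?thesis using clock by (intro le_of_decay_clock_le[OF s y]) (simp_all add: y_def)
      next
        case False
        then have "v = 0" using v0 by simp
        then show ?thesis by simp
      qed
      then show "Rk \<le> epowr (epowr R0 s - ereal (s * real k * L / (68 * q))) (1 / s)"
        by (simp add: Rk R0 epowr_def eq)
    next
      assume "c0 < \<infinity> \<and> int k \<ge> \<lceil>real_of_ereal c0\<rceil>"
      define n where "n = real_of_int (int k - \<lceil>c\<rceil>)"
      have n: "n \<le> real k - c" unfolding n_def using le_of_int_ceiling[of c] by simp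
      have rhs: "1 / (1 + \<alpha> * \<eta>) powr (n / (68 * q)) = exp (- (n / (68 * q) * L))"
      proof -
        have "(1 + \<alpha> * \<eta>) powr (n / (68 * q)) = exp (n / (68 * q) * L)"
          using \<alpha>\<eta> by (simp add: powr_def L_def)
        then show ?thesis by (simp only: exp_minus inverse_eq_divide)
      qed
      have "v \<le> exp (- (n / (68 * q) * L))"
      proof (cases "v > 0")
        case True
        have "n / (68 * q) * L = L / (68 * q) * n" by simp
        also have "\<dots> \<le> L / (68 * q) * (real k - c)" using n L q by (intro mult_left_mono) auto
        finally have "ln v \<le> - (n / (68 * q) * L)"
          using ln_le_decay_clock[OF s True] clock[OF True] by (simp add: right_diff_distrib)
        then show ?thesis using True by (metis exp_ln exp_le_cancel_iff)
      next
        case False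
        then have "v = 0" using v0 by simp
        then show ?thesis by simp
      qed
      then show "Rk \<le> ereal (1 / (1 + \<alpha> * \<eta>) powr (real_of_int (int k - \<lceil>real_of_ereal c0\<rceil>) / (68 * q)))"
        using rhs by (simp add: Rk c0 n_def)
    qed
  qed
  then show ?thesis
    unfolding Let_def inv_s R0_def Rk_def c0_def s_def L_def .
qed

end
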